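(* Let $X\subset Z$ be a compact $G$-stable subset, let $\mathfrak{a}\subset\mathfrak{p}$ be an abelian subalgebra and let $A=\exp(\mathfrak{a})$. Let $\mathscr{P}(X)$ be the space of Borel probability measures on $X$ with the weak topology, on which $A$ acts by push-forward, and let $\mathfrak{F}:\mathscr{P}(X)\to\mathfrak{a}$, $\mathfrak{F}(\nu)=\int_X\mu_{\mathfrak a}(x)\,d\nu(x)$. If $\nu\in\mathscr{P}(X)$, then: (a) $\mathfrak{F}(A\cdot\nu)$ is a convex set; (b) $\mathfrak{F}(\overline{A\cdot\nu})$ coincides with the convex hull of $\mathfrak{F}\big(\mathscr{P}(X)^A\cap\overline{A\cdot\nu}\big)$, where $\mathscr{P}(X)^A=\{\tilde\nu\in\mathscr{P}(X):\ A\cdot\tilde\nu=\tilde\nu\}$ is the set of $A$-invariant measures.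
   Context: $U$ is a compact connected Lie group with Lie algebra $\mathfrak{u}$ and complexification $U^{\mathbb{C}}$. $(Z,\omega)$ is a Kähler manifold on which $U^{\mathbb{C}}$ acts holomorphically, and $U$ acts in a Hamiltonian fashion with momentum map $\mu:Z\to\mathfrak{u}^*$: $\omega$ is $U$-invariant, $\mu$ is $U$-equivariant and $d\mu^\beta=i_{\beta_Z}\omega$ for all $\beta\in\mathfrak{u}$, where $\mu^\beta=\langle\mu,\beta\rangle$ and $\beta_Z$ is the fundamental vector field on $Z$ induced by $\beta$. (The Kähler metric is $\omega(\cdot,J\cdot)$, with $J$ the complex structure.) Fix a $U$-invariant scalar product $\langle\,,\,\rangle$ on $\mathfrak{u}$, identify $\mathfrak{u}\cong\mathfrak{u}^*$, and denote also by $\langle\,,\,\rangle$ the scalar product on $i\mathfrak{u}$ such that multiplication by $i$ is an isometry $\mathfrak{u}\to i\mathfrak{u}$. $G\subset U^{\mathbb{C}}$ is a closed connected compatible subgroup, i.e. $G=K\exp(\mathfrak{p})$ with $K=U\cap G$ and $\mathfrak{p}=\mathfrak{g}\cap i\mathfrak{u}$. For an abelian subalgebra $\mathfrak{a}\subset\mathfrak{p}$, the gradient map $\mu_{\mathfrak a}:Z\to\mathfrak{a}$ is defined by $\langle\mu_{\mathfrak a}(z),\beta\rangle=-\langle\mu(z),i\beta\rangle$ for all $\beta\in\mathfrak{a}$. The action of $A$ on $\mathscr{P}(X)$ is $(g,\nu)\mapsto g_*\nu$; $\mathscr{P}(X)$ with the weak topology (convergence against continuous functions on $X$) is a compact Hausdorff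 space, and closures are taken in it. *)

theory Defs
  imports "HOL-Probability.Probability" "HOL-Algebra.Group_Action"
begin

section \<open>Finite-dimensional model spaces\<close>

text \<open>
  Finite-dimensional real vector spaces with some norm. Unlike class \<open>euclidean_space\<close> this
  includes the zero space, so that the trivial group and discrete manifolds are not excluded.
  Completeness and separability are automatic in finite dimension; they are superclasses only so
  that the Bochner integral is available.
\<close>

class fin_dim_space = banach + second_countable_topology +
  assumes finite_spanning_set: "\<exists>B. finite B \<and> (\<forall>x. \<exists>c. x = (\<Sum>b\<in>B. c b *\<^sub>R b))"

instance euclidean_space \<subseteq> fin_dim_space
proof
  show "\<exists>B :: 'a set. finite B \<and> (\<forall>x. \<exists>c. x = (\<Sum>b\<in>B. c b *\<^sub>R b))"
    by (intro exI[of _ Basis] conjI allI finite_Basis) (metis euclidean_representation)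
qed

definition complex_structure :: "('e::real_vector \<Rightarrow> 'e) \<Rightarrow> bool" where
  "complex_structure J \<longleftrightarrow> linear J \<and> (\<forall>v. J (J v) = - v)"

section \<open>Smooth and holomorphic maps between open subsets of model spaces\<close>

text \<open>The set \<open>S\<close> is meant to be open in all of the following.\<close>

primrec Ck_on :: "nat \<Rightarrow> 'a::real_normed_vector set \<Rightarrow> ('a \<Rightarrow> 'b::real_normed_vector) \<Rightarrow> bool" where
  "Ck_on 0 S f \<longleftrightarrow> continuous_on S f"
| "Ck_on (Suc k) S f \<longleftrightarrow>
     (\<forall>x\<in>S. f differentiable (at x)) \<and> (\<forall>v. Ck_on k S (\<lambda>x. frechet_derivative f (at x) v))"

definition smooth_on :: "'a::real_normed_vector set \<Rightarrow> ('a \<Rightarrow> 'b::real_normed_vector) \<Rightarrow> bool" where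
  "smooth_on S f \<longleftrightarrow> (\<forall>k. Ck_on k S f)"

definition holo_on :: "('a \<Rightarrow> 'a) \<Rightarrow> ('b \<Rightarrow> 'b) \<Rightarrow> 'a::real_normed_vector set
    \<Rightarrow> ('a \<Rightarrow> 'b::real_normed_vector) \<Rightarrow> bool" where
  "holo_on J J' S f \<longleftrightarrow> smooth_on S f \<and>
     (\<forall>x\<in>S. \<forall>v. frechet_derivative f (at x) (J v) = J' (frechet_derivative f (at x) v))"

section \<open>Complex manifolds\<close>

text \<open>A chart is a domain together with a coordinate map (only its values on the domain matter).\<close>

type_synonym ('m, 'e) atlas = "('m set \<times> ('m \<Rightarrow> 'e)) set"

definition complex_manifold ::
    "('e \<Rightarrow> 'e) \<Rightarrow> ('m::{t2_space,second_countable_topology}, 'e::fin_dim_space) atlas \<Rightarrow> bool" where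
  "complex_manifold J \<A> \<longleftrightarrow>
     complex_structure J \<and>
     (\<Union>(fst ` \<A>)) = UNIV \<and>
     (\<forall>(D, \<phi>)\<in>\<A>. open D \<and> open (\<phi> ` D) \<and> homeomorphism D (\<phi> ` D) \<phi> (inv_into D \<phi>)) \<and>
     (\<forall>(D, \<phi>)\<in>\<A>. \<forall>(E, \<psi>)\<in>\<A>. holo_on J J (\<phi> ` (D \<inter> E)) (\<psi> \<circ> inv_into D \<phi>))"

definition prod_atlas :: "('m, 'e) atlas \<Rightarrow> ('n, 'f) atlas \<Rightarrow> ('m \<times> 'n, 'e \<times> 'f) atlas" where
  "prod_atlas \<A> \<B> = {(D \<times> E, map_prod \<phi> \<psi>) | D \<phi> E \<psi>. (D, \<phi>) \<in> \<A> \<and> (E, \<psi>) \<in> \<B>}"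

definition holo_map :: "('e \<Rightarrow> 'e) \<Rightarrow> ('m::topological_space, 'e::real_normed_vector) atlas
    \<Rightarrow> ('f \<Rightarrow> 'f) \<Rightarrow> ('n::topological_space, 'f::real_normed_vector) atlas
    \<Rightarrow> ('m \<Rightarrow> 'n) \<Rightarrow> bool" where
  "holo_map J \<A> J' \<B> f \<longleftrightarrow> continuous_on UNIV f \<and>
     (\<forall>(D, \<phi>)\<in>\<A>. \<forall>(E, \<psi>)\<in>\<B>. holo_on J J' (\<phi> ` (D \<inter> f -` E)) (\<psi> \<circ> f \<circ> inv_into D \<phi>))"

definition smooth_fun :: "('m, 'e::real_normed_vector) atlas \<Rightarrow> ('m \<Rightarrow> real) \<Rightarrow> bool" where
  "smooth_fun \<A> h \<longleftrightarrow> (\<forall>(D, \<phi>)\<in>\<A>. smooth_on (\<phi> ` D) (h \<circ> inv_into D \<phi>))"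

text \<open>
  A chart around each point is selected once and for all, and the tangent space at \<open>p\<close> is
  identified with the model space by means of the selected chart at \<open>p\<close>; under this identification
  the complex structure of every tangent space is \<open>J\<close>, because all charts are holomorphic.
\<close>

definition chart_at :: "('m, 'e) atlas \<Rightarrow> 'm \<Rightarrow> 'm set \<times> ('m \<Rightarrow> 'e)" where
  "chart_at \<A> p = (SOME c. c \<in> \<A> \<and> p \<in> fst c)"

definition coord :: "('m, 'e) atlas \<Rightarrow> 'm \<Rightarrow> 'm \<Rightarrow> 'e" where
  "coord \<A> p = snd (chart_at \<A> p)"

definition coord_inv :: "('m, 'e) atlas \<Rightarrow> 'm \<Rightarrow> 'e \<Rightarrow> 'm" where
  "coord_inv \<A> p = inv_into (fst (chart_at \<A> p)) (snd (chart_at \<A> p))"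

definition tangent_map :: "('m, 'e::real_normed_vector) atlas \<Rightarrow> ('n, 'f::real_normed_vector) atlas
    \<Rightarrow> ('m \<Rightarrow> 'n) \<Rightarrow> 'm \<Rightarrow> 'e \<Rightarrow> 'f" where
  "tangent_map \<A> \<B> f p =
     frechet_derivative (coord \<B> (f p) \<circ> f \<circ> coord_inv \<A> p) (at (coord \<A> p p))"

definition differential :: "('m, 'e::real_normed_vector) atlas \<Rightarrow> ('m \<Rightarrow> real) \<Rightarrow> 'm \<Rightarrow> 'e \<Rightarrow> real" where
  "differential \<A> h p = frechet_derivative (h \<circ> coord_inv \<A> p) (at (coord \<A> p p))"

section \<open>Kaehler manifolds\<close>

text \<open>
  \<open>coord_form \<A> \<omega> (D, \<phi>) y v w\<close> is the coefficient at \<open>y \<in> \<phi> ` D\<close> of the two-form \<open>\<omega>\<close> on the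
  constant coordinate fields \<open>v\<close>, \<open>w\<close> of the chart \<open>(D, \<phi>)\<close>. The derivative translates from that
  chart to the selected one.
\<close>

definition coord_form :: "('m, 'e::real_normed_vector) atlas \<Rightarrow> ('m \<Rightarrow> 'e \<Rightarrow> 'e \<Rightarrow> real)
    \<Rightarrow> 'm set \<times> ('m \<Rightarrow> 'e) \<Rightarrow> 'e \<Rightarrow> 'e \<Rightarrow> 'e \<Rightarrow> real" where
  "coord_form \<A> \<omega> c y v w =
     (let p = inv_into (fst c) (snd c) y;
          T = frechet_derivative (coord \<A> p \<circ> inv_into (fst c) (snd c)) (at y)
      in \<omega> p (T v) (T w))"

text \<open>
  The last conjunct but one is \<open>d\<omega> = 0\<close>, evaluated on constant coordinate fields (whose brackets
  vanish); the last one says that \<open>\<omega>(\<cdot>, J \<cdot>)\<close> is a Hermitian (with respect to \<open>J\<close>) Riemannian metric.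
\<close>

definition kaehler_manifold :: "('e \<Rightarrow> 'e)
    \<Rightarrow> ('m::{t2_space,second_countable_topology}, 'e::fin_dim_space) atlas
    \<Rightarrow> ('m \<Rightarrow> 'e \<Rightarrow> 'e \<Rightarrow> real) \<Rightarrow> bool" where
  "kaehler_manifold J \<A> \<omega> \<longleftrightarrow>
     complex_manifold J \<A> \<and>
     (\<forall>z. bilinear (\<omega> z) \<and> (\<forall>v w. \<omega> z v w = - \<omega> z w v)) \<and>
     (\<forall>c\<in>\<A>. \<forall>v w. smooth_on (snd c ` fst c) (\<lambda>y. coord_form \<A> \<omega> c y v w)) \<and>
     (\<forall>c\<in>\<A>. \<forall>y\<in>snd c ` fst c. \<forall>u v w.
        frechet_derivative (\<lambda>y. coord_form \<A> \<omega> c y v w) (at y) u +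
        frechet_derivative (\<lambda>y. coord_form \<A> \<omega> c y w u) (at y) v +
        frechet_derivative (\<lambda>y. coord_form \<A> \<omega> c y u v) (at y) w = 0) \<and>
     (\<forall>z. (\<forall>v w. \<omega> z (J v) (J w) = \<omega> z v w) \<and> (\<forall>v. v \<noteq> 0 \<longrightarrow> \<omega> z v (J v) > 0))"

section \<open>Complex Lie groups, Lie algebras, complexification\<close>

definition complex_lie_group :: "('l \<Rightarrow> 'l)
    \<Rightarrow> ('g::{t2_space,second_countable_topology}, 'l::fin_dim_space) atlas \<Rightarrow> 'g monoid \<Rightarrow> bool" where
  "complex_lie_group J \<A> H \<longleftrightarrow>
     group H \<and> carrier H = UNIV \<and> complex_manifold J \<A> \<and>
     holo_map (map_prod J J) (prod_atlas \<A> \<A>) J \<A> (\<lambda>(x, y). x \<otimes>\<^bsub>H\<^esub> y) \<and>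
     holo_map J \<A> J \<A> (\<lambda>x. inv\<^bsub>H\<^esub> x)"

text \<open>
  The Lie algebra of \<open>H\<close> is the tangent space at the identity, i.e. the model space via the selected
  chart there. \<open>one_param \<A> H \<gamma> \<xi>\<close>: \<open>\<gamma>\<close> is a one-parameter subgroup with initial velocity \<open>\<xi>\<close>.
\<close>

definition one_param :: "('g::topological_space, 'l::real_normed_vector) atlas \<Rightarrow> 'g monoid
    \<Rightarrow> (real \<Rightarrow> 'g) \<Rightarrow> 'l \<Rightarrow> bool" where
  "one_param \<A> H \<gamma> \<xi> \<longleftrightarrow>
     continuous_on UNIV \<gamma> \<and> (\<forall>s t. \<gamma> (s + t) = \<gamma> s \<otimes>\<^bsub>H\<^esub> \<gamma> t) \<and>
     (coord \<A> \<one>\<^bsub>H\<^esub> \<circ> \<gamma> has_vector_derivative \<xi>) (at 0)"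

definition lie_exp :: "('g::topological_space, 'l::real_normed_vector) atlas \<Rightarrow> 'g monoid
    \<Rightarrow> 'l \<Rightarrow> 'g" where
  "lie_exp \<A> H \<xi> = (THE \<gamma>. one_param \<A> H \<gamma> \<xi>) 1"

text \<open>Lie algebra of a closed subgroup \<open>S\<close> of \<open>H\<close>.\<close>

definition lie_algebra :: "('g::topological_space, 'l::real_normed_vector) atlas \<Rightarrow> 'g monoid
    \<Rightarrow> 'g set \<Rightarrow> 'l set" where
  "lie_algebra \<A> H S = {\<xi>. \<exists>\<gamma>. one_param \<A> H \<gamma> \<xi> \<and> range \<gamma> \<subseteq> S}"

definition Ad :: "('g, 'l::real_normed_vector) atlas \<Rightarrow> 'g monoid \<Rightarrow> 'g \<Rightarrow> 'l \<Rightarrow> 'l" where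
  "Ad \<A> H g = tangent_map \<A> \<A> (\<lambda>x. g \<otimes>\<^bsub>H\<^esub> x \<otimes>\<^bsub>H\<^esub> inv\<^bsub>H\<^esub> g) \<one>\<^bsub>H\<^esub>"

definition lie_bracket :: "('g::topological_space, 'l::real_normed_vector) atlas \<Rightarrow> 'g monoid
    \<Rightarrow> 'l \<Rightarrow> 'l \<Rightarrow> 'l" where
  "lie_bracket \<A> H \<xi> \<eta> =
     vector_derivative (\<lambda>t. Ad \<A> H (lie_exp \<A> H (t *\<^sub>R \<xi>)) \<eta>) (at 0)"

text \<open>
  \<open>H\<close> is the complexification of the compact subgroup \<open>U\<close>: its Lie algebra is the direct sum of
  \<open>\<u>\<close> and \<open>i\<u>\<close>, and polar decomposition \<open>(k, \<xi>) \<mapsto> k exp(i\<xi>)\<close> identifies \<open>U \<times> \<u>\<close> with \<open>H\<close>. This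
  determines \<open>H\<close> up to isomorphism; the universal property itself quantifies over all complex Lie
  groups and hence over types.
\<close>

definition is_complexification :: "('l \<Rightarrow> 'l)
    \<Rightarrow> ('g::{t2_space,second_countable_topology}, 'l::fin_dim_space) atlas
    \<Rightarrow> 'g monoid \<Rightarrow> 'g set \<Rightarrow> bool" where
  "is_complexification J \<A> H U \<longleftrightarrow>
     complex_lie_group J \<A> H \<and> subgroup U H \<and>
     (\<forall>\<zeta>. \<exists>!(\<xi>, \<eta>). \<xi> \<in> lie_algebra \<A> H U \<and> \<eta> \<in> lie_algebra \<A> H U \<and> \<zeta> = \<xi> + J \<eta>) \<and>
     (\<exists>h. homeomorphism (U \<times> lie_algebra \<A> H U) UNIV
            (\<lambda>(k, \<xi>). k \<otimes>\<^bsub>H\<^esub> lie_exp \<A> H (J \<xi>)) h)"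

section \<open>Compatible subgroups\<close>

definition compat_p :: "('l \<Rightarrow> 'l) \<Rightarrow> ('g::topological_space, 'l::real_normed_vector) atlas
    \<Rightarrow> 'g monoid \<Rightarrow> 'g set \<Rightarrow> 'g set \<Rightarrow> 'l set" where
  "compat_p J \<A> H U G = lie_algebra \<A> H G \<inter> J ` lie_algebra \<A> H U"

definition compatible_subgroup :: "('l \<Rightarrow> 'l) \<Rightarrow> ('g::topological_space, 'l::real_normed_vector) atlas
    \<Rightarrow> 'g monoid \<Rightarrow> 'g set \<Rightarrow> 'g set \<Rightarrow> bool" where
  "compatible_subgroup J \<A> H U G \<longleftrightarrow>
     subgroup G H \<and> G = (U \<inter> G) <#>\<^bsub>H\<^esub> (lie_exp \<A> H ` compat_p J \<A> H U G)"

definition abelian_subalgebra :: "('g::topological_space, 'l::real_normed_vector) atlas \<Rightarrow> 'g monoid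
    \<Rightarrow> 'l set \<Rightarrow> bool" where
  "abelian_subalgebra \<A> H \<aa> \<longleftrightarrow>
     subspace \<aa> \<and> (\<forall>\<xi>\<in>\<aa>. \<forall>\<eta>\<in>\<aa>. lie_bracket \<A> H \<xi> \<eta> = 0)"

section \<open>Hamiltonian actions and gradient maps\<close>

definition functional_on :: "'l::real_vector set \<Rightarrow> ('l \<Rightarrow> real) \<Rightarrow> bool" where
  "functional_on V f \<longleftrightarrow>
     (\<forall>x\<in>V. \<forall>y\<in>V. f (x + y) = f x + f y) \<and> (\<forall>c. \<forall>x\<in>V. f (c *\<^sub>R x) = c * f x)"

definition invariant_scalar_product :: "('g::topological_space, 'l::real_normed_vector) atlas
    \<Rightarrow> 'g monoid \<Rightarrow> 'g set \<Rightarrow> ('l \<Rightarrow> 'l \<Rightarrow> real) \<Rightarrow> bool" where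
  "invariant_scalar_product \<A> H U ip \<longleftrightarrow>
     (let \<uu> = lie_algebra \<A> H U in
       (\<forall>\<eta>\<in>\<uu>. functional_on \<uu> (\<lambda>\<xi>. ip \<xi> \<eta>)) \<and>
       (\<forall>\<xi>\<in>\<uu>. \<forall>\<eta>\<in>\<uu>. ip \<xi> \<eta> = ip \<eta> \<xi>) \<and>
       (\<forall>\<xi>\<in>\<uu>. \<xi> \<noteq> 0 \<longrightarrow> ip \<xi> \<xi> > 0) \<and>
       (\<forall>g\<in>U. \<forall>\<xi>\<in>\<uu>. \<forall>\<eta>\<in>\<uu>. ip (Ad \<A> H g \<xi>) (Ad \<A> H g \<eta>) = ip \<xi> \<eta>))"

text \<open>Scalar product on \<open>i\<u>\<close> making \<open>J : \<u> \<rightarrow> i\<u>\<close> an isometry; note \<open>- J \<beta> = \<xi>\<close> for \<open>\<beta> = J \<xi>\<close>.\<close>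

definition iu_scalar_product :: "('l \<Rightarrow> 'l) \<Rightarrow> ('l \<Rightarrow> 'l \<Rightarrow> real) \<Rightarrow> 'l::ab_group_add \<Rightarrow> 'l \<Rightarrow> real" where
  "iu_scalar_product J ip \<alpha> \<beta> = ip (- J \<alpha>) (- J \<beta>)"

definition holomorphic_action :: "('l \<Rightarrow> 'l) \<Rightarrow> ('g::topological_space, 'l::real_normed_vector) atlas
    \<Rightarrow> 'g monoid \<Rightarrow> ('e \<Rightarrow> 'e) \<Rightarrow> ('z::topological_space, 'e::real_normed_vector) atlas
    \<Rightarrow> ('g \<Rightarrow> 'z \<Rightarrow> 'z) \<Rightarrow> bool" where
  "holomorphic_action JH \<A> H JZ \<B> act \<longleftrightarrow>
     group_action H UNIV act \<and>
     holo_map (map_prod JH JZ) (prod_atlas \<A> \<B>) JZ \<B> (\<lambda>(g, z). act g z)"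

definition fundamental_field :: "('g::topological_space, 'l::real_normed_vector) atlas \<Rightarrow> 'g monoid
    \<Rightarrow> ('z, 'e::real_normed_vector) atlas \<Rightarrow> ('g \<Rightarrow> 'z \<Rightarrow> 'z) \<Rightarrow> 'l \<Rightarrow> 'z \<Rightarrow> 'e" where
  "fundamental_field \<A> H \<B> act \<xi> z =
     vector_derivative (\<lambda>t. coord \<B> z (act (lie_exp \<A> H (t *\<^sub>R \<xi>)) z)) (at 0)"

text \<open>
  A momentum map assigns to each point a linear functional on \<open>\<u>\<close>; \<open>\<mu> z \<beta>\<close> is \<open>\<mu>\<^sup>\<beta>(z)\<close>, and only
  \<open>\<beta> \<in> \<u>\<close> matters. Equivariance is with respect to the coadjoint action
  \<open>(g \<cdot> f) \<beta> = f (Ad (g\<inverse>) \<beta>)\<close>.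
\<close>

definition hamiltonian_action :: "('g::topological_space, 'l::real_normed_vector) atlas \<Rightarrow> 'g monoid
    \<Rightarrow> 'g set \<Rightarrow> ('z, 'e::real_normed_vector) atlas \<Rightarrow> ('z \<Rightarrow> 'e \<Rightarrow> 'e \<Rightarrow> real)
    \<Rightarrow> ('g \<Rightarrow> 'z \<Rightarrow> 'z) \<Rightarrow> ('z \<Rightarrow> 'l \<Rightarrow> real) \<Rightarrow> bool" where
  "hamiltonian_action \<A> H U \<B> \<omega> act \<mu> \<longleftrightarrow>
     (let \<uu> = lie_algebra \<A> H U in
       (\<forall>g\<in>U. \<forall>z v w.
          \<omega> (act g z) (tangent_map \<B> \<B> (act g) z v) (tangent_map \<B> \<B> (act g) z w) = \<omega> z v w) \<and>
       (\<forall>z. functional_on \<uu> (\<mu> z)) \<and>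
       (\<forall>\<beta>\<in>\<uu>. smooth_fun \<B> (\<lambda>z. \<mu> z \<beta>)) \<and>
       (\<forall>g\<in>U. \<forall>z. \<forall>\<beta>\<in>\<uu>. \<mu> (act g z) \<beta> = \<mu> z (Ad \<A> H (inv\<^bsub>H\<^esub> g) \<beta>)) \<and>
       (\<forall>\<beta>\<in>\<uu>. \<forall>z v.
          differential \<B> (\<lambda>z. \<mu> z \<beta>) z v = \<omega> z (fundamental_field \<A> H \<B> act \<beta> z) v))"

definition gradient_map :: "('l \<Rightarrow> 'l) \<Rightarrow> ('l \<Rightarrow> 'l \<Rightarrow> real) \<Rightarrow> ('z \<Rightarrow> 'l \<Rightarrow> real)
    \<Rightarrow> 'l::ab_group_add set \<Rightarrow> 'z \<Rightarrow> 'l" where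
  "gradient_map J ip \<mu> \<aa> z =
     (THE \<alpha>. \<alpha> \<in> \<aa> \<and> (\<forall>\<beta>\<in>\<aa>. iu_scalar_product J ip \<alpha> \<beta> = - \<mu> z (J \<beta>)))"

section \<open>Borel probability measures on a subset\<close>

definition prob_measures :: "'z::topological_space set \<Rightarrow> 'z measure set" where
  "prob_measures X = {\<nu>. prob_space \<nu> \<and> sets \<nu> = sets (restrict_space borel X)}"

text \<open>The coarsest topology for which integration of every continuous function is continuous.\<close>

definition weak_topology :: "'z::topological_space set \<Rightarrow> 'z measure topology" where
  "weak_topology X = topology_generated_by
     {{\<nu> \<in> prob_measures X. (\<integral>x. f x \<partial>\<nu>) \<in> W} | (f :: 'z \<Rightarrow> real) W. continuous_on X f \<and> open W}"

definition push_forward :: "'z::topological_space set \<Rightarrow> ('g \<Rightarrow> 'z \<Rightarrow> 'z) \<Rightarrow> 'g \<Rightarrow> 'z measure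
    \<Rightarrow> 'z measure" where
  "push_forward X act g \<nu> = distr \<nu> (restrict_space borel X) (act g)"

definition measure_orbit :: "'z::topological_space set \<Rightarrow> ('g \<Rightarrow> 'z \<Rightarrow> 'z) \<Rightarrow> 'g set \<Rightarrow> 'z measure
    \<Rightarrow> 'z measure set" where
  "measure_orbit X act A \<nu> = (\<lambda>g. push_forward X act g \<nu>) ` A"

definition invariant_measures :: "'z::topological_space set \<Rightarrow> ('g \<Rightarrow> 'z \<Rightarrow> 'z) \<Rightarrow> 'g set
    \<Rightarrow> 'z measure set" where
  "invariant_measures X act A = {\<nu> \<in> prob_measures X. \<forall>g\<in>A. push_forward X act g \<nu> = \<nu>}"

definition mean_gradient :: "('l \<Rightarrow> 'l) \<Rightarrow> ('l \<Rightarrow> 'l \<Rightarrow> real) \<Rightarrow> ('z \<Rightarrow> 'l \<Rightarrow> real)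
    \<Rightarrow> 'l::{banach,second_countable_topology} set \<Rightarrow> 'z measure \<Rightarrow> 'l" where
  "mean_gradient J ip \<mu> \<aa> \<nu> = (\<integral>x. gradient_map J ip \<mu> \<aa> x \<partial>\<nu>)"

end

theory Submission
  imports Defs
begin

text \<open>
  The one-parameter groups \<open>exp(t\<beta>)\<close>, \<open>\<beta> \<in> \<aa>\<close>, act on \<open>X\<close> as gradient flows of the components
  \<open>\<mu>\<^sub>\<aa>\<^sup>\<beta>\<close>, so these increase along the flow, and strictly so at points that are not fixed. Hence
  \<open>\<beta> \<mapsto> \<FF>(exp(\<beta>)\<nu>)\<close> is a bounded, continuous, monotone map \<open>F\<close> from \<open>\<aa>\<close> to itself which is strictly
  monotone modulo the subspace \<open>N\<close> of those \<open>\<beta>\<close> whose flow fixes \<open>\<nu>\<close>-almost every point. For a convex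
  combination \<open>y\<close> of two values, boundedness and strictness make \<open>F - y\<close> point outwards on large
  spheres, and Brouwer's theorem gives a preimage of \<open>y\<close>; no potential for \<open>F\<close> is needed.

  For the second part, compactness of \<open>\<P>(X)\<close> shows that the image of the orbit closure is compact
  and convex. If an extreme point is the image of \<open>\<nu>'\<close>, it is also an extreme point of the convex image
  of the orbit of \<open>\<nu>'\<close>. By strict monotonicity the normal of a supporting hyperplane at that point
  lies in \<open>N\<close>, so the point is in the relative interior of the image, which is then a single point;
  hence \<open>N = \<aa>\<close>, and \<open>\<nu>'\<close> is invariant. The theorem of Minkowski concludes.
\<close>

section \<open>Linear maps on finite-dimensional model spaces\<close>

text \<open>Brouwer's theorem, relative interiors and Minkowski's theorem are used in a Euclidean
  space, whereas \<aa> is a subspace of a bare normed space, with a scalar product that is one only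
  on part of it. The analysis therefore runs on \<open>real^'l coord_index\<close>, mapped linearly
  onto \<aa> by a map \<open>P\<close> that is not injective. Its kernel does no harm: such
  directions move no point and join the null directions, which stabilisers force the convexity
  argument to admit anyway. Since \<open>F\<close> gives no outward push along null directions, a
  term that is positive definite on them is added before Brouwer's theorem is applied, and it turns
  out to vanish at the zero that is found. Monotonicity rests on one formula: along the flow of
  \<beta>, holomorphy of the action and the momentum identity make the derivative of the component
  equal to \<omega>(v, Jv), the squared speed. That A is an image of a vector group takes more work.
  Vanishing brackets only say that Ad along a one-parameter subgroup has derivative zero at time
  zero, once it is known to be differentiable there, and this needs second derivatives of the
  multiplication. Means lie in finite dimension, so weak limits are needed only along
  sequences.\<close>

definition model_basis :: "'a::fin_dim_space set" where
  "model_basis = (SOME B. independent B \<and> finite B \<and> span B = UNIV)"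

lemma model_basis:
  shows independent_model_basis: "independent (model_basis :: 'a::fin_dim_space set)"
    and finite_model_basis: "finite (model_basis :: 'a set)"
    and span_model_basis: "span (model_basis :: 'a set) = UNIV"
proof -
  obtain S :: "'a set" where S: "finite S" "\<And>x. \<exists>c. x = (\<Sum>b\<in>S. c b *\<^sub>R b)"
    using finite_spanning_set by blast
  have "x \<in> span S" for x
  proof -
    obtain c where "x = (\<Sum>b\<in>S. c b *\<^sub>R b)" using S(2) by blast
    then show ?thesis by (auto intro: span_sum span_scale span_base)
  qed
  then have spS: "span S = UNIV" by auto
  obtain B where B: "B \<subseteq> S" "independent B" "S \<subseteq> span B"
    using maximal_independent_subset[of S] by blast
  have "span B = UNIV"
    using span_minimal[OF B(3) subspace_span] spS by auto
  then have "\<exists>B :: 'a set. independent B \<and> finite B \<and> span B = UNIV"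
    using B S(1) finite_subset by blast
  from someI_ex[OF this]
  show "independent (model_basis :: 'a set)" "finite (model_basis :: 'a set)"
    "span (model_basis :: 'a set) = UNIV"
    unfolding model_basis_def by blast+
qed

text \<open>A type must be inhabited, but the model space may be zero and its basis empty; hence the
  extra element 0. There is thus one index more than the dimension, and the coordinate of this dummy
  index has to be controlled separately.\<close>

typedef (overloaded) 'a coord_index = "insert (0 :: 'a::fin_dim_space) model_basis"
  by blast

instance coord_index :: (fin_dim_space) finite
proof
  have "(UNIV :: 'a coord_index set) = Abs_coord_index ` insert 0 model_basis"
    by (metis type_definition.Abs_image type_definition_coord_index)
  then show "finite (UNIV :: 'a coord_index set)"
    using finite_model_basis by (metis finite.insertI finite_imageI)
qed

text \<open>Serves to inject an orthonormal set of a subspace into the index type.\<close>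

lemma card_independent_le_coord_index:
  fixes B :: "'a::fin_dim_space set"
  assumes "independent B"
  shows "finite B \<and> card B \<le> CARD('a coord_index)"
proof -
  have 1: "finite B \<and> card B \<le> card (model_basis :: 'a set)"
    using independent_span_bound[OF finite_model_basis assms] span_model_basis by blast
  have "card (model_basis :: 'a set) \<le> card (insert (0::'a) model_basis)"
    by (simp add: card_insert_le finite_model_basis)
  also have "\<dots> = CARD('a coord_index)"
    by (simp add: type_definition.card[OF type_definition_coord_index])
  finally show ?thesis using 1 by linarith
qed

lemma bounded_linear_coord_sum:
  fixes f :: "'i::finite \<Rightarrow> 'b::real_normed_vector"
  shows "bounded_linear (\<lambda>t::real^'i. \<Sum>i\<in>UNIV. t $ i *\<^sub>R f i)"
  by (intro bounded_linear_sum bounded_linear_scaleR_left[THEN bounded_linear_compose]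
      bounded_linear_vec_nth)

text \<open>After composition with the coordinate map \<open>R\<close>, \<open>f\<close> becomes an
  explicit finite sum and is clearly bounded. To descend again, coordinates must be bounded by the
  norm of the vector; this is the usual compactness argument on the unit sphere, where the norm of
  \<open>R\<close> attains a positive minimum.\<close>

lemma linear_imp_bounded_linear:
  fixes f :: "'a::fin_dim_space \<Rightarrow> 'b::real_normed_vector"
  assumes "linear f"
  shows "bounded_linear f"
proof -
  define R :: "real^'a coord_index \<Rightarrow> 'a" where
    "R t = (\<Sum>i\<in>UNIV. t $ i *\<^sub>R Rep_coord_index i)" for t
  \<comment> \<open>On this slice the dummy coordinate is zero, which is what makes \<open>R\<close>
    injective.\<close>
  define S where "S = {t :: real^'a coord_index. t $ (Abs_coord_index 0) = 0}"
  define K where "K = S \<inter> sphere 0 1"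
  interpret R: bounded_linear R
    unfolding R_def by (rule bounded_linear_coord_sum)
  have Rep0: "Rep_coord_index (Abs_coord_index (0::'a)) = 0"
    by (simp add: Abs_coord_index_inverse)
  have Rsum: "R t = (\<Sum>b\<in>model_basis. t $ Abs_coord_index b *\<^sub>R b)" for t
  proof -
    have "R t = (\<Sum>b\<in>insert 0 model_basis. t $ Abs_coord_index b *\<^sub>R b)"
      unfolding R_def
      by (rule sum.reindex_bij_witness[where i = Abs_coord_index and j = Rep_coord_index])
        (use Rep_coord_index in \<open>auto simp: Rep_coord_index_inverse Abs_coord_index_inverse\<close>)
    also have "\<dots> = (\<Sum>b\<in>model_basis. t $ Abs_coord_index b *\<^sub>R b)"
      by (rule sum.mono_neutral_right) (auto simp: finite_model_basis)
    finally show ?thesis .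
  qed
  have surj: "\<exists>t\<in>S. R t = x" for x
  proof -
    have "x \<in> range (\<lambda>c. \<Sum>b\<in>model_basis. c b *\<^sub>R b)"
      unfolding span_finite[OF finite_model_basis, symmetric] span_model_basis by simp
    then obtain c where c: "x = (\<Sum>b\<in>model_basis. c b *\<^sub>R b)" by blast
    define t where "t = (\<chi> i. if Rep_coord_index i = (0::'a) then 0 else c (Rep_coord_index i))"
    have "0 \<notin> (model_basis :: 'a set)" using independent_model_basis dependent_zero by blast
    then have "R t = x"
      unfolding Rsum c t_def
      by (intro sum.cong) (auto simp: Abs_coord_index_inverse)
    moreover have "t \<in> S" unfolding S_def t_def using Rep0 by auto
    ultimately show ?thesis by blast
  qed
  have inj: "t = 0" if "t \<in> S" "R t = 0" for t
  proof -
    have z: "t $ Abs_coord_index b = 0" if "b \<in> model_basis" for b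
      using independent_model_basis \<open>R t = 0\<close> that finite_model_basis
      unfolding Rsum independent_explicit_finite_subsets by (metis (full_types) order_refl)
    have "t $ i = 0" for i
      using z[of "Rep_coord_index i"] \<open>t \<in> S\<close> Rep_coord_index[of i] unfolding S_def
      by (auto simp: Rep_coord_index_inverse) (metis Rep_coord_index_inverse)
    then show ?thesis by (simp add: vec_eq_iff)
  qed
  have subS: "subspace S" unfolding S_def subspace_def by auto
  have "\<exists>m>0. \<forall>t\<in>S. m * norm t \<le> norm (R t)"
  proof (cases "K = {}")
    \<comment> \<open>No unit vectors means that \<open>S\<close> is trivial, as for the zero space,
      so any constant works.\<close>
    case True
    have "t = 0" if "t \<in> S" for t
    proof (rule ccontr)
      assume "t \<noteq> 0"
      then have "(1 / norm t) *\<^sub>R t \<in> K"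
        unfolding K_def using subspace_scale[OF subS that] by auto
      with True show False by auto
    qed
    then have "\<forall>t\<in>S. 1 * norm t \<le> norm (R t)" by fastforce
    then show ?thesis using zero_less_one by blast
  next
    case False
    have "closed S" using subS by (rule closed_subspace)
    then have "compact K" unfolding K_def
      by (metis compact_sphere closed_Int_compact)
    then obtain u where u: "u \<in> K" "\<And>v. v \<in> K \<Longrightarrow> norm (R u) \<le> norm (R v)"
      using continuous_attains_inf[of K "\<lambda>v. norm (R v)"] False
        continuous_on_norm[OF R.continuous_on[OF continuous_on_id], of K] by blast
    have "norm (R u) > 0" using u(1) inj[of u] unfolding K_def by fastforce
    moreover have "norm (R u) * norm t \<le> norm (R t)" if t: "t \<in> S" for t
    proof (cases "t = 0")
      case False
      have "(1 / norm t) *\<^sub>R t \<in> K"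
        unfolding K_def using subspace_scale[OF subS t] False by auto
      from u(2)[OF this] show ?thesis using False by (simp add: R.scaleR field_simps)
    qed auto
    ultimately show ?thesis by blast
  qed
  then obtain m where m: "m > 0" "\<And>t. t \<in> S \<Longrightarrow> m * norm t \<le> norm (R t)" by blast
  interpret f: linear f by fact
  interpret fR: bounded_linear "\<lambda>t. f (R t)"
  proof -
    have "f (R t) = (\<Sum>i\<in>UNIV. t $ i *\<^sub>R f (Rep_coord_index i))" for t
      unfolding R_def by (simp add: f.sum f.scale)
    then show "bounded_linear (\<lambda>t. f (R t))"
      using bounded_linear_coord_sum[of "\<lambda>i. f (Rep_coord_index i)"] by (simp only:)
  qed
  obtain k where k: "k > 0" "\<And>t. norm (f (R t)) \<le> norm t * k"
    using fR.pos_bounded by blast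
  show ?thesis
  proof (intro bounded_linear.intro[OF assms] bounded_linear_axioms.intro exI[of _ "k / m"] allI)
    fix x
    obtain t where t: "t \<in> S" "R t = x" using surj by blast
    have "norm (f x) \<le> norm t * k" using k(2)[of t] t by simp
    also have "\<dots> \<le> (norm x / m) * k"
      using m(2)[OF t(1)] t(2) m(1) k(1) by (intro mult_right_mono) (auto simp: field_simps)
    finally show "norm (f x) \<le> norm x * (k / m)" by simp
  qed
qed

section \<open>Monotone vector fields\<close>

text \<open>If \<open>G\<close> had no zero, sending \<open>x\<close> to the point of the sphere
  opposite to the direction of \<open>G x\<close> would be a continuous self-map of the ball. A
  Brouwer fixed point would lie on the sphere with \<open>G\<close> pointing strictly inwards there,
  against \<open>out\<close>.\<close>

lemma inward_vector_field_zero: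
  fixes G :: "'a::euclidean_space \<Rightarrow> 'a"
  assumes cont: "continuous_on UNIV G" and T: "T > 0"
    and out: "\<And>x. norm x = T \<Longrightarrow> G x \<bullet> x \<ge> 0"
  shows "\<exists>x. G x = 0"
proof (rule ccontr)
  assume "\<nexists>x. G x = 0"
  then have nz: "G x \<noteq> 0" for x by blast
  define f where "f x = (- T / norm (G x)) *\<^sub>R G x" for x
  have nf: "norm (f x) = T" for x unfolding f_def using nz[of x] T by simp
  have "continuous_on (cball 0 T) f"
    unfolding f_def using nz cont
    by (intro continuous_intros) (auto intro: continuous_on_subset)
  moreover have "f \<in> cball 0 T \<rightarrow> cball 0 T" using nf by auto
  ultimately obtain x where x: "f x = x"
    using brouwer[of "cball 0 T" f] T by auto
  then have "norm x = T" using nf by metis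
  from out[OF this] have "0 \<le> G x \<bullet> f x" using x by simp
  also have "G x \<bullet> f x = - T * norm (G x)"
    unfolding f_def using nz[of x] by (simp add: power2_norm_eq_inner[symmetric] power2_eq_square)
  also have "\<dots> < 0" using T nz[of x] by simp
  finally show False by simp
qed

text \<open>Positivity at radius \<open>t u\<close> is an open condition on the direction, so
  finitely many radii serve all directions; radial monotonicity carries positivity outwards to the
  largest of them.\<close>

lemma compact_uniform_radius:
  fixes G :: "'a::euclidean_space \<Rightarrow> 'a"
  assumes cont: "continuous_on UNIV G"
    and mono: "\<And>u r s. norm u = 1 \<Longrightarrow> 0 < r \<Longrightarrow> r \<le> s \<Longrightarrow> G (r *\<^sub>R u) \<bullet> u \<le> G (s *\<^sub>R u) \<bullet> u"
    and ex: "\<And>u. norm u = 1 \<Longrightarrow> \<exists>t>0. G (t *\<^sub>R u) \<bullet> u > 0"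
  shows "\<exists>T>0. \<forall>x. norm x = T \<longrightarrow> G x \<bullet> x \<ge> 0"
proof -
  obtain t where t: "\<And>u. norm u = 1 \<Longrightarrow> t u > 0 \<and> G (t u *\<^sub>R u) \<bullet> u > 0"
    using ex by metis
  define V where "V u = {v. G (t u *\<^sub>R v) \<bullet> v > 0}" for u
  have opV: "open (V u)" for u
    unfolding V_def
    by (intro open_Collect_less continuous_intros continuous_on_compose2[OF cont]) auto
  have "sphere (0::'a) 1 \<subseteq> (\<Union>u\<in>sphere 0 1. V u)"
    using t unfolding V_def by auto
  then obtain F where F: "F \<subseteq> sphere 0 1" "finite F" "sphere (0::'a) 1 \<subseteq> (\<Union>u\<in>F. V u)"
    using compactE_image[OF compact_sphere, of "sphere 0 1" V] opV by metis
  \<comment> \<open>The 1 guarantees a nonempty set and a positive radius without any case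
    distinction on \<open>F\<close>.\<close>
  define T where "T = Max (insert 1 (t ` F))"
  have T: "T > 0" "\<And>u. u \<in> F \<Longrightarrow> t u \<le> T"
    unfolding T_def using F(2) by (auto simp: Max_gr_iff)
  have "G x \<bullet> x \<ge> 0" if x: "norm x = T" for x
  proof -
    define v where "v = (1 / T) *\<^sub>R x"
    have nv: "norm v = 1" and xv: "x = T *\<^sub>R v" unfolding v_def using x T(1) by auto
    then obtain u where u: "u \<in> F" "v \<in> V u" using F(3) by auto
    have "0 < G (t u *\<^sub>R v) \<bullet> v" using u(2) unfolding V_def by simp
    also have "\<dots> \<le> G (T *\<^sub>R v) \<bullet> v"
      using u(1) F(1) t T(2) nv by (intro mono) auto
    finally show ?thesis unfolding xv using T(1) by simp
  qed
  with T(1) show ?thesis by blast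
qed

locale monotone_field =
  fixes F :: "'a::euclidean_space \<Rightarrow> 'a" and N :: "'a set" and C :: real
  assumes cont: "continuous_on UNIV F"
    and mono: "(F x - F y) \<bullet> (x - y) \<ge> 0"
    and bound: "norm (F x) \<le> C"
    and subN: "subspace N"
    and inv: "n \<in> N \<Longrightarrow> F (x + n) = F x"
    and strict: "u \<notin> N \<Longrightarrow> (F (x + u) - F x) \<bullet> u > 0"
begin

text \<open>Translation by \<open>t *\<^sub>R n\<close> leaves \<open>F x\<close> alone but adds
  \<open>t * b\<close> to the monotonicity inequality for \<open>x\<close> and \<open>y\<close>. An
  affine function that is nonnegative on the whole line has slope zero. Hence the range of
  \<open>F\<close> lies in a translate of the orthogonal complement of \<open>N\<close>.\<close>

lemma null_constant:
  assumes "n \<in> N" shows "F x \<bullet> n = F y \<bullet> n"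
proof (rule ccontr)
  assume ne: "F x \<bullet> n \<noteq> F y \<bullet> n"
  define a where "a = (F x - F y) \<bullet> (x - y)"
  define b where "b = (F x - F y) \<bullet> n"
  have b: "b \<noteq> 0" unfolding b_def using ne by (simp add: inner_diff_left)
  have "a + t * b \<ge> 0" for t
  proof -
    have "F (x + t *\<^sub>R n) = F x" using inv subspace_scale[OF subN assms] by blast
    then have "0 \<le> (F x - F y) \<bullet> (x + t *\<^sub>R n - y)" using mono[of "x + t *\<^sub>R n" y] by simp
    also have "\<dots> = a + t * b" unfolding a_def b_def by (simp add: algebra_simps)
    finally show ?thesis .
  qed
  from this[of "- (a + 1) / b"] b show False by simp
qed

text \<open>Strictness gives a definite gain \<open>d\<close> at \<open>x + u\<close>. Comparing
  \<open>t *\<^sub>R u\<close> with that point by monotonicity loses only a bounded amount divided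
  by \<open>t\<close>, so far out the gain survives. The ray starts at the origin, independently of
  \<open>x\<close>, so that two base points can be compared along the same ray.\<close>

lemma eventually_above:
  assumes u: "u \<notin> N"
  shows "\<exists>t0>0. \<forall>t\<ge>t0. (F (t *\<^sub>R u) - F x) \<bullet> u > 0"
proof -
  define p where "p = x + u"
  define d where "d = (F p - F x) \<bullet> u"
  have d: "d > 0" unfolding d_def p_def using strict[OF u] by blast
  have C: "C \<ge> 0" using bound[of 0] norm_ge_zero order_trans by blast
  \<comment> \<open>From here on \<open>t * d\<close> exceeds by at least 1 the largest possible
    loss, which is \<open>2 * C * norm p\<close> by Cauchy-Schwarz.\<close>
  define t0 where "t0 = (2 * C * norm p + 1) / d"
  have "t0 > 0" unfolding t0_def using C d by (simp add: add_nonneg_pos)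
  moreover have "(F (t *\<^sub>R u) - F x) \<bullet> u > 0" if t: "t \<ge> t0" for t
  proof -
    have tp: "t > 0" using t \<open>t0 > 0\<close> by linarith
    define e where "e = F (t *\<^sub>R u) - F p"
    have "norm e \<le> 2 * C"
      unfolding e_def using norm_triangle_ineq4[of "F (t *\<^sub>R u)" "F p"] bound[of "t *\<^sub>R u"] bound[of p]
      by linarith
    then have "\<bar>e \<bullet> p\<bar> \<le> 2 * C * norm p"
      by (meson Cauchy_Schwarz_ineq2 mult_right_mono norm_ge_zero order_trans)
    moreover have "e \<bullet> (t *\<^sub>R u - p) \<ge> 0" unfolding e_def by (rule mono)
    ultimately have "t * (e \<bullet> u) \<ge> - (2 * C * norm p)" by (simp add: inner_diff_right)
    moreover have "t * d \<ge> 2 * C * norm p + 1"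
      using t d unfolding t0_def by (simp add: field_simps)
    ultimately have "t * (e \<bullet> u + d) > 0" by (simp add: distrib_left)
    then have "e \<bullet> u + d > 0" using tp by (simp add: zero_less_mult_iff)
    then show ?thesis unfolding e_def d_def by (simp add: inner_diff_left)
  qed
  ultimately show ?thesis by blast
qed

text \<open>For directions outside \<open>N\<close>, \<open>eventually_above\<close> at both
  endpoints makes \<open>F - y\<close> point outwards. For directions in \<open>N\<close> the
  product with \<open>F - y\<close> vanishes identically by \<open>null_constant\<close>, so a
  positive term \<open>Q\<close> has to supply the outward push.\<close>

lemma convex_range: "convex (range F)"
proof (rule convexI)
  fix y0 y1 and s t :: real
  assume "y0 \<in> range F" "y1 \<in> range F" and st: "0 \<le> s" "0 \<le> t" "s + t = 1"
  then obtain x0 x1 where x: "y0 = F x0" "y1 = F x1" by blast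
  define y where "y = s *\<^sub>R y0 + t *\<^sub>R y1"
  have yN: "y \<bullet> n = F x \<bullet> n" if "n \<in> N" for n x
  proof -
    have "y \<bullet> n = s * (F x \<bullet> n) + t * (F x \<bullet> n)"
      unfolding y_def x inner_add_left inner_scaleR_left
      using null_constant[OF that, of x0 x] null_constant[OF that, of x1 x] by simp
    also have "\<dots> = F x \<bullet> n" using st(3) by (metis distrib_right mult_1)
    finally show ?thesis .
  qed
  obtain B where B: "B \<subseteq> N" "independent B" "N \<subseteq> span B" "card B = dim N"
    using basis_exists by blast
  have finB: "finite B" using B(2) independent_bound by blast
  \<comment> \<open>This need not be the orthogonal projection, since \<open>B\<close> is an
    arbitrary basis of \<open>N\<close>. It suffices that \<open>Q\<close> takes values in
    \<open>N\<close>, is positive semidefinite, and is definite on \<open>N\<close>.\<close>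
  define Q where "Q x = (\<Sum>b\<in>B. (x \<bullet> b) *\<^sub>R b)" for x
  define G where "G x = F x - y + Q x" for x
  have QN: "Q x \<in> N" for x unfolding Q_def using B(1)
    by (intro subspace_sum[OF subN] subspace_scale[OF subN]) auto
  have Qx: "Q x \<bullet> z = (\<Sum>b\<in>B. (x \<bullet> b) * (z \<bullet> b))" for x z
    unfolding Q_def inner_sum_left by (intro sum.cong) (auto simp: inner_commute)
  have Qscale: "Q (r *\<^sub>R x) = r *\<^sub>R Q x" for r x
    unfolding Q_def by (simp add: scaleR_sum_right)
  have Qnn: "Q x \<bullet> x \<ge> 0" for x unfolding Qx by (intro sum_nonneg) auto
  have Qpos: "Q n \<bullet> n > 0" if n: "n \<in> N" "n \<noteq> 0" for n
  proof (rule ccontr)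
    assume "\<not> Q n \<bullet> n > 0"
    then have "(\<Sum>b\<in>B. (n \<bullet> b) * (n \<bullet> b)) = 0" using Qnn[of n] unfolding Qx by linarith
    then have "\<forall>b\<in>B. n \<bullet> b = 0" using finB by (subst (asm) sum_nonneg_eq_0_iff) auto
    then have "orthogonal n n"
      using orthogonal_to_span[of n B n] n(1) B(3) unfolding orthogonal_def by auto
    then show False using n(2) by (simp add: orthogonal_self)
  qed
  have contG: "continuous_on UNIV G"
    unfolding G_def Q_def by (intro continuous_intros cont)
  have "\<exists>T>0. \<forall>x. norm x = T \<longrightarrow> G x \<bullet> x \<ge> 0"
  proof (rule compact_uniform_radius[OF contG])
    fix u :: 'a and r s :: real
    assume u: "norm u = 1" and rs: "0 < r" "r \<le> s"
    show "G (r *\<^sub>R u) \<bullet> u \<le> G (s *\<^sub>R u) \<bullet> u"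
    proof (cases "r = s")
      case False
      then have "r < s" using rs by simp
      have "0 \<le> (F (s *\<^sub>R u) - F (r *\<^sub>R u)) \<bullet> (s *\<^sub>R u - r *\<^sub>R u)" by (rule mono)
      also have "\<dots> = (s - r) * ((F (s *\<^sub>R u) - F (r *\<^sub>R u)) \<bullet> u)" by (simp add: algebra_simps)
      finally have "F (r *\<^sub>R u) \<bullet> u \<le> F (s *\<^sub>R u) \<bullet> u"
        using \<open>r < s\<close> by (simp add: zero_le_mult_iff inner_diff_left)
      moreover have "r * (Q u \<bullet> u) \<le> s * (Q u \<bullet> u)"
        using Qnn rs by (intro mult_right_mono) auto
      ultimately show ?thesis
        unfolding G_def Qscale by (simp add: inner_add_left inner_diff_left)
    qed simp
  next
    fix u :: 'a assume u: "norm u = 1"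
    show "\<exists>t>0. G (t *\<^sub>R u) \<bullet> u > 0"
    proof (cases "u \<in> N")
      case True
      have "(F (1 *\<^sub>R u) - y) \<bullet> u = 0" using yN[OF True] by (simp add: inner_diff_left)
      then have "G (1 *\<^sub>R u) \<bullet> u > 0"
        unfolding G_def using Qpos[OF True] u by (cases "u = 0") (auto simp: inner_add_left)
      then show ?thesis using zero_less_one by blast
    next
      case False
      obtain t0 t1 where t: "t0 > 0" "t1 > 0"
        "\<And>r. r \<ge> t0 \<Longrightarrow> (F (r *\<^sub>R u) - F x0) \<bullet> u > 0"
        "\<And>r. r \<ge> t1 \<Longrightarrow> (F (r *\<^sub>R u) - F x1) \<bullet> u > 0"
        using eventually_above[OF False] by metis
      define r where "r = max t0 t1"
      have r: "r > 0" "(F (r *\<^sub>R u) - F x0) \<bullet> u > 0" "(F (r *\<^sub>R u) - F x1) \<bullet> u > 0"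
        using t unfolding r_def by (auto simp: less_max_iff_disj)
      have "(F (r *\<^sub>R u) - y) = s *\<^sub>R (F (r *\<^sub>R u) - F x0) + t *\<^sub>R (F (r *\<^sub>R u) - F x1)"
      proof -
        have "F (r *\<^sub>R u) = s *\<^sub>R F (r *\<^sub>R u) + t *\<^sub>R F (r *\<^sub>R u)"
          using st(3) by (metis scaleR_add_left scaleR_one)
        then show ?thesis unfolding y_def x by (simp add: algebra_simps)
      qed
      then have "(F (r *\<^sub>R u) - y) \<bullet> u
        = s * ((F (r *\<^sub>R u) - F x0) \<bullet> u) + t * ((F (r *\<^sub>R u) - F x1) \<bullet> u)"
        by (simp add: inner_add_left)
      also have "\<dots> > 0"
      proof (cases "s = 0")
        case False
        then show ?thesis using st r by (intro add_pos_nonneg mult_pos_pos mult_nonneg_nonneg) auto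
      qed (use st r in auto)
      finally have "(F (r *\<^sub>R u) - y) \<bullet> u > 0" .
      moreover have "Q (r *\<^sub>R u) \<bullet> u \<ge> 0" unfolding Qscale using r(1) Qnn[of u] by simp
      ultimately have "G (r *\<^sub>R u) \<bullet> u > 0" unfolding G_def by (simp add: inner_add_left)
      with r(1) show ?thesis by blast
    qed
  qed
  then obtain T where "T > 0" "\<And>x. norm x = T \<Longrightarrow> G x \<bullet> x \<ge> 0" by blast
  then obtain x where Gx: "G x = 0" using inward_vector_field_zero[OF contG] by blast
  \<comment> \<open>At the zero, \<open>F x - y\<close> equals \<open>- Q x\<close>. The left side
    is orthogonal to \<open>N\<close> and the right side lies in \<open>N\<close>, so both are zero
    and the auxiliary term disappears.\<close>
  have "Q x \<bullet> Q x = 0"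
  proof -
    have "0 = G x \<bullet> Q x" using Gx by simp
    also have "\<dots> = Q x \<bullet> Q x"
      unfolding G_def using yN[OF QN, of x x] by (simp add: inner_add_left inner_diff_left)
    finally show ?thesis by simp
  qed
  then have "F x = y" using Gx unfolding G_def by simp
  then show "s *\<^sub>R y0 + t *\<^sub>R y1 \<in> range F" unfolding y_def by (metis rangeI)
qed

lemma extreme_imp_null:
  assumes ext: "F 0 extreme_point_of S" and sub: "range F \<subseteq> S"
  shows "N = UNIV"
proof -
  have ext': "F 0 extreme_point_of (range F)"
    using ext sub unfolding extreme_point_of_def by blast
  have "F 0 \<in> rel_interior (range F)"
  proof (rule ccontr)
    assume "F 0 \<notin> rel_interior (range F)"
    then obtain a where a: "a \<noteq> 0" "\<And>y. y \<in> range F \<Longrightarrow> a \<bullet> F 0 \<le> a \<bullet> y"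
      "\<And>y. y \<in> rel_interior (range F) \<Longrightarrow> a \<bullet> F 0 < a \<bullet> y"
      using supporting_hyperplane_rel_boundary[OF convex_range, of "F 0"] by blast
    \<comment> \<open>The support is strict on the relative interior, while a normal in
      \<open>N\<close> would be constant on the range.\<close>
    have "a \<notin> N"
    proof
      assume "a \<in> N"
      obtain y where y: "y \<in> rel_interior (range F)"
        using rel_interior_eq_empty[OF convex_range] by blast
      then obtain x where "y = F x" using rel_interior_subset by blast
      then show False using a(3)[OF y] null_constant[OF \<open>a \<in> N\<close>, of x 0] by (simp add: inner_commute)
    qed
    \<comment> \<open>A step along \<open>- a\<close> strictly lowers the component along
      \<open>a\<close>, below the value that the supporting hyperplane allows.\<close>
    then have "- a \<notin> N" using subspace_neg[OF subN, of "- a"] by auto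
    from strict[OF this, of 0] have "F (- a) \<bullet> a < F 0 \<bullet> a" by (simp add: inner_diff_left)
    with a(2)[of "F (- a)"] show False by (simp add: inner_commute)
  qed
  then have "range F = {F 0}"
    using extreme_point_not_in_REL_INTERIOR[OF ext'] by blast
  then have "F x = F 0" for x by blast
  then show ?thesis using strict[of _ 0] by (metis UNIV_eq_I diff_self inner_zero_left less_irrefl)
qed

end

section \<open>Sequential compactness of the space of probability measures\<close>

text \<open>At the first disagreement \<open>k\<close> the digits contribute a difference of
  \<open>1 / 3 ^ k\<close>, and all later digits together at most half of that. The codes are then
  at least \<open>1 / (2 * 3 ^ k)\<close> apart. In base 2 the tail could cancel the leading
  difference completely, which is why base 3 is used.\<close>

lemma ternary_code_bits:
  fixes a b :: "nat \<Rightarrow> bool"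
  assumes close: "\<bar>(\<Sum>n. of_bool (a n) / 3 ^ n) - (\<Sum>n. of_bool (b n) / 3 ^ n)\<bar> < (1::real) / (2 * 3 ^ N)"
    and "n \<le> N"
  shows "a n = b n"
proof (rule ccontr)
  assume "a n \<noteq> b n"
  define k where "k = (LEAST n. a n \<noteq> b n)"
  have k: "a k \<noteq> b k" "k \<le> n" "\<And>j. j < k \<Longrightarrow> a j = b j"
    unfolding k_def
    using LeastI[of "\<lambda>n. a n \<noteq> b n", OF \<open>a n \<noteq> b n\<close>]
      Least_le[of "\<lambda>n. a n \<noteq> b n", OF \<open>a n \<noteq> b n\<close>]
      not_less_Least[of _ "\<lambda>n. a n \<noteq> b n"] by blast+
  have sg: "summable (\<lambda>n. 1 / 3 ^ n :: real)"
    using summable_geometric[of "1/3 :: real"] by (simp add: power_divide)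
  have sm: "summable (\<lambda>n. of_bool (c n) / 3 ^ n :: real)" for c
    by (rule summable_comparison_test'[OF sg, of 0]) auto
  define d :: "nat \<Rightarrow> real" where "d n = (of_bool (a n) - of_bool (b n)) / 3 ^ n" for n :: nat
  have d_eq: "d n = of_bool (a n) / 3 ^ n - of_bool (b n) / (3 ^ n :: real)" for n
    by (simp add: d_def diff_divide_distrib)
  have sd: "summable d" unfolding d_eq by (intro summable_diff sm)
  have sum_d: "suminf d = (\<Sum>n. of_bool (a n) / 3 ^ n) - (\<Sum>n. of_bool (b n) / (3 ^ n :: real))"
    unfolding d_eq by (intro suminf_diff[symmetric] sm)
  define tail where "tail = (\<Sum>n. d (n + Suc k))"
  have split: "suminf d = tail + d k"
  proof -
    have "(\<Sum>i<Suc k. d i) = d k" using k(3) by (simp add: d_def)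
    then show ?thesis unfolding tail_def using suminf_split_initial_segment[OF sd, of "Suc k"] by simp
  qed
  have "\<bar>tail\<bar> \<le> 1 / (2 * 3 ^ k)"
  proof -
    have g: "(\<lambda>n. (1 / 3 ^ Suc k) * (1/3) ^ n :: real) sums ((1 / 3 ^ Suc k) * (1 / (1 - 1/3)))"
      by (intro sums_mult geometric_sums) auto
    have "norm (d (n + Suc k)) \<le> (1 / 3 ^ Suc k) * (1/3) ^ n" for n
      unfolding d_def by (auto simp: power_add power_divide of_bool_def mult_ac)
    then have "norm tail \<le> (\<Sum>n. (1 / 3 ^ Suc k) * (1/3) ^ n)"
      unfolding tail_def using g by (intro norm_suminf_le) (auto simp: sums_iff)
    also have "\<dots> = (1 / 3 ^ Suc k) * (1 / (1 - 1/3))" using g by (simp add: sums_iff)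
    also have "\<dots> = 1 / (2 * 3 ^ k)" by simp
    finally show ?thesis by simp
  qed
  moreover have "\<bar>d k\<bar> = 1 / 3 ^ k" using k(1) unfolding d_def by (auto simp: of_bool_def)
  ultimately have "\<bar>suminf d\<bar> \<ge> 1 / (2 * 3 ^ k)"
    unfolding split by linarith
  moreover have "1 / (2 * 3 ^ k) \<ge> (1::real) / (2 * 3 ^ N)"
    using k(2) \<open>n \<le> N\<close> by (intro divide_left_mono mult_left_mono power_increasing) auto
  ultimately show False using close unfolding sum_d by linarith
qed

text \<open>A second countable compact Hausdorff space is coded by reals: the digits of \<open>s x\<close> record
  which basic open sets contain \<open>x\<close>. The code is only Borel, but decoding is continuous.\<close>

lemma compact_real_code:
  fixes X :: "'z::{t2_space,second_countable_topology} set"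
  assumes X: "compact X" and ne: "X \<noteq> {}"
  obtains s :: "'z \<Rightarrow> real" and c :: "real \<Rightarrow> 'z" where
    "s \<in> borel_measurable borel" "\<And>x. 0 \<le> s x \<and> s x \<le> 3/2"
    "continuous_on (closure (s ` X)) c" "c ` closure (s ` X) \<subseteq> X" "\<And>x. x \<in> X \<Longrightarrow> c (s x) = x"
proof -
  obtain B :: "nat \<Rightarrow> 'z set" where B: "\<And>n. open (B n)"
    "\<And>U x. open U \<Longrightarrow> x \<in> U \<Longrightarrow> \<exists>n. x \<in> B n \<and> B n \<subseteq> U"
  proof -
    obtain \<B> :: "'z set set" where b: "countable \<B>" "topological_basis \<B>"
      using ex_countable_basis by blast
    have neB: "\<B> \<noteq> {}"
      by (rule topological_basisE[OF b(2) open_UNIV UNIV_I]) auto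
    show thesis
    proof (rule that[of "from_nat_into \<B>"])
      show "open (from_nat_into \<B> n)" for n
        by (rule topological_basis_open[OF b(2) from_nat_into[OF neB]])
      fix U :: "'z set" and x assume "open U" "x \<in> U"
      then obtain D where "D \<in> \<B>" "x \<in> D" "D \<subseteq> U" using topological_basisE[OF b(2)] by blast
      then show "\<exists>n. x \<in> from_nat_into \<B> n \<and> from_nat_into \<B> n \<subseteq> U"
        using from_nat_into_surj[OF b(1), of D] by blast
    qed
  qed
  define s :: "'z \<Rightarrow> real" where "s x = (\<Sum>n. of_bool (x \<in> B n) / 3 ^ n)" for x
  have meas: "s \<in> borel_measurable borel"
    unfolding s_def
  proof (intro borel_measurable_suminf)
    fix n
    have [measurable]: "B n \<in> sets borel" using B(1) by simp
    have "(\<lambda>x. indicator (B n) x / 3 ^ n :: real) \<in> borel_measurable borel" by measurable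
    then show "(\<lambda>x. of_bool (x \<in> B n) / 3 ^ n :: real) \<in> borel_measurable borel"
      by (simp add: indicator_def of_bool_def cong: if_cong)
  qed
  have sg: "(\<lambda>n. 1 / 3 ^ n :: real) sums (3/2)"
    using geometric_sums[of "1/3 :: real"] by (simp add: power_divide)
  have sm: "summable (\<lambda>n. of_bool (P n) / 3 ^ n :: real)" for P
    by (rule summable_comparison_test'[OF sums_summable[OF sg], of 0]) auto
  have bounds: "0 \<le> s x \<and> s x \<le> 3/2" for x
  proof
    show "0 \<le> s x" unfolding s_def by (intro suminf_nonneg sm) auto
    have "s x \<le> (\<Sum>n. 1 / 3 ^ n)"
      unfolding s_def by (intro suminf_le sm sums_summable[OF sg]) (auto intro!: divide_right_mono)
    then show "s x \<le> 3/2" using sg by (simp add: sums_iff)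
  qed
  \<comment> \<open>Codes that are close agree in the first digits. These decide membership in the
    finitely many basic sets of a subcover on which \<open>f\<close> varies little, so
    \<open>f\<close> is uniformly continuous as a function of the code.\<close>
  have uc: "\<exists>d>0. \<forall>x\<in>X. \<forall>y\<in>X. \<bar>s x - s y\<bar> < d \<longrightarrow> \<bar>f x - f y\<bar> < e"
    if f: "continuous_on X f" and e: "e > 0" for f :: "'z \<Rightarrow> real" and e
  proof -
    have "\<exists>n. x \<in> B n \<and> (\<forall>y\<in>B n \<inter> X. \<bar>f y - f x\<bar> < e / 2)" if "x \<in> X" for x
    proof -
      obtain U where U: "open U" "U \<inter> X = f -` {f x - e/2 <..< f x + e/2} \<inter> X"
        using continuous_on_open_invariant[THEN iffD1, OF f, rule_format, of "{f x - e/2 <..< f x + e/2}"]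
        by auto
      then have "x \<in> U" using that e by auto
      then obtain n where "x \<in> B n" "B n \<subseteq> U" using B(2) U(1) by blast
      have "\<bar>f y - f x\<bar> < e / 2" if "y \<in> B n \<inter> X" for y
      proof -
        have "y \<in> f -` {f x - e/2 <..< f x + e/2} \<inter> X" using that \<open>B n \<subseteq> U\<close> U(2) by blast
        then show ?thesis unfolding abs_less_iff by auto
      qed
      then show ?thesis using \<open>x \<in> B n\<close> by blast
    qed
    then obtain m where m: "\<And>x. x \<in> X \<Longrightarrow> x \<in> B (m x) \<and> (\<forall>y\<in>B (m x) \<inter> X. \<bar>f y - f x\<bar> < e / 2)"
      by metis
    obtain F where F: "F \<subseteq> X" "finite F" "X \<subseteq> (\<Union>x\<in>F. B (m x))"
      using compactE_image[OF X, of X "\<lambda>x. B (m x)"] B(1) m by blast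
    define N where "N = Max (insert 0 (m ` F))"
    have N: "m x \<le> N" if "x \<in> F" for x unfolding N_def using F(2) that by auto
    show ?thesis
    proof (intro exI[of _ "1 / (2 * 3 ^ N)"] conjI ballI impI)
      fix x y assume xy: "x \<in> X" "y \<in> X" "\<bar>s x - s y\<bar> < 1 / (2 * 3 ^ N)"
      obtain z where z: "z \<in> F" "x \<in> B (m z)" using F(3) xy(1) by blast
      have "y \<in> B (m z)"
        using ternary_code_bits[of "\<lambda>n. x \<in> B n" "\<lambda>n. y \<in> B n" N "m z"] xy(3) N[OF z(1)] z(2)
        unfolding s_def by blast
      then have "\<bar>f x - f z\<bar> < e / 2" "\<bar>f y - f z\<bar> < e / 2"
        using m[of z] z F(1) xy by blast+
      then show "\<bar>f x - f y\<bar> < e" by linarith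
    qed simp
  qed
  \<comment> \<open>A compact Hausdorff space is completely regular, so continuous real functions
    detect neighbourhoods; \<open>uc\<close> can then be used to control points of \<open>X\<close>
    as well.\<close>
  have sep: "\<exists>f :: 'z \<Rightarrow> real. continuous_on X f \<and> f x = 0 \<and> (\<forall>y\<in>X - U. f y = 1)"
    if U: "open U" and xU: "x \<in> X \<inter> U" for U x
  proof -
    have "compact_space (top_of_set X)" using X by (simp add: compact_space_subtopology)
    moreover have "Hausdorff_space (top_of_set X)"
      by (rule Hausdorff_space_subtopology) (auto simp: Hausdorff_space_def disjnt_def dest!: hausdorff)
    ultimately have "completely_regular_space (top_of_set X)"
      by (simp add: compact_Hausdorff_or_regular_imp_normal_space normal_imp_completely_regular_space)
    moreover have "openin (top_of_set X) (X \<inter> U)" using U by (simp add: openin_open_Int)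
    ultimately obtain f :: "'z \<Rightarrow> real" where "continuous_map (top_of_set X) euclideanreal f" "f x = 0"
      "f ` (X - X \<inter> U) \<subseteq> {1}"
      using xU unfolding completely_regular_space_alt' by force
    then show ?thesis by (intro exI[of _ f]) auto
  qed
  define K where "K = closure (s ` X)"
  define S where "S k r = {x \<in> X. \<bar>s x - k\<bar> < r}" for k r
  \<comment> \<open>The decoding of \<open>k\<close> is a cluster point of the points whose codes
    approach \<open>k\<close>. It exists by the finite intersection property; that the choice is
    immaterial follows from \<open>key\<close> and \<open>sep\<close>.\<close>
  define c where "c k = (SOME x. x \<in> X \<and> (\<forall>r>0. x \<in> closure (S k r)))" for k
  have c: "c k \<in> X \<and> (\<forall>r>0. c k \<in> closure (S k r))" if k: "k \<in> K" for k
  proof -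
    have "X \<inter> (\<Inter>r\<in>{0<..}. closure (S k r)) \<noteq> {}"
    proof (rule compact_imp_fip_image[OF X])
      fix I :: "real set" assume I: "finite I" "I \<subseteq> {0<..}"
      define r where "r = Min (insert 1 I)"
      have r: "r > 0" "\<And>i. i \<in> I \<Longrightarrow> r \<le> i" unfolding r_def using I by (auto simp: Min_gr_iff)
      obtain x where "x \<in> X" "\<bar>s x - k\<bar> < r"
        using k r(1) unfolding K_def closure_approachable dist_real_def by blast
      then have "x \<in> X \<inter> (\<Inter>i\<in>I. S k i)" using r(2) unfolding S_def by force
      then show "X \<inter> (\<Inter>i\<in>I. closure (S k i)) \<noteq> {}" using closure_subset by blast
    qed simp
    then have "\<exists>x. x \<in> X \<and> (\<forall>r>0. x \<in> closure (S k r))" by blast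
    from someI_ex[OF this] show ?thesis unfolding c_def .
  qed
  \<comment> \<open>The estimate \<open>uc\<close> passes to cluster points, at the price of a weak
    inequality.\<close>
  have key: "\<exists>d>0. \<forall>k\<in>K. \<forall>x\<in>X. \<bar>s x - k\<bar> < d \<longrightarrow> \<bar>f x - f (c k)\<bar> \<le> e"
    if f: "continuous_on X f" and e: "e > 0" for f :: "'z \<Rightarrow> real" and e
  proof -
    obtain d where d: "d > 0" "\<And>x y. x \<in> X \<Longrightarrow> y \<in> X \<Longrightarrow> \<bar>s x - s y\<bar> < d \<Longrightarrow> \<bar>f x - f y\<bar> < e"
      using uc[OF f e] by blast
    show ?thesis
    proof (intro exI[of _ "d / 2"] conjI ballI impI)
      fix k x assume k: "k \<in> K" and x: "x \<in> X" "\<bar>s x - k\<bar> < d / 2"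
      define T where "T = {y \<in> X. \<bar>f x - f y\<bar> \<le> e}"
      have "closed T"
      proof -
        have "closedin (top_of_set X) (X \<inter> (\<lambda>y. \<bar>f x - f y\<bar>) -` {..e})"
          by (intro continuous_closedin_preimage continuous_intros f)
        moreover have "X \<inter> (\<lambda>y. \<bar>f x - f y\<bar>) -` {..e} = T" unfolding T_def by auto
        ultimately show ?thesis using compact_imp_closed[OF X] closedin_closed_trans by metis
      qed
      moreover have "S k (d / 2) \<subseteq> T"
      proof
        fix y assume "y \<in> S k (d / 2)"
        then have y: "y \<in> X" "\<bar>s y - k\<bar> < d / 2" unfolding S_def by auto
        then have "\<bar>s x - s y\<bar> < d" using x by linarith
        then show "y \<in> T" unfolding T_def using d(2) x y by force
      qed
      ultimately have "closure (S k (d/2)) \<subseteq> T" by (rule closure_minimal[rotated])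
      moreover have "c k \<in> closure (S k (d/2))" using c[OF k] d(1) by simp
      ultimately show "\<bar>f x - f (c k)\<bar> \<le> e" unfolding T_def by blast
    qed (use d in simp)
  qed
  show thesis
  proof (rule that[of s c])
    show "c ` closure (s ` X) \<subseteq> X" using c unfolding K_def by blast
    show "c (s x) = x" if x: "x \<in> X" for x
    proof (rule ccontr)
      assume "c (s x) \<noteq> x"
      have sxK: "s x \<in> K" unfolding K_def using x closure_subset[of "s ` X"] by blast
      have cX: "c (s x) \<in> X" using c[OF sxK] by blast
      have "open (- {x})" by (rule open_Compl) simp
      then obtain f :: "'z \<Rightarrow> real" where f: "continuous_on X f" "f (c (s x)) = 0" "\<forall>y\<in>X - (- {x}). f y = 1"
        using sep[of "- {x}" "c (s x)"] cX \<open>c (s x) \<noteq> x\<close> by blast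
      obtain d where "d > 0" "\<And>k y. k \<in> K \<Longrightarrow> y \<in> X \<Longrightarrow> \<bar>s y - k\<bar> < d \<Longrightarrow> \<bar>f y - f (c k)\<bar> \<le> 1/2"
        using key[OF f(1), of "1/2"] by (metis half_gt_zero_iff zero_less_one)
      then have "\<bar>f x - f (c (s x))\<bar> \<le> 1/2" using sxK x by force
      moreover have "f x = 1" using f(3) x by blast
      ultimately show False using f(2) by simp
    qed
    show "continuous_on (closure (s ` X)) c"
      unfolding K_def[symmetric] continuous_on_topological
    proof (intro ballI allI impI)
      fix k0 U assume k0: "k0 \<in> K" and U: "open U" "c k0 \<in> U"
      obtain f :: "'z \<Rightarrow> real" where f: "continuous_on X f" "f (c k0) = 0" "\<forall>y\<in>X - U. f y = 1"
        using sep[of U "c k0"] c[OF k0] U by blast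
      \<comment> \<open>Two errors of 1/3 stay below the gap 1 between \<open>f (c k0)\<close> and
        the values of \<open>f\<close> outside \<open>U\<close>.\<close>
      obtain d where d: "d > 0" "\<And>k y. k \<in> K \<Longrightarrow> y \<in> X \<Longrightarrow> \<bar>s y - k\<bar> < d \<Longrightarrow> \<bar>f y - f (c k)\<bar> \<le> 1/3"
        using key[OF f(1), of "1/3"] by (metis zero_less_divide_1_iff zero_less_numeral)
      show "\<exists>A. open A \<and> k0 \<in> A \<and> (\<forall>y\<in>K. y \<in> A \<longrightarrow> c y \<in> U)"
      proof (intro exI[of _ "ball k0 (d/2)"] conjI ballI impI)
        fix k assume k: "k \<in> K" "k \<in> ball k0 (d/2)"
        obtain x where x: "x \<in> X" "\<bar>s x - k\<bar> < d / 2"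
          using k(1) d(1) half_gt_zero unfolding K_def closure_approachable dist_real_def by blast
        have "\<bar>s x - k0\<bar> < d" using x(2) k(2) unfolding mem_ball dist_real_def by linarith
        then have "\<bar>f x - f (c k0)\<bar> \<le> 1/3" using d(2) k0 x by blast
        moreover have "\<bar>f x - f (c k)\<bar> \<le> 1/3" using d k x by force
        ultimately have "f (c k) \<noteq> 1" using f(2) by linarith
        then show "c k \<in> U" using f(3) c[OF k(1)] by blast
      qed (use d in auto)
    qed
  qed (use meas bounds in auto)
qed

lemma prob_measuresD:
  assumes "\<nu> \<in> prob_measures X"
  shows "prob_space \<nu>" "sets \<nu> = sets (restrict_space borel X)" "space \<nu> = X"
  using assms sets_eq_imp_space_eq[of \<nu> "restrict_space borel X"]
  unfolding prob_measures_def by (auto simp: space_restrict_space)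

lemma prob_measures_measurable:
  assumes "\<nu> \<in> prob_measures X" "continuous_on X f"
  shows "f \<in> borel_measurable \<nu>"
  using borel_measurable_continuous_on_restrict[OF assms(2)]
    measurable_cong_sets[OF prob_measuresD(2)[OF assms(1)] refl] by blast

text \<open>Coded as measures on a bounded interval, the sequence is tight and has a weakly
  convergent subsequence on the real line. Its limit is concentrated on the closed set
  \<open>K\<close> of limits of codes, where decoding is continuous, and can be carried back to
  \<open>X\<close>. Discontinuity of the code itself is harmless because test functions are composed
  with \<open>c\<close> and not with \<open>s\<close>.\<close>

lemma prob_measures_sequentially_compact:
  fixes X :: "'z::{t2_space,second_countable_topology} set"
  assumes X: "compact X" and nu: "\<And>n :: nat. \<nu> n \<in> prob_measures X"
  obtains r L where "strict_mono r" "L \<in> prob_measures X"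
    "\<And>f :: 'z \<Rightarrow> real. continuous_on X f \<Longrightarrow> (\<lambda>n. \<integral>x. f x \<partial>\<nu> (r n)) \<longlonglongrightarrow> (\<integral>x. f x \<partial>L)"
proof -
  note nu_sets = prob_measuresD(2)[OF nu] and nu_space = prob_measuresD(3)[OF nu]
  interpret nu: prob_space "\<nu> n" for n by (rule prob_measuresD(1)[OF nu])
  have ne: "X \<noteq> {}" using nu.not_empty[of 0] nu_space by simp
  obtain s :: "'z \<Rightarrow> real" and c :: "real \<Rightarrow> 'z" where s: "s \<in> borel_measurable borel"
    "\<And>x. 0 \<le> s x \<and> s x \<le> 3/2"
    and c: "continuous_on (closure (s ` X)) c" "c ` closure (s ` X) \<subseteq> X" "\<And>x. x \<in> X \<Longrightarrow> c (s x) = x"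
    using compact_real_code[OF X ne] by blast
  define K where "K = closure (s ` X)"
  have K: "closed K" "K \<noteq> {}" and sK: "\<And>x. x \<in> X \<Longrightarrow> s x \<in> K"
    unfolding K_def using ne closure_subset[of "s ` X"] by auto
  have compK: "compact K"
  proof -
    have "s ` X \<subseteq> {0..3/2}" using s(2) by auto
    then show ?thesis unfolding K_def by (meson bounded_closed_interval bounded_subset compact_closure)
  qed
  have s_meas: "s \<in> borel_measurable (\<nu> n)" for n
    using measurable_restrict_space1[OF s(1), of X] measurable_cong_sets[OF nu_sets refl] by blast
  define \<mu> where "\<mu> n = distr (\<nu> n) borel s" for n
  have mu: "real_distribution (\<mu> n)" for n
    unfolding \<mu>_def by (rule nu.real_distribution_distr[OF s_meas])
  have mu_int: "(\<integral>k. g k \<partial>\<mu> n) = (\<integral>x. g (s x) \<partial>\<nu> n)" if "continuous_on UNIV g" for g :: "real \<Rightarrow> real" and n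
    unfolding \<mu>_def by (intro integral_distr s_meas borel_measurable_continuous_onI that)
  have "tight \<mu>"
    unfolding tight_def
  proof (intro conjI allI impI mu)
    fix e :: real assume "e > 0"
    \<comment> \<open>All codes lie between 0 and 3/2, so one half-open interval carries the full
      mass of every measure.\<close>
    have "measure (\<mu> n) {-1<..2} = 1" for n
    proof -
      have "s x \<in> {-1<..2}" for x using s(2)[of x] by auto
      then have "s -` {-1<..2} \<inter> space (\<nu> n) = space (\<nu> n)" by auto
      then show ?thesis unfolding \<mu>_def by (subst measure_distr[OF s_meas]) (auto simp: nu.prob_space)
    qed
    then show "\<exists>a b. a < b \<and> (\<forall>n. 1 - e < measure (\<mu> n) {a<..b})"
      using \<open>e > 0\<close> by (intro exI[of _ "-1"] exI[of _ 2]) auto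
  qed
  then obtain r M where r: "strict_mono r" and M: "real_distribution M" and conv: "weak_conv_m (\<mu> \<circ> id \<circ> r) M"
    using tight_imp_convergent_subsubsequence[of \<mu> id] by (auto simp: strict_mono_id)
  interpret M: real_distribution M by (rule M)
  have lim: "(\<lambda>n. \<integral>x. g (s x) \<partial>\<nu> (r n)) \<longlonglongrightarrow> (\<integral>k. g k \<partial>M)"
    if g: "continuous_on UNIV g" "\<And>k. norm (g k) \<le> b" for g :: "real \<Rightarrow> real" and b
  proof -
    have "(\<lambda>n. integral\<^sup>L ((\<mu> \<circ> id \<circ> r) n) g) \<longlonglongrightarrow> integral\<^sup>L M g"
    proof (rule weak_conv_imp_integral_bdd_continuous_conv)
      show "isCont g x" for x using g(1) by (simp add: continuous_on_eq_continuous_at)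
    qed (use mu M conv g(2) in \<open>auto simp: comp_def\<close>)
    then show ?thesis using mu_int[OF g(1)] by simp
  qed
  have M_sets: "sets M = sets borel" by simp
  have AEK: "AE k in M. k \<in> K"
  proof -
    \<comment> \<open>A bounded continuous function whose zero set is \<open>K\<close>. Its
      integrals vanish along the sequence, hence also for the limit.\<close>
    define g where "g k = min 1 (infdist k K)" for k
    have gc: "continuous_on UNIV g" unfolding g_def by (intro continuous_intros)
    have gb: "norm (g k) \<le> 1" for k unfolding g_def by (auto simp: infdist_nonneg)
    have "g (s x) = 0" if "x \<in> X" for x
      unfolding g_def using infdist_zero[OF sK[OF that]] by simp
    then have "(\<integral>x. g (s x) \<partial>\<nu> n) = 0" for n
      using Bochner_Integration.integral_cong[of "\<nu> n" "\<nu> n" "\<lambda>x. g (s x)" "\<lambda>_. 0"] nu_space[of n] by simp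
    then have "(\<lambda>n :: nat. 0) \<longlonglongrightarrow> (\<integral>k. g k \<partial>M)"
      using lim[OF gc gb] by simp
    then have g0: "(\<integral>k. g k \<partial>M) = 0" by (simp add: LIMSEQ_const_iff)
    have "integrable M g"
      by (rule M.integrable_const_bound[where B=1])
        (use gb borel_measurable_continuous_onI[OF gc] in \<open>auto simp: measurable_cong_sets[OF M_sets refl]\<close>)
    then have "AE k in M. g k = 0"
      using integral_nonneg_eq_0_iff_AE[of M g] g0 by (auto simp: g_def infdist_nonneg)
    then show ?thesis
    proof (rule AE_mp, intro AE_I2 impI)
      fix k assume "g k = 0"
      then have "infdist k K = 0" unfolding g_def by (auto simp: min_def split: if_splits)
      then show "k \<in> K" using in_closed_iff_infdist_zero[OF K] by simp
    qed
  qed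
  have KM: "K \<in> sets M" using K(1) by simp
  define L where "L = distr (restrict_space M K) (restrict_space borel X) c"
  have cm: "c \<in> restrict_space M K \<rightarrow>\<^sub>M restrict_space borel X"
  proof (rule measurable_restrict_space2)
    show "c \<in> space (restrict_space M K) \<rightarrow> X" using c(2) unfolding K_def by (auto simp: space_restrict_space)
    have "c \<in> borel_measurable (restrict_space borel K)"
      using borel_measurable_continuous_on_restrict c(1) unfolding K_def by blast
    then show "c \<in> borel_measurable (restrict_space M K)"
      using measurable_cong_sets[OF sets_restrict_space_cong[OF M_sets] refl] by blast
  qed
  have "prob_space (restrict_space M K)"
    by (rule prob_space_restrict_space[OF KM M.emeasure_eq_1_AE[OF KM AEK]])
  then have "prob_space L" unfolding L_def using prob_space.prob_space_distr cm by blast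
  then have L: "L \<in> prob_measures X" unfolding prob_measures_def L_def by simp
  show thesis
  proof (rule that[OF r L])
    fix f :: "'z \<Rightarrow> real" assume f: "continuous_on X f"
    have fc: "continuous_on K (\<lambda>k. f (c k))"
      using continuous_on_compose2[OF f] c unfolding K_def by blast
    then obtain b where b: "\<And>k. k \<in> K \<Longrightarrow> norm (f (c k)) \<le> b"
      using compact_imp_bounded[OF compact_continuous_image[OF fc compK]] unfolding bounded_iff by auto
    have b0: "b \<ge> 0" using b K(2) norm_ge_zero order_trans by blast
    \<comment> \<open>Weak convergence on the line needs bounded continuous test functions on all of
      it; Tietze's extension keeps the bound \<open>b\<close>.\<close>
    obtain g :: "real \<Rightarrow> real" where g: "continuous_on UNIV g" "\<And>k. k \<in> K \<Longrightarrow> g k = f (c k)" "\<And>k. norm (g k) \<le> b"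
      using Tietze[OF fc, of UNIV b] K(1) b b0 by auto
    have "(\<integral>x. g (s x) \<partial>\<nu> n) = (\<integral>x. f x \<partial>\<nu> n)" for n
      by (rule Bochner_Integration.integral_cong) (simp_all add: nu_space g(2)[OF sK] c(3))
    then have l: "(\<lambda>n. \<integral>x. f x \<partial>\<nu> (r n)) \<longlonglongrightarrow> (\<integral>k. g k \<partial>M)"
      using lim[OF g(1) g(3)] by simp
    have "(\<integral>x. f x \<partial>L) = (\<integral>k. f (c k) \<partial>restrict_space M K)"
      unfolding L_def by (intro integral_distr cm borel_measurable_continuous_on_restrict f)
    also have "\<dots> = (\<integral>k. indicator K k *\<^sub>R f (c k) \<partial>M)"
      using KM by (subst integral_restrict_space) auto
    also have "\<dots> = (\<integral>k. g k \<partial>M)"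
    proof (rule integral_cong_AE)
      show gm: "g \<in> borel_measurable M"
        using borel_measurable_continuous_onI[OF g(1)] measurable_cong_sets[OF M_sets refl] by blast
      have "(\<lambda>k. indicator K k *\<^sub>R f (c k)) = (\<lambda>k. indicator K k *\<^sub>R g k)"
        using g(2) by (auto simp: indicator_def)
      moreover have "(\<lambda>k. indicator K k *\<^sub>R g k) \<in> borel_measurable M" using gm KM by measurable
      ultimately show "(\<lambda>k. indicator K k *\<^sub>R f (c k)) \<in> borel_measurable M" by simp
      show "AE k in M. indicator K k *\<^sub>R f (c k) = g k"
        using AEK by (rule AE_mp) (auto simp: g(2))
    qed
    finally show "(\<lambda>n. \<integral>x. f x \<partial>\<nu> (r n)) \<longlonglongrightarrow> (\<integral>x. f x \<partial>L)" using l by simp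
  qed
qed

section \<open>Push-forward along monotone flows\<close>

lemma topspace_weak_topology [simp]: "topspace (weak_topology X) = prob_measures X"
  unfolding weak_topology_def topology_generated_by_topspace
proof (intro equalityI subsetI)
  fix \<nu> assume "\<nu> \<in> prob_measures X"
  then have "\<nu> \<in> {\<nu> \<in> prob_measures X. (\<integral>x. 0 \<partial>\<nu>) \<in> (UNIV :: real set)}" by simp
  moreover have "continuous_on X (\<lambda>_. 0 :: real)" by simp
  ultimately show "\<nu> \<in> \<Union>{{\<nu> \<in> prob_measures X. (\<integral>x. f x \<partial>\<nu>) \<in> W} |f W. continuous_on X f \<and> open (W :: real set)}"
    using open_UNIV by blast
qed blast

text \<open>Being eventually in every neighbourhood is inherited by finite intersections and unions,
  so it is enough to check the generating sets; there it is convergence of integrals.\<close>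

lemma limitin_weak_topology:
  fixes \<nu> :: "nat \<Rightarrow> 'z::topological_space measure"
  assumes nu: "\<And>n. \<nu> n \<in> prob_measures X" and L: "L \<in> prob_measures X"
    and lim: "\<And>f :: 'z \<Rightarrow> real. continuous_on X f \<Longrightarrow> (\<lambda>n. \<integral>x. f x \<partial>\<nu> n) \<longlonglongrightarrow> (\<integral>x. f x \<partial>L)"
  shows "limitin (weak_topology X) \<nu> L sequentially"
  unfolding limitin_def
proof (intro conjI allI impI)
  show "L \<in> topspace (weak_topology X)" using L by simp
  fix U assume U: "openin (weak_topology X) U \<and> L \<in> U"
  then have "generate_topology_on {{\<nu> \<in> prob_measures X. (\<integral>x. f x \<partial>\<nu>) \<in> W} | (f :: 'z \<Rightarrow> real) W.
      continuous_on X f \<and> open W} U"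
    unfolding weak_topology_def openin_topology_generated_by_iff by blast
  then have "L \<in> U \<longrightarrow> (\<forall>\<^sub>F n in sequentially. \<nu> n \<in> U)"
  proof induction
    case (Int a b)
    then show ?case by (auto intro: eventually_conj)
  next
    case (UN K)
    show ?case
    proof
      assume "L \<in> \<Union>K"
      then obtain k where k: "k \<in> K" "L \<in> k" by blast
      then have "\<forall>\<^sub>F n in sequentially. \<nu> n \<in> k" using UN.IH by blast
      then show "\<forall>\<^sub>F n in sequentially. \<nu> n \<in> \<Union>K" by eventually_elim (use k in blast)
    qed
  next
    case (Basis s)
    then obtain f :: "'z \<Rightarrow> real" and W where s: "s = {\<nu> \<in> prob_measures X. (\<integral>x. f x \<partial>\<nu>) \<in> W}"
      "continuous_on X f" "open W" by blast
    show ?case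
    proof
      assume "L \<in> s"
      then have "\<forall>\<^sub>F n in sequentially. (\<integral>x. f x \<partial>\<nu> n) \<in> W"
        using lim[OF s(2)] s(3) unfolding s(1) by (auto dest: topological_tendstoD)
      then show "\<forall>\<^sub>F n in sequentially. \<nu> n \<in> s" unfolding s(1) using nu by simp
    qed
  qed simp
  then show "\<forall>\<^sub>F n in sequentially. \<nu> n \<in> U" using U by blast
qed

lemma limitin_in_closure_of:
  assumes "limitin T f l sequentially" "\<And>n :: nat. f n \<in> S"
  shows "l \<in> T closure_of S"
  unfolding in_closure_of
proof (intro conjI allI impI)
  show "l \<in> topspace T" using assms(1) unfolding limitin_def by blast
  fix U assume "l \<in> U \<and> openin T U"
  then have "\<forall>\<^sub>F n in sequentially. f n \<in> U" using assms(1) unfolding limitin_def by blast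
  then show "\<exists>y. y \<in> S \<and> y \<in> U" using assms(2) eventually_happens' sequentially_bot by blast
qed

lemma continuous_map_weak_integral:
  fixes f :: "'z::topological_space \<Rightarrow> real"
  assumes "continuous_on X f"
  shows "continuous_map (weak_topology X) euclideanreal (\<lambda>\<nu>. \<integral>x. f x \<partial>\<nu>)"
  unfolding continuous_map_alt topspace_weak_topology
proof (intro conjI allI impI)
  fix W :: "real set" assume "openin euclidean W"
  then have "open W" by simp
  have "(\<lambda>\<nu>. \<integral>x. f x \<partial>\<nu>) -` W \<inter> prob_measures X = {\<nu> \<in> prob_measures X. (\<integral>x. f x \<partial>\<nu>) \<in> W}" by blast
  then show "openin (weak_topology X) ((\<lambda>\<nu>. \<integral>x. f x \<partial>\<nu>) -` W \<inter> prob_measures X)"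
    unfolding weak_topology_def using assms \<open>open W\<close>
    by (intro topology_generated_by_Basis) blast
qed auto

section \<open>Push-forward of probability measures by continuous self-maps\<close>

lemma push_forward_measurable:
  assumes "\<nu> \<in> prob_measures X" "continuous_on X (act g)" "act g ` X \<subseteq> X"
  shows "act g \<in> \<nu> \<rightarrow>\<^sub>M restrict_space borel X"
  using assms prob_measures_measurable[OF assms(1,2)] prob_measuresD(3)[OF assms(1)]
  by (intro measurable_restrict_space2) auto

lemma push_forward_in_prob_measures:
  assumes "\<nu> \<in> prob_measures X" "continuous_on X (act g)" "act g ` X \<subseteq> X"
  shows "push_forward X act g \<nu> \<in> prob_measures X"
  using prob_space.prob_space_distr[OF prob_measuresD(1)[OF assms(1)]
      push_forward_measurable[where act = act and g = g, OF assms]]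
  unfolding prob_measures_def push_forward_def by simp

lemma integral_push_forward:
  fixes f :: "'z::topological_space \<Rightarrow> 'b::{banach,second_countable_topology}"
  assumes "\<nu> \<in> prob_measures X" "continuous_on X (act g)" "act g ` X \<subseteq> X" "continuous_on X f"
  shows "(\<integral>x. f x \<partial>push_forward X act g \<nu>) = (\<integral>x. f (act g x) \<partial>\<nu>)"
  unfolding push_forward_def
  by (intro integral_distr push_forward_measurable borel_measurable_continuous_on_restrict assms)

lemma push_forward_push_forward:
  assumes "\<nu> \<in> prob_measures X" "continuous_on X (act g)" "act g ` X \<subseteq> X"
    "continuous_on X (act h)" "act h ` X \<subseteq> X" "\<And>x. x \<in> X \<Longrightarrow> act k x = act g (act h x)"
  shows "push_forward X act g (push_forward X act h \<nu>) = push_forward X act k \<nu>"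
proof -
  have "act g \<in> restrict_space borel X \<rightarrow>\<^sub>M restrict_space borel X"
    using borel_measurable_continuous_on_restrict[OF assms(2)] assms(3)
    by (intro measurable_restrict_space2) (auto simp: space_restrict_space)
  then have "push_forward X act g (push_forward X act h \<nu>) = distr \<nu> (restrict_space borel X) (act g \<circ> act h)"
    unfolding push_forward_def using push_forward_measurable[where act = act and g = h, OF assms(1,4,5)] by (rule distr_distr)
  also have "\<dots> = push_forward X act k \<nu>"
    unfolding push_forward_def using assms(6) prob_measuresD(3)[OF assms(1)]
    by (intro distr_cong) auto
  finally show ?thesis .
qed

lemma push_forward_AE_id:
  assumes "\<nu> \<in> prob_measures X" "continuous_on X (act g)" "act g ` X \<subseteq> X" "AE x in \<nu>. act g x = x"
  shows "push_forward X act g \<nu> = \<nu>"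
proof -
  have "push_forward X act g \<nu> = distr \<nu> (restrict_space borel X) (\<lambda>x. x)"
    unfolding push_forward_def using assms push_forward_measurable[where act = act and g = g, OF assms(1-3)]
      measurable_ident_sets[OF prob_measuresD(2)[OF assms(1)]]
    by (intro distr_cong_AE) auto
  also have "\<dots> = \<nu>" using prob_measuresD(2)[OF assms(1)] by (intro distr_id2) simp
  finally show ?thesis .
qed

text \<open>The preimage of the generating set for \<open>f\<close> is the generating set for
  \<open>f\<close> composed with \<open>act g\<close>.\<close>

lemma continuous_map_push_forward:
  fixes act :: "'g \<Rightarrow> 'z::topological_space \<Rightarrow> 'z"
  assumes g: "continuous_on X (act g)" "act g ` X \<subseteq> X"
  shows "continuous_map (weak_topology X) (weak_topology X) (push_forward X act g)"
proof -
  let ?S = "{{\<nu> \<in> prob_measures X. (\<integral>x. f x \<partial>\<nu>) \<in> W} | (f :: 'z \<Rightarrow> real) W. continuous_on X f \<and> open W}"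
  have "continuous_map (weak_topology X) (topology_generated_by ?S) (push_forward X act g)"
  proof (rule continuous_on_generated_topo)
    fix U assume "U \<in> ?S"
    then obtain f :: "'z \<Rightarrow> real" and W where U: "U = {\<nu> \<in> prob_measures X. (\<integral>x. f x \<partial>\<nu>) \<in> W}"
      and f: "continuous_on X f" and W: "open W" by blast
    have "continuous_on X (\<lambda>x. f (act g x))"
      using continuous_on_compose2[OF f g] .
    moreover have "push_forward X act g -` U \<inter> topspace (weak_topology X)
        = {\<nu> \<in> prob_measures X. (\<integral>x. f (act g x) \<partial>\<nu>) \<in> W}"
      using integral_push_forward[where act = act and g = g, OF _ g f] push_forward_in_prob_measures[where act = act and g = g, OF _ g]
      unfolding U topspace_weak_topology by auto
    ultimately show "openin (weak_topology X) (push_forward X act g -` U \<inter> topspace (weak_topology X))"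
      unfolding weak_topology_def using W by (intro topology_generated_by_Basis) auto
  next
    have "\<Union>?S = prob_measures X"
      using topspace_weak_topology[of X] unfolding weak_topology_def topology_generated_by_topspace .
    then show "push_forward X act g ` topspace (weak_topology X) \<subseteq> \<Union>?S"
      using push_forward_in_prob_measures[where act = act and g = g, OF _ g] by auto
  qed
  then show ?thesis unfolding weak_topology_def .
qed

text \<open>What remains of the geometry: \<open>\<Phi>\<close> is an action of a vector group and
  \<open>m\<close> the gradient map in coordinates. \<open>m_mono\<close> and
  \<open>m_strict\<close> are the time-one forms of "the component along \<open>s\<close> has
  nonnegative derivative along the flow" and "equality occurs only at fixed points".\<close>

locale gradient_flow =
  fixes X :: "'z::{t2_space,second_countable_topology} set"
    and \<Phi> :: "'a::euclidean_space \<Rightarrow> 'z \<Rightarrow> 'z" and m :: "'z \<Rightarrow> 'a"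
  assumes compX: "compact X"
    and flow_continuous: "continuous_on (UNIV \<times> X) (\<lambda>(s, x). \<Phi> s x)"
    and flow_in: "x \<in> X \<Longrightarrow> \<Phi> s x \<in> X"
    and flow_add: "x \<in> X \<Longrightarrow> \<Phi> (s + t) x = \<Phi> s (\<Phi> t x)"
    and flow_zero: "x \<in> X \<Longrightarrow> \<Phi> 0 x = x"
    and m_continuous: "continuous_on X m"
    and m_mono: "x \<in> X \<Longrightarrow> m x \<bullet> s \<le> m (\<Phi> s x) \<bullet> s"
    and m_strict: "x \<in> X \<Longrightarrow> m (\<Phi> s x) \<bullet> s = m x \<bullet> s \<Longrightarrow> \<Phi> (r *\<^sub>R s) x = x"
begin

definition mean :: "'z measure \<Rightarrow> 'a" where
  "mean \<nu> = (\<integral>x. m x \<partial>\<nu>)"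

text \<open>The quantifier over \<open>t\<close> stands inside \<open>AE\<close>, so that one null
  set serves the whole line spanned by \<open>s\<close>; closure under scaling is then
  immediate.\<close>

definition null_directions :: "'z measure \<Rightarrow> 'a set" where
  "null_directions \<nu> = {s. AE x in \<nu>. \<forall>t. \<Phi> (t *\<^sub>R s) x = x}"

lemma flow_image: "\<Phi> s ` X \<subseteq> X"
  using flow_in by blast

lemma flow_continuous_on: "continuous_on X (\<Phi> s)"
proof -
  have "continuous_on X (\<lambda>x. (s, x))" by (intro continuous_intros)
  from continuous_on_compose2[OF flow_continuous this] show ?thesis by auto
qed

lemma m_bounded: "\<exists>C. \<forall>x\<in>X. norm (m x) \<le> C"
  using compact_imp_bounded[OF compact_continuous_image[OF m_continuous compX]]
  unfolding bounded_iff by auto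

lemma mean_push_forward:
  "\<nu> \<in> prob_measures X \<Longrightarrow> mean (push_forward X \<Phi> s \<nu>) = (\<integral>x. m (\<Phi> s x) \<partial>\<nu>)"
  unfolding mean_def by (intro integral_push_forward flow_continuous_on flow_image m_continuous)

lemma m_flow_measurable: "\<nu> \<in> prob_measures X \<Longrightarrow> (\<lambda>x. m (\<Phi> s x)) \<in> borel_measurable \<nu>"
  using continuous_on_compose2[OF m_continuous flow_continuous_on[of s] flow_image[of s]]
  by (intro prob_measures_measurable)

lemma m_flow_integrable:
  assumes "\<nu> \<in> prob_measures X" shows "integrable \<nu> (\<lambda>x. m (\<Phi> s x))"
proof -
  interpret prob_space \<nu> by (rule prob_measuresD(1)[OF assms])
  obtain C where "\<forall>x\<in>X. norm (m x) \<le> C" using m_bounded by blast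
  then show ?thesis
    using flow_in prob_measuresD(3)[OF assms]
    by (intro integrable_const_bound[where B=C] m_flow_measurable assms AE_I2) auto
qed

lemma m_integrable:
  assumes nu: "\<nu> \<in> prob_measures X" shows "integrable \<nu> m"
  using m_flow_integrable[OF nu, of 0] prob_measuresD(3)[OF nu] flow_zero
  by (subst Bochner_Integration.integrable_cong[of \<nu> \<nu> m "\<lambda>x. m (\<Phi> 0 x)"]) auto

lemma mean_bounded: "\<exists>C. \<forall>\<nu>\<in>prob_measures X. norm (mean \<nu>) \<le> C"
proof -
  obtain C where C: "\<And>x. x \<in> X \<Longrightarrow> norm (m x) \<le> C" using m_bounded by blast
  have "norm (mean \<nu>) \<le> C" if nu: "\<nu> \<in> prob_measures X" for \<nu>
  proof -
    interpret prob_space \<nu> by (rule prob_measuresD(1)[OF nu])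
    have "norm (mean \<nu>) \<le> (\<integral>z. norm (m z) \<partial>\<nu>)"
      unfolding mean_def by (rule integral_norm_bound)
    also have "\<dots> \<le> C"
      using C prob_measuresD(3)[OF nu] m_integrable[OF nu]
      by (intro integral_le_const AE_I2) auto
    finally show ?thesis .
  qed
  then show ?thesis by blast
qed

lemma mean_push_forward_inner:
  assumes "\<nu> \<in> prob_measures X"
  shows "mean (push_forward X \<Phi> s \<nu>) \<bullet> u = (\<integral>x. m (\<Phi> s x) \<bullet> u \<partial>\<nu>)"
  unfolding mean_push_forward[OF assms] using m_flow_integrable[OF assms] by simp

text \<open>Increments of the mean are integrals of pointwise nonnegative increments of
  \<open>m\<close>. If such an integral is zero, the increments vanish almost everywhere and
  \<open>m_strict\<close> applies point by point; continuity is dominated convergence, as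
  \<open>m\<close> is bounded on the compact set \<open>X\<close>.\<close>

lemma monotone_field_mean:
  assumes nu: "\<nu> \<in> prob_measures X"
  obtains C where "monotone_field (\<lambda>s. mean (push_forward X \<Phi> s \<nu>)) (null_directions \<nu>) C"
proof -
  interpret prob_space \<nu> by (rule prob_measuresD(1)[OF nu])
  note sp = prob_measuresD(3)[OF nu]
  obtain C where C: "\<And>x. x \<in> X \<Longrightarrow> norm (m x) \<le> C" using m_bounded by blast
  obtain D where D: "\<And>\<nu>. \<nu> \<in> prob_measures X \<Longrightarrow> norm (mean \<nu>) \<le> D" using mean_bounded by blast
  \<comment> \<open>Written with \<open>u + y\<close>, so that \<open>flow_add\<close> splits off
    \<open>u\<close> as the last part of the flow, to which \<open>m_mono\<close> refers.\<close>
  have diff: "(mean (push_forward X \<Phi> (y + u) \<nu>) - mean (push_forward X \<Phi> y \<nu>)) \<bullet> u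
      = (\<integral>x. m (\<Phi> (u + y) x) \<bullet> u - m (\<Phi> y x) \<bullet> u \<partial>\<nu>)" for y u
    unfolding inner_diff_left mean_push_forward_inner[OF nu] add.commute[of y u]
    by (rule Bochner_Integration.integral_diff[symmetric])
      (auto intro!: integrable_inner_left m_flow_integrable nu)
  have nonneg: "0 \<le> m (\<Phi> (u + y) x) \<bullet> u - m (\<Phi> y x) \<bullet> u" if "x \<in> X" for u y x
    using m_mono[OF flow_in[OF that], of y u] flow_add[OF that] by simp
  show thesis
  proof (rule that[of D], unfold_locales)
    show "continuous_on UNIV (\<lambda>s. mean (push_forward X \<Phi> s \<nu>))"
    proof (rule continuous_on_sequentiallyI)
      fix u :: "nat \<Rightarrow> 'a" and a assume u: "u \<longlonglongrightarrow> a"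
      show "(\<lambda>n. mean (push_forward X \<Phi> (u n) \<nu>)) \<longlonglongrightarrow> mean (push_forward X \<Phi> a \<nu>)"
        unfolding mean_push_forward[OF nu]
      proof (rule integral_dominated_convergence[where w="\<lambda>_. C"])
        show "AE x in \<nu>. (\<lambda>n. m (\<Phi> (u n) x)) \<longlonglongrightarrow> m (\<Phi> a x)"
        proof (rule AE_I2)
          fix x assume "x \<in> space \<nu>"
          then have x: "x \<in> X" using sp by simp
          have "continuous_on UNIV (\<lambda>s. m (\<Phi> s x))"
          proof -
            have "continuous_on UNIV (\<lambda>s :: 'a. (s, x))" by (intro continuous_intros)
            from continuous_on_compose2[OF flow_continuous this] x
            have "continuous_on UNIV (\<lambda>s. \<Phi> s x)" by auto
            from continuous_on_compose2[OF m_continuous this] show ?thesis using flow_in[OF x] by auto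
          qed
          then show "(\<lambda>n. m (\<Phi> (u n) x)) \<longlonglongrightarrow> m (\<Phi> a x)"
            using continuous_on_tendsto_compose[where f = "\<lambda>s. m (\<Phi> s x)" and s = UNIV, OF _ u] by simp
        qed
        show "AE x in \<nu>. norm (m (\<Phi> (u n) x)) \<le> C" for n
          using C flow_in sp by (intro AE_I2) auto
      qed (auto intro: m_flow_measurable nu)
    qed
    show "0 \<le> (mean (push_forward X \<Phi> x \<nu>) - mean (push_forward X \<Phi> y \<nu>)) \<bullet> (x - y)" for x y
    proof -
      have "0 \<le> (mean (push_forward X \<Phi> (y + (x - y)) \<nu>) - mean (push_forward X \<Phi> y \<nu>)) \<bullet> (x - y)"
        unfolding diff using nonneg sp by (intro integral_nonneg_AE AE_I2) blast
      then show ?thesis by simp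
    qed
    show "norm (mean (push_forward X \<Phi> x \<nu>)) \<le> D" for x
      by (intro D push_forward_in_prob_measures nu flow_continuous_on flow_image)
    show "subspace (null_directions \<nu>)"
      unfolding subspace_def
    proof (intro conjI ballI allI)
      show "0 \<in> null_directions \<nu>"
        unfolding null_directions_def using flow_zero sp by auto
      show "c *\<^sub>R s \<in> null_directions \<nu>" if "s \<in> null_directions \<nu>" for c s
      proof -
        have "AE x in \<nu>. \<forall>t. \<Phi> (t *\<^sub>R s) x = x" using that unfolding null_directions_def by simp
        then have "AE x in \<nu>. \<forall>t. \<Phi> (t *\<^sub>R c *\<^sub>R s) x = x" by eventually_elim simp
        then show ?thesis unfolding null_directions_def by simp
      qed
      show "s + s' \<in> null_directions \<nu>" if "s \<in> null_directions \<nu>" "s' \<in> null_directions \<nu>" for s s'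
      proof -
        have "AE x in \<nu>. \<forall>t. \<Phi> (t *\<^sub>R s) x = x" "AE x in \<nu>. \<forall>t. \<Phi> (t *\<^sub>R s') x = x"
          using that unfolding null_directions_def by auto
        then have "AE x in \<nu>. \<forall>t. \<Phi> (t *\<^sub>R (s + s')) x = x"
          using AE_space by eventually_elim (simp add: scaleR_add_right flow_add sp)
        then show ?thesis unfolding null_directions_def by simp
      qed
    qed
    show "mean (push_forward X \<Phi> (x + n) \<nu>) = mean (push_forward X \<Phi> x \<nu>)"
      if "n \<in> null_directions \<nu>" for n x
    proof -
      have "AE z in \<nu>. \<forall>t. \<Phi> (t *\<^sub>R n) z = z" using that unfolding null_directions_def by simp
      then have "AE z in \<nu>. m (\<Phi> (x + n) z) = m (\<Phi> x z)"
        using AE_space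
      proof eventually_elim
        case (elim z)
        then show ?case using flow_add[of z x n] spec[OF elim(1), of 1] sp by simp
      qed
      then show ?thesis
        unfolding mean_push_forward[OF nu] by (intro integral_cong_AE m_flow_measurable nu)
    qed
    show "0 < (mean (push_forward X \<Phi> (x + u) \<nu>) - mean (push_forward X \<Phi> x \<nu>)) \<bullet> u"
      if u: "u \<notin> null_directions \<nu>" for u x
    proof (rule ccontr)
      let ?k = "\<lambda>z. m (\<Phi> (u + x) z) \<bullet> u - m (\<Phi> x z) \<bullet> u"
      assume "\<not> ?thesis"
      moreover have "0 \<le> (\<integral>z. ?k z \<partial>\<nu>)" using nonneg sp by (intro integral_nonneg_AE AE_I2) blast
      ultimately have "(\<integral>z. ?k z \<partial>\<nu>) = 0" unfolding diff by linarith
      moreover have "integrable \<nu> ?k"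
        by (auto intro!: integrable_inner_left m_flow_integrable nu)
      moreover have "AE z in \<nu>. 0 \<le> ?k z" using nonneg sp by (intro AE_I2) blast
      ultimately have "AE z in \<nu>. ?k z = 0" using integral_nonneg_eq_0_iff_AE by blast
      then have "AE z in \<nu>. \<forall>t. \<Phi> (t *\<^sub>R u) z = z"
        using AE_space
      proof eventually_elim
        case (elim z)
        then have z: "z \<in> X" using sp by simp
        show ?case
        proof
          fix t
          have "\<Phi> (t *\<^sub>R u) (\<Phi> x z) = \<Phi> x z"
            using elim(1) flow_add[OF z, of u x] by (intro m_strict flow_in z) simp
          \<comment> \<open>Fixedness is known at the moved point \<open>\<Phi> x z\<close>; as the
            parameters commute, flowing back by \<open>- x\<close> brings it to
            \<open>z\<close>.\<close>
          then have "\<Phi> (- x) (\<Phi> (t *\<^sub>R u) (\<Phi> x z)) = \<Phi> (- x) (\<Phi> x z)" by simp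
          then have "\<Phi> (- x + (t *\<^sub>R u + x)) z = \<Phi> (- x + x) z"
            using flow_add[OF z] flow_add[OF flow_in[OF z]] flow_in[OF z] by metis
          then show "\<Phi> (t *\<^sub>R u) z = z" using flow_zero[OF z] by simp
        qed
      qed
      then show False using u unfolding null_directions_def by simp
    qed
  qed
qed

section \<open>Orbits of measures, their closures and their means\<close>

lemma measure_orbit_eq_range: "measure_orbit X \<Phi> UNIV \<nu> = range (\<lambda>s. push_forward X \<Phi> s \<nu>)"
  unfolding measure_orbit_def ..

lemma convex_mean_orbit:
  assumes "\<nu> \<in> prob_measures X"
  shows "convex (mean ` measure_orbit X \<Phi> UNIV \<nu>)"
proof -
  obtain C where "monotone_field (\<lambda>s. mean (push_forward X \<Phi> s \<nu>)) (null_directions \<nu>) C"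
    using monotone_field_mean[OF assms] by blast
  from monotone_field.convex_range[OF this] show ?thesis
    unfolding measure_orbit_eq_range image_image .
qed

lemma orbit_subset: "\<nu> \<in> prob_measures X \<Longrightarrow> measure_orbit X \<Phi> UNIV \<nu> \<subseteq> prob_measures X"
  unfolding measure_orbit_eq_range
  by (intro image_subsetI push_forward_in_prob_measures flow_continuous_on flow_image)

text \<open>Each push-forward is weakly continuous and maps the orbit into itself, hence also its
  closure.\<close>

lemma closure_of_orbit_invariant:
  assumes nu: "\<nu> \<in> prob_measures X"
    and L: "L \<in> weak_topology X closure_of measure_orbit X \<Phi> UNIV \<nu>"
  shows "push_forward X \<Phi> s L \<in> weak_topology X closure_of measure_orbit X \<Phi> UNIV \<nu>"
proof -
  let ?O = "measure_orbit X \<Phi> UNIV \<nu>"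
  have "push_forward X \<Phi> s ` ?O \<subseteq> ?O"
  proof -
    have "push_forward X \<Phi> s (push_forward X \<Phi> t \<nu>) = push_forward X \<Phi> (s + t) \<nu>" for t
      using flow_add by (intro push_forward_push_forward nu flow_continuous_on flow_image)
    then show ?thesis unfolding measure_orbit_eq_range by auto
  qed
  moreover have "push_forward X \<Phi> s L \<in> weak_topology X closure_of (push_forward X \<Phi> s ` ?O)"
    by (rule subsetD[OF continuous_map_image_closure_subset[OF continuous_map_push_forward[
            where act = \<Phi> and g = s, OF flow_continuous_on flow_image]] imageI[OF L]])
  ultimately show ?thesis by (meson closure_of_mono subsetD)
qed

text \<open>One inclusion is continuity of the mean. For the other, measures whose means converge
  have a weakly convergent subsequence, and its limit has the required mean.\<close>

lemma mean_closure_of: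
  assumes S: "S \<subseteq> prob_measures X"
  shows "mean ` (weak_topology X closure_of S) = closure (mean ` S)"
proof (rule equalityI)
  have "continuous_map (weak_topology X) euclidean mean"
  proof -
    have "continuous_map (weak_topology X) euclideanreal (\<lambda>\<nu>. mean \<nu> \<bullet> b)" for b
    proof (rule continuous_map_eq)
      show "continuous_map (weak_topology X) euclideanreal (\<lambda>\<nu>. \<integral>x. m x \<bullet> b \<partial>\<nu>)"
        by (intro continuous_map_weak_integral continuous_intros m_continuous)
      fix \<nu> assume "\<nu> \<in> topspace (weak_topology X)"
      then have nu: "\<nu> \<in> prob_measures X" by simp
      show "(\<integral>x. m x \<bullet> b \<partial>\<nu>) = mean \<nu> \<bullet> b" unfolding mean_def using m_integrable[OF nu] by simp
    qed
    then show ?thesis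
      by (simp add: continuous_map_atin tendsto_componentwise_iff[of mean])
  qed
  then show "mean ` (weak_topology X closure_of S) \<subseteq> closure (mean ` S)"
    using continuous_map_image_closure_subset by fastforce
  show "closure (mean ` S) \<subseteq> mean ` (weak_topology X closure_of S)"
  proof
    fix y assume "y \<in> closure (mean ` S)"
    then obtain z where z: "\<And>n :: nat. z n \<in> mean ` S" "z \<longlonglongrightarrow> y" unfolding closure_sequential by blast
    then have "\<forall>n. \<exists>L\<in>S. z n = mean L" by blast
    then obtain \<nu> where nu: "\<And>n. \<nu> n \<in> S" "\<And>n. z n = mean (\<nu> n)" by metis
    then have nuX: "\<nu> n \<in> prob_measures X" for n using S by blast
    obtain r L where r: "strict_mono r" and L: "L \<in> prob_measures X"
      and lim: "\<And>f :: 'z \<Rightarrow> real. continuous_on X f \<Longrightarrow> (\<lambda>n. \<integral>x. f x \<partial>\<nu> (r n)) \<longlonglongrightarrow> (\<integral>x. f x \<partial>L)"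
      by (rule prob_measures_sequentially_compact[of X \<nu>, OF compX nuX]) (rule that)
    have limL: "limitin (weak_topology X) (\<lambda>n. \<nu> (r n)) L sequentially"
      using lim by (intro limitin_weak_topology nuX L)
    then have "L \<in> weak_topology X closure_of S" using nu(1) by (rule limitin_in_closure_of)
    moreover have "mean L = y"
    proof (rule LIMSEQ_unique)
      show "(\<lambda>n. z (r n)) \<longlonglongrightarrow> y" using LIMSEQ_subseq_LIMSEQ[OF z(2) r] by (simp add: comp_def)
      show "(\<lambda>n. z (r n)) \<longlonglongrightarrow> mean L"
        using continuous_map_limit[OF \<open>continuous_map (weak_topology X) euclidean mean\<close> limL]
        by (simp add: nu(2) comp_def)
    qed
    ultimately show "y \<in> mean ` (weak_topology X closure_of S)" by blast
  qed
qed

theorem mean_closure_orbit: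
  assumes nu: "\<nu> \<in> prob_measures X"
  defines "S \<equiv> weak_topology X closure_of measure_orbit X \<Phi> UNIV \<nu>"
  shows "mean ` S = convex hull (mean ` (invariant_measures X \<Phi> UNIV \<inter> S))"
proof -
  have SX: "S \<subseteq> prob_measures X" 
    unfolding S_def
    using closure_of_subset_topspace[of "weak_topology X" "measure_orbit X \<Phi> UNIV \<nu>"] by simp
  have eq: "mean ` S = closure (mean ` measure_orbit X \<Phi> UNIV \<nu>)"
    unfolding S_def by (rule mean_closure_of[OF orbit_subset[OF nu]])
  have conv: "convex (mean ` S)" unfolding eq by (intro convex_closure convex_mean_orbit nu)
  have "bounded (mean ` S)"
  proof -
    obtain C where "\<And>L. L \<in> prob_measures X \<Longrightarrow> norm (mean L) \<le> C" using mean_bounded by blast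
    then show ?thesis unfolding bounded_iff using SX by (intro exI[of _ C]) auto
  qed
  then have comp: "compact (mean ` S)" unfolding compact_eq_bounded_closed eq by simp
  have "x \<in> mean ` (invariant_measures X \<Phi> UNIV \<inter> S)" if x: "x extreme_point_of (mean ` S)" for x
  proof -
    obtain L where L: "L \<in> S" "x = mean L" using x unfolding extreme_point_of_def by blast
    then have LX: "L \<in> prob_measures X" using SX by blast
    obtain C where mf: "monotone_field (\<lambda>s. mean (push_forward X \<Phi> s L)) (null_directions L) C"
      using monotone_field_mean[OF LX] by blast
    have "push_forward X \<Phi> 0 L = L"
      using flow_zero prob_measuresD(3)[OF LX]
      by (intro push_forward_AE_id LX flow_continuous_on flow_image AE_I2) auto
    then have "mean (push_forward X \<Phi> 0 L) extreme_point_of (mean ` S)" using x L(2) by simp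
    \<comment> \<open>The orbit of \<open>L\<close> stays in the closure, so its means lie in the
      set of which \<open>x\<close> is an extreme point.\<close>
    moreover have "range (\<lambda>s. mean (push_forward X \<Phi> s L)) \<subseteq> mean ` S"
      using closure_of_orbit_invariant[OF nu L(1)[unfolded S_def]] unfolding S_def
      by (intro image_subsetI imageI)
    ultimately have "null_directions L = UNIV" using monotone_field.extreme_imp_null[OF mf] by blast
    then have AE: "AE z in L. \<forall>t. \<Phi> (t *\<^sub>R s) z = z" for s
      unfolding null_directions_def by blast
    have "push_forward X \<Phi> s L = L" for s
    proof (rule push_forward_AE_id[OF LX flow_continuous_on flow_image])
      show "AE z in L. \<Phi> s z = z" using AE[of s] by eventually_elim (metis scaleR_one)
    qed
    then have "L \<in> invariant_measures X \<Phi> UNIV" unfolding invariant_measures_def using LX by blast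
    with L show ?thesis by blast
  qed
  then have "mean ` S \<subseteq> convex hull (mean ` (invariant_measures X \<Phi> UNIV \<inter> S))"
    using Krein_Milman_Minkowski[OF comp conv] by (metis hull_mono mem_Collect_eq subsetI)
  moreover have "convex hull (mean ` (invariant_measures X \<Phi> UNIV \<inter> S)) \<subseteq> mean ` S"
    using conv by (intro hull_minimal) auto
  ultimately show ?thesis by blast
qed

end

section \<open>Tangent maps in selected charts\<close>

text \<open>Both functions have exactly the same derivatives at \<open>z\<close>, so the choice
  operator behind \<open>frechet_derivative\<close> picks the same one; differentiability need not
  be known.\<close>

lemma frechet_derivative_cong_open:
  assumes "open S" "z \<in> S" "\<And>x. x \<in> S \<Longrightarrow> f x = g x"
  shows "frechet_derivative f (at z) = frechet_derivative g (at z)"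
proof -
  have "(f has_derivative L) (at z) \<longleftrightarrow> (g has_derivative L) (at z)" for L
    using has_derivative_transform_within_open[of f L z UNIV S g]
      has_derivative_transform_within_open[of g L z UNIV S f] assms by auto
  then show ?thesis unfolding frechet_derivative_def by simp
qed

lemma Ck_on_cong_open:
  assumes "open S" "\<And>x. x \<in> S \<Longrightarrow> f x = g x" "Ck_on k S f"
  shows "Ck_on k S g"
  using assms(2,3)
proof (induction k arbitrary: f g)
  case 0
  then show ?case using continuous_on_eq[of S f g] by simp
next
  case (Suc k)
  have "g differentiable (at x)" if x: "x \<in> S" for x
  proof -
    obtain L where "(f has_derivative L) (at x)"
      using Suc.prems(2) x unfolding Ck_on.simps differentiable_def by blast
    then have "(g has_derivative L) (at x)"
      by (rule has_derivative_transform_within_open[OF _ assms(1) x]) (rule Suc.prems(1))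
    then show ?thesis unfolding differentiable_def by blast
  qed
  moreover have "Ck_on k S (\<lambda>x. frechet_derivative g (at x) v)" for v
  proof (rule Suc.IH)
    show "Ck_on k S (\<lambda>x. frechet_derivative f (at x) v)" using Suc.prems(2) by simp
    show "frechet_derivative f (at x) v = frechet_derivative g (at x) v" if "x \<in> S" for x
      using frechet_derivative_cong_open[of S x f g, OF assms(1) that Suc.prems(1)] by simp
  qed
  ultimately show ?case by simp
qed

section \<open>Velocities and tangent maps with respect to selected charts\<close>

definition chart_dom :: "('m, 'e) atlas \<Rightarrow> 'm \<Rightarrow> 'm set" where
  "chart_dom \<A> p = fst (chart_at \<A> p)"

text \<open>Outside the chart domain \<open>coord\<close> is arbitrary, so a derivative of the
  coordinates says nothing about where the curve is; continuity is therefore demanded as well. It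
  ensures that the curve stays in the chart for nearby times.\<close>

definition velocity :: "('m::t2_space, 'e::real_normed_vector) atlas \<Rightarrow> (real \<Rightarrow> 'm) \<Rightarrow> real
    \<Rightarrow> 'e \<Rightarrow> bool" where
  "velocity \<A> c t v \<longleftrightarrow> isCont c t \<and> ((\<lambda>s. coord \<A> (c t) (c s)) has_vector_derivative v) (at t)"

definition has_tangent_map :: "('m::t2_space, 'e::real_normed_vector) atlas
    \<Rightarrow> ('n::t2_space, 'f::real_normed_vector) atlas \<Rightarrow> ('m \<Rightarrow> 'n) \<Rightarrow> 'm \<Rightarrow> ('e \<Rightarrow> 'f) \<Rightarrow> bool" where
  "has_tangent_map \<A> \<B> f p L \<longleftrightarrow> isCont f p \<and>
     ((\<lambda>y. coord \<B> (f p) (f (coord_inv \<A> p y))) has_derivative L) (at (coord \<A> p p))"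

definition has_tangent_map2 :: "('m::t2_space, 'e::real_normed_vector) atlas
    \<Rightarrow> ('n::t2_space, 'f::real_normed_vector) atlas
    \<Rightarrow> ('o::t2_space, 'h::real_normed_vector) atlas
    \<Rightarrow> ('m \<Rightarrow> 'n \<Rightarrow> 'o) \<Rightarrow> 'm \<Rightarrow> 'n \<Rightarrow> ('e \<times> 'f \<Rightarrow> 'h) \<Rightarrow> bool" where
  "has_tangent_map2 \<A> \<B> \<C> f p q L \<longleftrightarrow> isCont (\<lambda>(x, y). f x y) (p, q) \<and>
     ((\<lambda>z. coord \<C> (f p q) (f (coord_inv \<A> p (fst z)) (coord_inv \<B> q (snd z)))) has_derivative L)
       (at (coord \<A> p p, coord \<B> q q))"

context
  fixes J :: "'e::fin_dim_space \<Rightarrow> 'e" and \<A> :: "('m::{t2_space,second_countable_topology}, 'e::fin_dim_space) atlas"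
  assumes M: "complex_manifold J \<A>"
begin

lemma chart_at_in: "chart_at \<A> p \<in> \<A>" and base_in_chart_dom: "p \<in> chart_dom \<A> p"
proof -
  have "p \<in> \<Union>(fst ` \<A>)" using M unfolding complex_manifold_def by simp
  then have "\<exists>c. c \<in> \<A> \<and> p \<in> fst c" by blast
  from someI_ex[OF this] show "chart_at \<A> p \<in> \<A>" "p \<in> chart_dom \<A> p"
    unfolding chart_at_def chart_dom_def by auto
qed

lemma chart_pair_in: "(chart_dom \<A> p, coord \<A> p) \<in> \<A>"
  using chart_at_in[of p] unfolding chart_dom_def coord_def by simp

lemma coord_inv_eq: "coord_inv \<A> p = inv_into (chart_dom \<A> p) (coord \<A> p)"
  unfolding coord_inv_def chart_dom_def coord_def ..

lemma
  shows open_chart_dom: "open (chart_dom \<A> p)"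
    and open_coord_image: "open (coord \<A> p ` chart_dom \<A> p)"
    and coord_homeomorphism:
      "homeomorphism (chart_dom \<A> p) (coord \<A> p ` chart_dom \<A> p) (coord \<A> p) (coord_inv \<A> p)"
proof -
  have "case (chart_dom \<A> p, coord \<A> p) of (D, \<phi>) \<Rightarrow>
      open D \<and> open (\<phi> ` D) \<and> homeomorphism D (\<phi> ` D) \<phi> (inv_into D \<phi>)"
    using M chart_pair_in[of p] unfolding complex_manifold_def by blast
  then show "open (chart_dom \<A> p)" "open (coord \<A> p ` chart_dom \<A> p)"
    "homeomorphism (chart_dom \<A> p) (coord \<A> p ` chart_dom \<A> p) (coord \<A> p) (coord_inv \<A> p)"
    unfolding coord_inv_eq by simp_all
qed

lemma coord_inv_coord: "x \<in> chart_dom \<A> p \<Longrightarrow> coord_inv \<A> p (coord \<A> p x) = x"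
  using coord_homeomorphism[of p] unfolding homeomorphism_def by blast

lemma coord_coord_inv: "y \<in> coord \<A> p ` chart_dom \<A> p \<Longrightarrow> coord \<A> p (coord_inv \<A> p y) = y"
  using coord_homeomorphism[of p] unfolding homeomorphism_def by blast

lemma isCont_coord: "x \<in> chart_dom \<A> p \<Longrightarrow> isCont (coord \<A> p) x"
  using continuous_on_eq_continuous_at[OF open_chart_dom]
    homeomorphism_cont1[OF coord_homeomorphism] by blast

lemma isCont_coord_inv: "x \<in> chart_dom \<A> p \<Longrightarrow> isCont (coord_inv \<A> p) (coord \<A> p x)"
  using continuous_on_eq_continuous_at[OF open_coord_image]
    homeomorphism_cont2[OF coord_homeomorphism] by blast

lemma eventually_chart_dom:
  assumes "isCont c (t :: 't::t2_space)"
  shows "\<forall>\<^sub>F s in nhds t. c s \<in> chart_dom \<A> (c t)"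
proof -
  have "(c \<longlongrightarrow> c t) (nhds t)" using assms unfolding continuous_at tendsto_at_iff_tendsto_nhds .
  then show ?thesis using open_chart_dom base_in_chart_dom by (rule topological_tendstoD)
qed

lemma transition_differentiable:
  assumes "x \<in> chart_dom \<A> p" "x \<in> chart_dom \<A> q"
  shows "(\<lambda>y. coord \<A> q (coord_inv \<A> p y)) differentiable (at (coord \<A> p x))"
proof -
  have "holo_on J J (coord \<A> p ` (chart_dom \<A> p \<inter> chart_dom \<A> q)) (coord \<A> q \<circ> coord_inv \<A> p)"
    using M chart_pair_in unfolding complex_manifold_def coord_inv_eq by blast
  then have "Ck_on (Suc 0) (coord \<A> p ` (chart_dom \<A> p \<inter> chart_dom \<A> q)) (coord \<A> q \<circ> coord_inv \<A> p)"
    unfolding holo_on_def smooth_on_def by blast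
  then have "(coord \<A> q \<circ> coord_inv \<A> p) differentiable (at (coord \<A> p x))"
    using assms by auto
  then show ?thesis by (simp add: comp_def)
qed

lemma velocity_const: "velocity \<A> (\<lambda>_. p) t 0"
  unfolding velocity_def by simp

text \<open>Zero is the one velocity that looks the same in all charts: whatever the derivative of
  the transition map is, it sends 0 to 0.\<close>

lemma velocity_other_chart:
  assumes c: "velocity \<A> c t 0" and x: "c t \<in> chart_dom \<A> q"
  shows "((\<lambda>s. coord \<A> q (c s)) has_derivative (\<lambda>_. 0)) (at t)"
proof -
  let ?p = "c t"
  obtain L where L: "((\<lambda>y. coord \<A> q (coord_inv \<A> ?p y)) has_derivative L) (at (coord \<A> ?p ?p))"
    using transition_differentiable[OF base_in_chart_dom x] unfolding differentiable_def by blast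
  have "((\<lambda>s. coord \<A> ?p (c s)) has_derivative (\<lambda>_. 0)) (at t)"
    using c unfolding velocity_def has_vector_derivative_def by simp
  from has_derivative_compose[OF this L]
  have "((\<lambda>s. coord \<A> q (coord_inv \<A> ?p (coord \<A> ?p (c s)))) has_derivative (\<lambda>_. 0)) (at t)"
    using has_derivative_bounded_linear[OF L] by (simp add: linear_simps)
  then show ?thesis
  proof (rule has_derivative_transform_eventually)
    have "\<forall>\<^sub>F s in nhds t. c s \<in> chart_dom \<A> ?p"
      using c by (intro eventually_chart_dom) (simp add: velocity_def)
    then have "\<forall>\<^sub>F s in nhds t. coord \<A> q (coord_inv \<A> ?p (coord \<A> ?p (c s))) = coord \<A> q (c s)"
      by eventually_elim (simp add: coord_inv_coord)
    then show "\<forall>\<^sub>F s in at t. coord \<A> q (coord_inv \<A> ?p (coord \<A> ?p (c s))) = coord \<A> q (c s)"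
      by (simp add: eventually_nhds_conv_at)
  qed (simp_all add: coord_inv_coord base_in_chart_dom)
qed

text \<open>The selected chart changes from point to point along the curve. Near a given time all
  nearby points lie in one chart, where the derivative vanishes on a ball, so the curve is locally
  constant, and the line is connected. This takes the place of uniqueness for differential
  equations.\<close>

lemma zero_velocity_constant:
  assumes c: "\<And>t. velocity \<A> c t 0"
  shows "c s = c t"
proof (rule connected_local_const[of UNIV s t c])
  show "\<forall>a\<in>UNIV. \<forall>\<^sub>F b in at a within UNIV. c a = c b"
  proof
    fix a :: real
    have cont: "isCont c t" for t using c unfolding velocity_def by blast
    have "\<forall>\<^sub>F s in nhds a. c s \<in> chart_dom \<A> (c a)" by (rule eventually_chart_dom[OF cont])
    then obtain e where e: "e > 0" "\<And>s. s \<in> ball a e \<Longrightarrow> c s \<in> chart_dom \<A> (c a)"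
      unfolding eventually_nhds_metric by (auto simp: dist_commute)
    have "\<exists>k. \<forall>s\<in>ball a e. coord \<A> (c a) (c s) = k"
      using velocity_other_chart[OF c e(2)]
      by (intro has_derivative_zero_constant) (auto intro: has_derivative_at_withinI)
    then have "coord \<A> (c a) (c s) = coord \<A> (c a) (c a)" if "s \<in> ball a e" for s
      using that e(1) by (metis centre_in_ball)
    then have "c a = c s" if "s \<in> ball a e" for s
      using that coord_inv_coord[OF e(2)[OF that]] coord_inv_coord[OF base_in_chart_dom] by metis
    then show "\<forall>\<^sub>F b in at a within UNIV. c a = c b"
      using e(1) unfolding eventually_at by (metis dist_commute mem_ball)
  qed
qed simp_all

lemma velocity_compose:
  assumes c: "velocity \<A> c t v" and f: "has_tangent_map \<A> \<B> f (c t) L"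
  shows "velocity \<B> (\<lambda>s. f (c s)) t (L v)"
  unfolding velocity_def
proof
  have cont: "isCont c t" using c by (simp add: velocity_def)
  show "isCont (\<lambda>s. f (c s)) t" using cont f unfolding has_tangent_map_def by (blast intro: isCont_o2)
  have L: "((\<lambda>y. coord \<B> (f (c t)) (f (coord_inv \<A> (c t) y))) has_derivative L) (at (coord \<A> (c t) (c t)))"
    using f unfolding has_tangent_map_def by blast
  have "((\<lambda>s. coord \<A> (c t) (c s)) has_derivative (\<lambda>r. r *\<^sub>R v)) (at t)"
    using c unfolding velocity_def has_vector_derivative_def by simp
  from has_derivative_compose[OF this L]
  have "((\<lambda>s. coord \<B> (f (c t)) (f (coord_inv \<A> (c t) (coord \<A> (c t) (c s))))) has_derivative (\<lambda>r. r *\<^sub>R L v)) (at t)"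
    using has_derivative_bounded_linear[OF L] by (simp add: linear_simps)
  then have "((\<lambda>s. coord \<B> (f (c t)) (f (c s))) has_derivative (\<lambda>r. r *\<^sub>R L v)) (at t)"
  proof (rule has_derivative_transform_eventually)
    have "\<forall>\<^sub>F s in nhds t. coord \<B> (f (c t)) (f (coord_inv \<A> (c t) (coord \<A> (c t) (c s)))) = coord \<B> (f (c t)) (f (c s))"
      using eventually_chart_dom[OF cont] by eventually_elim (simp add: coord_inv_coord)
    then show "\<forall>\<^sub>F s in at t. coord \<B> (f (c t)) (f (coord_inv \<A> (c t) (coord \<A> (c t) (c s)))) = coord \<B> (f (c t)) (f (c s))"
      by (simp add: eventually_nhds_conv_at)
  qed (simp_all add: coord_inv_coord base_in_chart_dom)
  then show "((\<lambda>s. coord \<B> (f (c t)) (f (c s))) has_vector_derivative L v) (at t)"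
    unfolding has_vector_derivative_def .
qed

lemma has_tangent_mapD:
  assumes "has_tangent_map \<A> \<B> f p L"
  shows "tangent_map \<A> \<B> f p = L"
  using assms frechet_derivative_at[of "\<lambda>y. coord \<B> (f p) (f (coord_inv \<A> p y))" L "coord \<A> p p"]
  unfolding has_tangent_map_def tangent_map_def comp_def by simp

lemma has_tangent_map_id: "has_tangent_map \<A> \<A> (\<lambda>x. x) p (\<lambda>v. v)"
  unfolding has_tangent_map_def
proof
  have "((\<lambda>y. y) has_derivative (\<lambda>v. v)) (at (coord \<A> p p))" by simp
  then show "((\<lambda>y. coord \<A> p (coord_inv \<A> p y)) has_derivative (\<lambda>v. v)) (at (coord \<A> p p))"
    by (rule has_derivative_transform_within_open[OF _ open_coord_image[of p]])
      (use base_in_chart_dom coord_coord_inv in auto)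
qed simp

end

lemma has_tangent_map_compose:
  assumes MA: "complex_manifold J \<A>" and MB: "complex_manifold J' \<B>"
    and f: "has_tangent_map \<A> \<B> f p L" and g: "has_tangent_map \<B> \<C> g (f p) L'"
  shows "has_tangent_map \<A> \<C> (\<lambda>x. g (f x)) p (\<lambda>v. L' (L v))"
  unfolding has_tangent_map_def
proof
  let ?y = "coord \<A> p p"
  show "isCont (\<lambda>x. g (f x)) p" using f g unfolding has_tangent_map_def by (blast intro: isCont_o2)
  have p: "coord_inv \<A> p ?y = p" by (simp add: coord_inv_coord[OF MA] base_in_chart_dom[OF MA])
  have "isCont (coord_inv \<A> p) ?y" by (rule isCont_coord_inv[OF MA base_in_chart_dom[OF MA]])
  then have cont: "isCont (\<lambda>y. f (coord_inv \<A> p y)) ?y"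
    using f p unfolding has_tangent_map_def by (metis isCont_o2)
  have df: "((\<lambda>y. coord \<B> (f p) (f (coord_inv \<A> p y))) has_derivative L) (at ?y)"
    using f unfolding has_tangent_map_def by blast
  have dg: "((\<lambda>y. coord \<C> (g (f p)) (g (coord_inv \<B> (f p) y))) has_derivative L') (at (coord \<B> (f p) (f p)))"
    using g unfolding has_tangent_map_def by blast
  from has_derivative_compose[OF df, of _ L'] dg
  have "((\<lambda>y. coord \<C> (g (f p)) (g (coord_inv \<B> (f p) (coord \<B> (f p) (f (coord_inv \<A> p y))))))
      has_derivative (\<lambda>v. L' (L v))) (at ?y)" by (simp add: p)
  then show "((\<lambda>y. coord \<C> (g (f p)) (g (f (coord_inv \<A> p y)))) has_derivative (\<lambda>v. L' (L v))) (at ?y)"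
  proof (rule has_derivative_transform_eventually)
    have "\<forall>\<^sub>F y in nhds ?y. f (coord_inv \<A> p y) \<in> chart_dom \<B> (f p)"
      using eventually_chart_dom[OF MB cont] p by simp
    then have "\<forall>\<^sub>F y in nhds ?y. coord \<C> (g (f p)) (g (coord_inv \<B> (f p) (coord \<B> (f p) (f (coord_inv \<A> p y)))))
        = coord \<C> (g (f p)) (g (f (coord_inv \<A> p y)))"
      by eventually_elim (simp add: coord_inv_coord[OF MB])
    then show "\<forall>\<^sub>F y in at ?y. coord \<C> (g (f p)) (g (coord_inv \<B> (f p) (coord \<B> (f p) (f (coord_inv \<A> p y)))))
        = coord \<C> (g (f p)) (g (f (coord_inv \<A> p y)))"
      by (simp add: eventually_nhds_conv_at)
  qed (simp_all add: p coord_inv_coord[OF MB] base_in_chart_dom[OF MB])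
qed

lemma velocity_pair:
  assumes MA: "complex_manifold J \<A>" and MB: "complex_manifold J' \<B>"
    and f: "has_tangent_map2 \<A> \<B> \<C> f p q L"
    and c: "velocity \<A> c t v" "c t = p" and d: "velocity \<B> d t w" "d t = q"
  shows "velocity \<C> (\<lambda>s. f (c s) (d s)) t (L (v, w))"
  unfolding velocity_def c(2) d(2)
proof
  have cc: "isCont c t" and cd: "isCont d t" using c d by (simp_all add: velocity_def)
  have "isCont (\<lambda>s. (c s, d s)) t" using cc cd by (intro continuous_intros)
  then have "isCont (\<lambda>s. (\<lambda>(x, y). f x y) (c s, d s)) t"
    by (rule isCont_o2) (use f c d in \<open>simp add: has_tangent_map2_def\<close>)
  then show "isCont (\<lambda>s. f (c s) (d s)) t" by simp
  have L: "((\<lambda>z. coord \<C> (f p q) (f (coord_inv \<A> p (fst z)) (coord_inv \<B> q (snd z)))) has_derivative L)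
       (at (coord \<A> p (c t), coord \<B> q (d t)))"
    using f unfolding has_tangent_map2_def c d by blast
  have "((\<lambda>s. coord \<A> p (c s)) has_derivative (\<lambda>r. r *\<^sub>R v)) (at t)"
    "((\<lambda>s. coord \<B> q (d s)) has_derivative (\<lambda>r. r *\<^sub>R w)) (at t)"
    using c d unfolding velocity_def has_vector_derivative_def by simp_all
  then have "((\<lambda>s. (coord \<A> p (c s), coord \<B> q (d s))) has_derivative (\<lambda>r. (r *\<^sub>R v, r *\<^sub>R w))) (at t)"
    by (rule has_derivative_Pair)
  from has_derivative_compose[OF this L]
  have "((\<lambda>s. coord \<C> (f p q) (f (coord_inv \<A> p (coord \<A> p (c s))) (coord_inv \<B> q (coord \<B> q (d s)))))
      has_derivative (\<lambda>r. L (r *\<^sub>R (v, w)))) (at t)"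
    by simp
  then have "((\<lambda>s. coord \<C> (f p q) (f (coord_inv \<A> p (coord \<A> p (c s))) (coord_inv \<B> q (coord \<B> q (d s)))))
      has_derivative (\<lambda>r. r *\<^sub>R L (v, w))) (at t)"
    unfolding linear_simps(5)[OF has_derivative_bounded_linear[OF L]] .
  then have "((\<lambda>s. coord \<C> (f p q) (f (c s) (d s))) has_derivative (\<lambda>r. r *\<^sub>R L (v, w))) (at t)"
  proof (rule has_derivative_transform_eventually)
    have "\<forall>\<^sub>F s in nhds t. coord \<C> (f p q) (f (coord_inv \<A> p (coord \<A> p (c s))) (coord_inv \<B> q (coord \<B> q (d s))))
        = coord \<C> (f p q) (f (c s) (d s))"
      using eventually_chart_dom[OF MA cc] eventually_chart_dom[OF MB cd] unfolding c d
      by eventually_elim (simp add: coord_inv_coord[OF MA] coord_inv_coord[OF MB])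
    then show "\<forall>\<^sub>F s in at t. coord \<C> (f p q) (f (coord_inv \<A> p (coord \<A> p (c s))) (coord_inv \<B> q (coord \<B> q (d s))))
        = coord \<C> (f p q) (f (c s) (d s))"
      by (simp add: eventually_nhds_conv_at)
  qed (simp_all add: c d coord_inv_coord[OF MA] base_in_chart_dom[OF MA] coord_inv_coord[OF MB] base_in_chart_dom[OF MB])
  then show "((\<lambda>s. coord \<C> (f p q) (f (c s) (d s))) has_vector_derivative L (v, w)) (at t)"
    unfolding has_vector_derivative_def .
qed

lemma has_tangent_map2_left:
  assumes MB: "complex_manifold J' \<B>" and f: "has_tangent_map2 \<A> \<B> \<C> f p q L"
  shows "has_tangent_map \<A> \<C> (\<lambda>x. f x q) p (\<lambda>v. L (v, 0))"
  unfolding has_tangent_map_def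
proof
  have "isCont (\<lambda>x. (x, q)) p" by (intro continuous_intros)
  then have "isCont (\<lambda>x. (\<lambda>(x, y). f x y) (x, q)) p"
    by (rule isCont_o2) (use f in \<open>simp add: has_tangent_map2_def\<close>)
  then show "isCont (\<lambda>x. f x q) p" by simp
  have L: "((\<lambda>z. coord \<C> (f p q) (f (coord_inv \<A> p (fst z)) (coord_inv \<B> q (snd z)))) has_derivative L)
       (at (coord \<A> p p, coord \<B> q q))"
    using f unfolding has_tangent_map2_def by blast
  have "((\<lambda>y. (y, coord \<B> q q)) has_derivative (\<lambda>v. (v, 0))) (at (coord \<A> p p))"
    by (intro has_derivative_Pair has_derivative_ident has_derivative_const)
  from has_derivative_compose[OF this L]
  show "((\<lambda>y. coord \<C> (f p q) (f (coord_inv \<A> p y) q)) has_derivative (\<lambda>v. L (v, 0))) (at (coord \<A> p p))"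
    by (simp add: coord_inv_coord[OF MB] base_in_chart_dom[OF MB])
qed

lemma has_tangent_map2_right:
  assumes MA: "complex_manifold J \<A>" and f: "has_tangent_map2 \<A> \<B> \<C> f p q L"
  shows "has_tangent_map \<B> \<C> (f p) q (\<lambda>w. L (0, w))"
  unfolding has_tangent_map_def
proof
  have "isCont (\<lambda>y. (p, y)) q" by (intro continuous_intros)
  then have "isCont (\<lambda>y. (\<lambda>(x, y). f x y) (p, y)) q"
    by (rule isCont_o2) (use f in \<open>simp add: has_tangent_map2_def\<close>)
  then show "isCont (f p) q" by simp
  have L: "((\<lambda>z. coord \<C> (f p q) (f (coord_inv \<A> p (fst z)) (coord_inv \<B> q (snd z)))) has_derivative L)
       (at (coord \<A> p p, coord \<B> q q))"
    using f unfolding has_tangent_map2_def by blast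
  have "((\<lambda>y. (coord \<A> p p, y)) has_derivative (\<lambda>w. (0, w))) (at (coord \<B> q q))"
    by (intro has_derivative_Pair has_derivative_ident has_derivative_const)
  from has_derivative_compose[OF this L]
  show "((\<lambda>y. coord \<C> (f p q) (f p (coord_inv \<B> q y))) has_derivative (\<lambda>w. L (0, w))) (at (coord \<B> q q))"
    by (simp add: coord_inv_coord[OF MA] base_in_chart_dom[OF MA])
qed

text \<open>The selected chart of \<open>prod_atlas\<close> at \<open>(p, q)\<close> need not be the product of the selected charts,
  which is why maps of two variables are treated by hand.\<close>

lemma holo_map_prod_smooth:
  assumes MA: "complex_manifold J \<A>" and MB: "complex_manifold J' \<B>" and MC: "complex_manifold J'' \<C>"
    and f: "holo_map (map_prod J J') (prod_atlas \<A> \<B>) J'' \<C> (\<lambda>(x, y). f x y)"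
  defines "S \<equiv> \<lambda>p q r. map_prod (coord \<A> p) (coord \<B> q) `
      (chart_dom \<A> p \<times> chart_dom \<B> q \<inter> (\<lambda>(x, y). f x y) -` chart_dom \<C> r)"
    and "F \<equiv> \<lambda>p q r z. coord \<C> r (f (coord_inv \<A> p (fst z)) (coord_inv \<B> q (snd z)))"
  shows "open (S p q r)" and "smooth_on (S p q r) (F p q r)"
    and "z \<in> S p q r \<Longrightarrow> frechet_derivative (F p q r) (at z) (map_prod J J' v) = J'' (frechet_derivative (F p q r) (at z) v)"
proof -
  let ?D = "chart_dom \<A> p \<times> chart_dom \<B> q" and ?\<phi> = "map_prod (coord \<A> p) (coord \<B> q)"
  let ?\<psi> = "map_prod (coord_inv \<A> p) (coord_inv \<B> q)"
  have inj: "inj_on ?\<phi> ?D"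
    by (rule inj_onI) (auto, metis coord_inv_coord[OF MA], metis coord_inv_coord[OF MB])
  have inv: "inv_into ?D ?\<phi> z = ?\<psi> z" if "z \<in> ?\<phi> ` ?D" for z
    using that inv_into_f_f[OF inj] by (auto simp: coord_inv_coord[OF MA] coord_inv_coord[OF MB])
  have contf: "continuous_on UNIV (\<lambda>(x, y). f x y)" using f unfolding holo_map_def by blast
  have imD: "?\<phi> ` ?D = coord \<A> p ` chart_dom \<A> p \<times> coord \<B> q ` chart_dom \<B> q" by auto
  have opD: "open (?\<phi> ` ?D)" unfolding imD by (intro open_Times open_coord_image[OF MA] open_coord_image[OF MB])
  have Seq: "S p q r = ?\<phi> ` ?D \<inter> (\<lambda>z. (\<lambda>(x, y). f x y) (?\<psi> z)) -` chart_dom \<C> r"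
    unfolding S_def by (auto simp: coord_inv_coord[OF MA] coord_inv_coord[OF MB])
  have cont\<psi>: "continuous_on (?\<phi> ` ?D) ?\<psi>"
  proof -
    have 1: "continuous_on (coord \<A> p ` chart_dom \<A> p) (coord_inv \<A> p)"
      "continuous_on (coord \<B> q ` chart_dom \<B> q) (coord_inv \<B> q)"
      using homeomorphism_cont2[OF coord_homeomorphism[OF MA]] homeomorphism_cont2[OF coord_homeomorphism[OF MB]] .
    have "continuous_on (?\<phi> ` ?D) (\<lambda>z. coord_inv \<A> p (fst z))"
      by (rule continuous_on_compose2[OF 1(1) continuous_on_fst[OF continuous_on_id]]) auto
    moreover have "continuous_on (?\<phi> ` ?D) (\<lambda>z. coord_inv \<B> q (snd z))"
      by (rule continuous_on_compose2[OF 1(2) continuous_on_snd[OF continuous_on_id]]) auto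
    ultimately show ?thesis unfolding map_prod_def case_prod_unfold by (rule continuous_on_Pair)
  qed
  show op: "open (S p q r)"
    unfolding Seq
    by (rule continuous_open_preimage[OF continuous_on_compose2[OF contf cont\<psi>] opD open_chart_dom[OF MC]]) simp
  have "(?D, ?\<phi>) \<in> prod_atlas \<A> \<B>"
    unfolding prod_atlas_def using chart_pair_in[OF MA] chart_pair_in[OF MB] by blast
  then have holo: "holo_on (map_prod J J') J'' (S p q r) (coord \<C> r \<circ> (\<lambda>(x, y). f x y) \<circ> inv_into ?D ?\<phi>)"
    using f chart_pair_in[OF MC, of r] unfolding holo_map_def S_def by blast
  have eq: "(coord \<C> r \<circ> (\<lambda>(x, y). f x y) \<circ> inv_into ?D ?\<phi>) z = F p q r z" if "z \<in> S p q r" for z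
    using inv[of z] that unfolding Seq F_def by (auto simp: case_prod_unfold)
  have fd: "frechet_derivative (coord \<C> r \<circ> (\<lambda>(x, y). f x y) \<circ> inv_into ?D ?\<phi>) (at z) = frechet_derivative (F p q r) (at z)"
    if "z \<in> S p q r" for z
    by (rule frechet_derivative_cong_open[OF op that eq])
  show "smooth_on (S p q r) (F p q r)"
    unfolding smooth_on_def
  proof
    fix k
    show "Ck_on k (S p q r) (F p q r)"
    proof (rule Ck_on_cong_open[OF op])
      show "Ck_on k (S p q r) (coord \<C> r \<circ> (\<lambda>(x, y). f x y) \<circ> inv_into ?D ?\<phi>)"
        using holo unfolding holo_on_def smooth_on_def by blast
    qed (rule eq)
  qed
  assume z: "z \<in> S p q r"
  show "frechet_derivative (F p q r) (at z) (map_prod J J' v) = J'' (frechet_derivative (F p q r) (at z) v)"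
    unfolding fd[OF z, symmetric] using holo z unfolding holo_on_def by blast
qed

section \<open>One-parameter subgroups\<close>

lemma holo_map_has_tangent_map2:
  assumes MA: "complex_manifold J \<A>" and MB: "complex_manifold J' \<B>" and MC: "complex_manifold J'' \<C>"
    and f: "holo_map (map_prod J J') (prod_atlas \<A> \<B>) J'' \<C> (\<lambda>(x, y). f x y)"
  obtains L where "has_tangent_map2 \<A> \<B> \<C> f p q L" "\<And>v. L (map_prod J J' v) = J'' (L v)" "linear L"
proof -
  let ?S = "map_prod (coord \<A> p) (coord \<B> q) `
      (chart_dom \<A> p \<times> chart_dom \<B> q \<inter> (\<lambda>(x, y). f x y) -` chart_dom \<C> (f p q))"
  let ?F = "\<lambda>z. coord \<C> (f p q) (f (coord_inv \<A> p (fst z)) (coord_inv \<B> q (snd z)))"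
  let ?z = "(coord \<A> p p, coord \<B> q q)"
  have z: "?z \<in> ?S"
    using base_in_chart_dom[OF MA, of p] base_in_chart_dom[OF MB, of q] base_in_chart_dom[OF MC, of "f p q"]
    by (intro image_eqI[of _ _ "(p, q)"]) auto
  have "Ck_on (Suc 0) ?S ?F"
    using holo_map_prod_smooth(2)[OF MA MB MC f, of p q "f p q"] unfolding smooth_on_def by blast
  then have "?F differentiable (at ?z)"
    unfolding Ck_on.simps by (elim conjE) (erule bspec[OF _ z])
  then have L: "(?F has_derivative frechet_derivative ?F (at ?z)) (at ?z)"
    unfolding frechet_derivative_works .
  have "isCont (\<lambda>(x, y). f x y) (p, q)"
    using f unfolding holo_map_def by (simp add: continuous_on_eq_continuous_at)
  with L have "has_tangent_map2 \<A> \<B> \<C> f p q (frechet_derivative ?F (at ?z))"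
    unfolding has_tangent_map2_def by blast
  moreover have "frechet_derivative ?F (at ?z) (map_prod J J' v) = J'' (frechet_derivative ?F (at ?z) v)" for v
    using holo_map_prod_smooth(3)[OF MA MB MC f z] .
  moreover have "linear (frechet_derivative ?F (at ?z))"
    using has_derivative_bounded_linear[OF L] by (rule bounded_linear.linear)
  ultimately show thesis using that by blast
qed

lemma velocity_shift:
  assumes "velocity \<A> (\<lambda>h. c (t + h)) 0 v"
  shows "velocity \<A> c t v"
  unfolding velocity_def
proof
  have c: "isCont (\<lambda>h. c (t + h)) (t - t)"
    and d: "((\<lambda>h. coord \<A> (c t) (c (t + h))) has_derivative (\<lambda>r. r *\<^sub>R v)) (at (t - t))"
    using assms unfolding velocity_def has_vector_derivative_def by simp_all
  have "isCont (\<lambda>s. c (t + (s - t))) t" by (rule isCont_o2[where f = "\<lambda>s. s - t", OF _ c]) (intro continuous_intros)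
  then show "isCont c t" by simp
  have "((\<lambda>s. s - t) has_derivative (\<lambda>s. s)) (at t)" by (intro derivative_eq_intros) auto
  from has_derivative_compose[OF this, OF d]
  show "((\<lambda>s. coord \<A> (c t) (c s)) has_vector_derivative v) (at t)"
    unfolding has_vector_derivative_def by simp
qed

lemma velocity_scale:
  assumes "velocity \<A> c 0 v"
  shows "velocity \<A> (\<lambda>s. c (a * s)) 0 (a *\<^sub>R v)"
  unfolding velocity_def
proof
  have c: "isCont c (a * 0)" and d: "((\<lambda>s. coord \<A> (c 0) (c s)) has_derivative (\<lambda>r. r *\<^sub>R v)) (at (a * 0))"
    using assms unfolding velocity_def has_vector_derivative_def by simp_all
  show "isCont (\<lambda>s. c (a * s)) 0" by (rule isCont_o2[where f = "\<lambda>s. a * s", OF _ c]) (intro continuous_intros)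
  have "((\<lambda>s. a * s) has_derivative (\<lambda>s. a * s)) (at 0)" by (intro derivative_eq_intros) auto
  from has_derivative_compose[OF this, OF d]
  show "((\<lambda>s. coord \<A> (c (a * 0)) (c (a * s))) has_vector_derivative a *\<^sub>R v) (at 0)"
    unfolding has_vector_derivative_def by (simp add: mult.commute)
qed

locale complex_lie = group H for H :: "'g::{t2_space,second_countable_topology} monoid" (structure) +
  fixes J :: "'l::fin_dim_space \<Rightarrow> 'l" and \<A> :: "('g, 'l) atlas"
  assumes clg: "complex_lie_group J \<A> H"
begin

lemma M: "complex_manifold J \<A>" and carrier_UNIV [simp]: "carrier H = UNIV"
  and mult_holo: "holo_map (map_prod J J) (prod_atlas \<A> \<A>) J \<A> (\<lambda>(x, y). x \<otimes> y)"
  using clg unfolding complex_lie_group_def by auto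

lemma mult_assoc: "(x \<otimes> y) \<otimes> z = x \<otimes> (y \<otimes> z)"
  by (rule m_assoc) simp_all

lemma one_simps [simp]: "\<one> \<otimes> x = x" "x \<otimes> \<one> = x" "inv x \<otimes> x = \<one>" "x \<otimes> inv x = \<one>"
  by simp_all

text \<open>Multiplication by the identity on either side is the identity map, so both partial
  derivatives of the product at the identity are the identity; by linearity the full derivative is
  addition.\<close>

lemma velocity_mult_one:
  assumes "velocity \<A> c t v" "c t = \<one>" "velocity \<A> d t w" "d t = \<one>"
  shows "velocity \<A> (\<lambda>s. c s \<otimes> d s) t (v + w)"
proof -
  obtain L where L: "has_tangent_map2 \<A> \<A> \<A> (\<otimes>) \<one> \<one> L" "linear L"
    using holo_map_has_tangent_map2[OF M M M mult_holo] by metis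
  have id: "(\<otimes>) \<one> = (\<lambda>x. x)" by auto
  have "(\<lambda>v. L (v, 0)) = (\<lambda>v. v)" "(\<lambda>w. L (0, w)) = (\<lambda>w. w)"
    using has_tangent_mapD[OF M has_tangent_map2_left[OF M L(1)]]
      has_tangent_mapD[OF M has_tangent_map2_right[OF M L(1)]]
      has_tangent_mapD[OF M has_tangent_map_id[OF M, of "\<one>"]]
    by (simp_all add: id)
  then have "L (v, 0) + L (0, w) = v + w" by metis
  then have "L (v, w) = v + w" using linear_add[OF L(2), of "(v, 0)" "(0, w)"] by simp
  then show ?thesis using velocity_pair[OF M M L(1) assms] by simp
qed

lemma velocity_zero_translate:
  assumes "velocity \<A> c t 0"
  shows "velocity \<A> (\<lambda>s. g \<otimes> c s \<otimes> h) t 0"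
proof -
  obtain L where L: "has_tangent_map2 \<A> \<A> \<A> (\<otimes>) g (c t) L" "linear L"
    using holo_map_has_tangent_map2[OF M M M mult_holo] by metis
  have 1: "velocity \<A> (\<lambda>s. g \<otimes> c s) t 0"
    using velocity_pair[OF M M L(1) velocity_const[OF M] refl assms refl] linear_0[OF L(2)]
    by (simp add: zero_prod_def)
  obtain L' where L': "has_tangent_map2 \<A> \<A> \<A> (\<otimes>) (g \<otimes> c t) h L'" "linear L'"
    using holo_map_has_tangent_map2[OF M M M mult_holo] by metis
  show ?thesis
    using velocity_pair[OF M M L'(1) 1 refl velocity_const[OF M] refl] linear_0[OF L'(2)]
    by (simp add: zero_prod_def)
qed

section \<open>One-parameter subgroups, their uniqueness and the exponential map\<close>

lemma one_param_add: "one_param \<A> H \<gamma> \<xi> \<Longrightarrow> \<gamma> (s + t) = \<gamma> s \<otimes> \<gamma> t"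
  unfolding one_param_def by blast

lemma one_param_zero: assumes "one_param \<A> H \<gamma> \<xi>" shows "\<gamma> 0 = \<one>"
proof -
  have "\<gamma> 0 \<otimes> \<gamma> 0 = \<gamma> 0" using one_param_add[OF assms, of 0 0] by simp
  then show ?thesis using l_cancel_one[of "\<gamma> 0" "\<gamma> 0"] by simp
qed

lemma one_param_minus: assumes "one_param \<A> H \<gamma> \<xi>" shows "\<gamma> t \<otimes> \<gamma> (- t) = \<one>" "inv (\<gamma> t) = \<gamma> (- t)"
proof -
  show "\<gamma> t \<otimes> \<gamma> (- t) = \<one>" using one_param_add[OF assms, of t "- t"] one_param_zero[OF assms] by simp
  then show "inv (\<gamma> t) = \<gamma> (- t)"
    by (intro inv_equality) (use one_param_add[OF assms, of "- t" t] one_param_zero[OF assms] in simp_all)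
qed

lemma one_param_velocity: "one_param \<A> H \<gamma> \<xi> \<Longrightarrow> velocity \<A> \<gamma> 0 \<xi>"
  using one_param_zero[of \<gamma> \<xi>] unfolding velocity_def one_param_def
  by (simp add: comp_def continuous_on_eq_continuous_at)

lemma one_paramI:
  assumes "\<And>s t. \<gamma> (s + t) = \<gamma> s \<otimes> \<gamma> t" "velocity \<A> \<gamma> 0 \<xi>" "continuous_on UNIV \<gamma>"
  shows "one_param \<A> H \<gamma> \<xi>"
proof -
  have "\<gamma> 0 \<otimes> \<gamma> 0 = \<gamma> 0" using assms(1)[of 0 0] by simp
  then have "\<gamma> 0 = \<one>" using l_cancel_one[of "\<gamma> 0" "\<gamma> 0"] by simp
  then show ?thesis using assms unfolding one_param_def velocity_def comp_def by simp
qed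

lemma one_param_scale:
  assumes "one_param \<A> H \<gamma> \<xi>" shows "one_param \<A> H (\<lambda>s. \<gamma> (a * s)) (a *\<^sub>R \<xi>)"
proof (rule one_paramI)
  show "velocity \<A> (\<lambda>s. \<gamma> (a * s)) 0 (a *\<^sub>R \<xi>)"
    by (rule velocity_scale[OF one_param_velocity[OF assms]])
  show "continuous_on UNIV (\<lambda>s. \<gamma> (a * s))"
    using assms unfolding one_param_def
    by (auto intro: continuous_on_compose2[of UNIV \<gamma>] continuous_intros)
qed (simp add: distrib_left one_param_add[OF assms])

text \<open>The quotient \<open>\<delta>\<close> has velocity \<open>- \<xi> + \<xi> = 0\<close> at
  time 0, and at time \<open>t\<close> it is a two-sided translate of its germ at time 0. So its
  velocity vanishes everywhere and it is constant. This makes the definite description in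
  \<open>lie_exp\<close> meaningful.\<close>

lemma one_param_unique:
  assumes g: "one_param \<A> H \<gamma> \<xi>" and g': "one_param \<A> H \<gamma>' \<xi>"
  shows "\<gamma>' = \<gamma>"
proof
  fix t
  define \<delta> where "\<delta> t = \<gamma> (- t) \<otimes> \<gamma>' t" for t
  have "velocity \<A> \<delta> t 0" for t
  proof -
    have "velocity \<A> (\<lambda>s. \<gamma> (- 1 * s)) 0 ((- 1) *\<^sub>R \<xi>)"
      by (rule velocity_scale[OF one_param_velocity[OF g]])
    then have "velocity \<A> (\<lambda>s. \<gamma> (- 1 * s) \<otimes> \<gamma>' s) 0 ((- 1) *\<^sub>R \<xi> + \<xi>)"
      by (rule velocity_mult_one) (simp_all add: one_param_velocity[OF g'] one_param_zero[OF g] one_param_zero[OF g'])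
    then have "velocity \<A> (\<lambda>s. \<gamma> (- s) \<otimes> \<gamma>' s) 0 0" by simp
    then have "velocity \<A> (\<lambda>s. \<gamma> (- t) \<otimes> (\<gamma> (- s) \<otimes> \<gamma>' s) \<otimes> \<gamma>' t) 0 0"
      by (rule velocity_zero_translate)
    moreover have "\<gamma> (- t) \<otimes> (\<gamma> (- s) \<otimes> \<gamma>' s) \<otimes> \<gamma>' t = \<delta> (t + s)" for s
      unfolding \<delta>_def using one_param_add[OF g, of "- t" "- s"] one_param_add[OF g', of s t]
      by (simp add: mult_assoc add.commute)
    ultimately have "velocity \<A> (\<lambda>s. \<delta> (t + s)) 0 0" by simp
    then show ?thesis by (rule velocity_shift)
  qed
  then have "\<delta> t = \<delta> 0" by (rule zero_velocity_constant[OF M])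
  then have "\<gamma> (- t) \<otimes> \<gamma>' t = \<one>" unfolding \<delta>_def by (simp add: one_param_zero[OF g] one_param_zero[OF g'])
  then have "\<gamma> t \<otimes> (\<gamma> (- t) \<otimes> \<gamma>' t) = \<gamma> t" by simp
  then show "\<gamma>' t = \<gamma> t" unfolding mult_assoc[symmetric] one_param_minus(1)[OF g] by simp
qed

lemma lie_exp_one_param:
  assumes "one_param \<A> H \<gamma> \<xi>" shows "lie_exp \<A> H (t *\<^sub>R \<xi>) = \<gamma> t"
proof -
  have "(THE \<gamma>. one_param \<A> H \<gamma> (t *\<^sub>R \<xi>)) = (\<lambda>s. \<gamma> (t * s))"
    using one_param_scale[OF assms, of t] one_param_unique by (intro the_equality) blast+
  then show ?thesis unfolding lie_exp_def by simp
qed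

section \<open>The adjoint representation along one-parameter subgroups\<close>

lemma Ad_tangent_map: "has_tangent_map \<A> \<A> (\<lambda>x. g \<otimes> x \<otimes> inv g) \<one> (Ad \<A> H g)"
proof -
  obtain L where L: "has_tangent_map2 \<A> \<A> \<A> (\<otimes>) g \<one> L"
    using holo_map_has_tangent_map2[OF M M M mult_holo] by metis
  obtain L' where L': "has_tangent_map2 \<A> \<A> \<A> (\<otimes>) (g \<otimes> \<one>) (inv g) L'"
    using holo_map_has_tangent_map2[OF M M M mult_holo] by metis
  have "has_tangent_map \<A> \<A> (\<lambda>x. g \<otimes> x \<otimes> inv g) \<one> (\<lambda>w. L' (L (0, w), 0))"
    using has_tangent_map_compose[OF M M has_tangent_map2_right[OF M L] has_tangent_map2_left[OF M L']] .
  then show ?thesis using has_tangent_mapD[OF M] unfolding Ad_def by metis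
qed

lemma bounded_linear_Ad: "bounded_linear (Ad \<A> H g)"
  using Ad_tangent_map[of g] unfolding has_tangent_map_def by (blast intro: has_derivative_bounded_linear)

lemma Ad_mult: "Ad \<A> H (g \<otimes> h) v = Ad \<A> H g (Ad \<A> H h v)"
proof -
  have 1: "has_tangent_map \<A> \<A> (\<lambda>x. g \<otimes> x \<otimes> inv g) (h \<otimes> \<one> \<otimes> inv h) (Ad \<A> H g)"
    using Ad_tangent_map[of g] by simp
  have "has_tangent_map \<A> \<A> (\<lambda>x. g \<otimes> (h \<otimes> x \<otimes> inv h) \<otimes> inv g) \<one> (\<lambda>v. Ad \<A> H g (Ad \<A> H h v))"
    by (rule has_tangent_map_compose[OF M M Ad_tangent_map 1])
  moreover have "g \<otimes> (h \<otimes> x \<otimes> inv h) \<otimes> inv g = (g \<otimes> h) \<otimes> x \<otimes> inv (g \<otimes> h)" for x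
    by (simp add: inv_mult_group mult_assoc)
  ultimately have "has_tangent_map \<A> \<A> (\<lambda>x. (g \<otimes> h) \<otimes> x \<otimes> inv (g \<otimes> h)) \<one> (\<lambda>v. Ad \<A> H g (Ad \<A> H h v))"
    by (simp only:)
  from has_tangent_mapD[OF M this] have "Ad \<A> H (g \<otimes> h) = (\<lambda>v. Ad \<A> H g (Ad \<A> H h v))"
    unfolding has_tangent_mapD[OF M Ad_tangent_map[of "g \<otimes> h"]] .
  then show ?thesis by metis
qed

lemma Ad_one: "Ad \<A> H \<one> v = v"
proof -
  have "Ad \<A> H \<one> = (\<lambda>v. v)"
    using has_tangent_mapD[OF M Ad_tangent_map[of "\<one>"]] has_tangent_mapD[OF M has_tangent_map_id[OF M, of "\<one>"]]
    by simp
  then show ?thesis by (rule fun_cong)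
qed

text \<open>Near the identity, \<open>Ad g\<close> is expressed by first derivatives of the multiplication in the chart,
  which are differentiable in \<open>g\<close> because the multiplication is \<open>C\<^sup>2\<close>.\<close>

lemma Ad_one_param_differentiable:
  assumes g: "one_param \<A> H \<gamma> \<xi>"
  shows "(\<lambda>t. Ad \<A> H (\<gamma> t) \<eta>) differentiable (at 0)"
proof -
  define \<phi> where "\<phi> = coord \<A> \<one>"
  define \<psi> where "\<psi> = coord_inv \<A> \<one>"
  define D where "D = chart_dom \<A> \<one>"
  define F where "F z = \<phi> (\<psi> (fst z) \<otimes> \<psi> (snd z))" for z
  define S where "S = map_prod \<phi> \<phi> ` (D \<times> D \<inter> (\<lambda>(x, y). x \<otimes> y) -` D)"
  define DF where "DF z = frechet_derivative F (at z)" for z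
  have Feq: "F = (\<lambda>z. \<phi> (\<psi> (fst z) \<otimes> \<psi> (snd z)))" by (rule ext) (rule F_def)
  have "smooth_on S F"
    using holo_map_prod_smooth(2)[OF M M M mult_holo, of "\<one>" "\<one>" "\<one>"]
    unfolding S_def Feq \<phi>_def \<psi>_def D_def .
  then have C2: "Ck_on (Suc (Suc 0)) S F" unfolding smooth_on_def by blast
  have dF: "(F has_derivative DF z) (at z)" if z: "z \<in> S" for z
  proof -
    have "F differentiable (at z)" using C2 unfolding Ck_on.simps by (elim conjE) (erule bspec[OF _ z])
    then show ?thesis unfolding frechet_derivative_works DF_def .
  qed
  have dDF: "(\<lambda>z. DF z v) differentiable (at z)" if z: "z \<in> S" for z v
  proof -
    have "Ck_on (Suc 0) S (\<lambda>x. frechet_derivative F (at x) v)" using C2 by (simp only: Ck_on.simps(2)[of "Suc 0"])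
    then show ?thesis unfolding DF_def Ck_on.simps by (elim conjE) (erule bspec[OF _ z])
  qed
  have \<psi>\<phi>: "\<psi> (\<phi> x) = x" if "x \<in> D" for x using that coord_inv_coord[OF M] unfolding \<psi>_def \<phi>_def D_def by simp
  have one: "\<one> \<in> D" unfolding D_def by (rule base_in_chart_dom[OF M])
  have inS: "(\<phi> x, \<phi> y) \<in> S" if "x \<in> D" "y \<in> D" "x \<otimes> y \<in> D" for x y
    unfolding S_def using that by (intro image_eqI[of _ _ "(x, y)"]) auto
  \<comment> \<open>Conjugation is left multiplication by \<open>h\<close> at the identity followed
    by right multiplication by \<open>inv h\<close> at \<open>h\<close>, each a partial derivative
    of \<open>F\<close>. For \<open>h\<close> and \<open>inv h\<close> in \<open>D\<close> all
    intermediate points stay in the same chart.\<close>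
  have Ad_eq: "Ad \<A> H h \<eta> = DF (\<phi> h, \<phi> (inv h)) (DF (\<phi> h, \<phi> \<one>) (0, \<eta>), 0)"
    if h: "h \<in> D" "inv h \<in> D" for h
  proof -
    have 1: "((\<lambda>b. F (\<phi> h, b)) has_derivative (\<lambda>w. DF (\<phi> h, \<phi> \<one>) (0, w))) (at (\<phi> \<one>))"
      by (rule has_derivative_compose[OF has_derivative_Pair[OF has_derivative_const has_derivative_ident]
          dF[OF inS[OF h(1) one]]]) (simp add: h)
    have 2: "((\<lambda>a. F (a, \<phi> (inv h))) has_derivative (\<lambda>v. DF (\<phi> h, \<phi> (inv h)) (v, 0))) (at (\<phi> h))"
      by (rule has_derivative_compose[OF has_derivative_Pair[OF has_derivative_ident has_derivative_const]
          dF[OF inS[OF h]]]) (simp add: one)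
    have Fh: "F (\<phi> h, \<phi> \<one>) = \<phi> h" unfolding F_def by (simp add: \<psi>\<phi> h one)
    have comp: "((\<lambda>b. F (F (\<phi> h, b), \<phi> (inv h))) has_derivative
        (\<lambda>w. DF (\<phi> h, \<phi> (inv h)) (DF (\<phi> h, \<phi> \<one>) (0, w), 0))) (at (\<phi> \<one>))"
      using has_derivative_compose[OF 1, of "\<lambda>a. F (a, \<phi> (inv h))"] 2 unfolding Fh by blast
    have "isCont \<psi> (\<phi> \<one>)" using isCont_coord_inv[OF M] one unfolding \<psi>_def \<phi>_def D_def by blast
    moreover have "isCont (\<lambda>y. h \<otimes> y) (\<psi> (\<phi> \<one>))"
    proof -
      have c: "continuous_on UNIV (\<lambda>(x, y). x \<otimes> y)" using mult_holo unfolding holo_map_def by blast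
      have "continuous_on UNIV (\<lambda>y. (\<lambda>(x, y). x \<otimes> y) (h, y))"
        by (rule continuous_on_compose2[OF c]) (auto intro!: continuous_intros)
      then show ?thesis by (simp add: continuous_on_eq_continuous_at)
    qed
    ultimately have "isCont (\<lambda>b. h \<otimes> \<psi> b) (\<phi> \<one>)" by (rule isCont_o2)
    then have "((\<lambda>b. h \<otimes> \<psi> b) \<longlongrightarrow> h \<otimes> \<psi> (\<phi> \<one>)) (nhds (\<phi> \<one>))"
      unfolding continuous_at using tendsto_at_iff_tendsto_nhds[of "\<lambda>b. h \<otimes> \<psi> b" "\<phi> \<one>"] by blast
    then have "((\<lambda>b. h \<otimes> \<psi> b) \<longlongrightarrow> h) (nhds (\<phi> \<one>))" by (simp add: \<psi>\<phi> one)
    then have "\<forall>\<^sub>F b in nhds (\<phi> \<one>). h \<otimes> \<psi> b \<in> D"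
      using open_chart_dom[OF M] h(1) unfolding D_def by (rule topological_tendstoD)
    then have ev: "\<forall>\<^sub>F b in nhds (\<phi> \<one>). F (F (\<phi> h, b), \<phi> (inv h)) = \<phi> (h \<otimes> \<psi> b \<otimes> inv h)"
      by eventually_elim (simp add: F_def \<psi>\<phi> h)
    have "((\<lambda>b. \<phi> (h \<otimes> \<psi> b \<otimes> inv h)) has_derivative
        (\<lambda>w. DF (\<phi> h, \<phi> (inv h)) (DF (\<phi> h, \<phi> \<one>) (0, w), 0))) (at (\<phi> \<one>))"
      using comp
    proof (rule has_derivative_transform_eventually)
      show "\<forall>\<^sub>F b in at (\<phi> \<one>). F (F (\<phi> h, b), \<phi> (inv h)) = \<phi> (h \<otimes> \<psi> b \<otimes> inv h)"
        using ev by (simp add: eventually_nhds_conv_at)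
      show "F (F (\<phi> h, \<phi> \<one>), \<phi> (inv h)) = \<phi> (h \<otimes> \<psi> (\<phi> \<one>) \<otimes> inv h)"
        using eventually_nhds_x_imp_x[OF ev] .
    qed simp
    moreover have "((\<lambda>b. \<phi> (h \<otimes> \<psi> b \<otimes> inv h)) has_derivative Ad \<A> H h) (at (\<phi> \<one>))"
      using Ad_tangent_map[of h] unfolding has_tangent_map_def \<phi>_def \<psi>_def by simp
    ultimately show ?thesis by (metis has_derivative_unique)
  qed
  have g0: "\<gamma> 0 = \<one>" by (rule one_param_zero[OF g])
  have cont: "isCont \<gamma> 0" using one_param_velocity[OF g] unfolding velocity_def by blast
  have cont': "isCont (\<lambda>t. \<gamma> (- t)) 0"
    by (rule isCont_o2[where f = "\<lambda>t. - t"]) (auto intro: cont continuous_intros)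
  have evD: "\<forall>\<^sub>F t in nhds 0. \<gamma> t \<in> D" "\<forall>\<^sub>F t in nhds 0. \<gamma> (- t) \<in> D"
    using eventually_chart_dom[OF M cont] eventually_chart_dom[OF M cont'] g0 unfolding D_def by simp_all
  define x where "x t = \<phi> (\<gamma> t)" for t
  have x0: "x 0 = \<phi> \<one>" unfolding x_def g0 ..
  have "(x has_vector_derivative \<xi>) (at 0)"
    using one_param_velocity[OF g] g0 unfolding velocity_def x_def \<phi>_def by simp
  then have dx: "x differentiable (at 0)" unfolding has_vector_derivative_def differentiable_def by blast
  have dx': "(\<lambda>t. x (- t)) differentiable (at 0)"
    using velocity_scale[OF one_param_velocity[OF g], of "- 1"] g0
    unfolding velocity_def x_def \<phi>_def has_vector_derivative_def differentiable_def by auto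
  define w where "w t = DF (x t, \<phi> \<one>) (0, \<eta>)" for t
  have dw: "w differentiable (at 0)"
  proof -
    have 1: "(\<lambda>t. (x t, \<phi> \<one>)) differentiable (at 0)" using dx by (intro differentiable_Pair) auto
    have "(\<lambda>z. DF z (0, \<eta>)) differentiable (at (x 0, \<phi> \<one>))"
      unfolding x0 using one by (intro dDF inS) simp_all
    from differentiable_chain_at[OF 1 this] show ?thesis unfolding w_def comp_def .
  qed
  define r where "r b = (\<lambda>u :: 'l. representation model_basis u b)" for b
  \<comment> \<open>Both the point and the argument of \<open>DF\<close> vary with \<open>t\<close>.
    Expanding \<open>w t\<close> in a basis leaves only derivatives in fixed directions, for which
    differentiability is known.\<close>
  define k where "k t = (\<Sum>b\<in>model_basis. r b (w t) *\<^sub>R DF (x t, x (- t)) (b, 0))" for t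
  have "k differentiable (at 0)"
    unfolding k_def
  proof (intro differentiable_sum finite_model_basis ballI differentiable_scaleR)
    fix b :: 'l
    have "linear (r b)"
      unfolding r_def by (intro linearI)
        (simp_all add: representation_add representation_scale independent_model_basis span_model_basis)
    then have "r b differentiable (at (w 0))"
      by (intro linear_imp_bounded_linear[THEN bounded_linear_imp_differentiable])
    from differentiable_chain_at[OF dw this] show "(\<lambda>t. r b (w t)) differentiable (at 0)" unfolding comp_def .
    have 1: "(\<lambda>t. (x t, x (- t))) differentiable (at 0)" using dx dx' by (intro differentiable_Pair)
    have "(\<lambda>z. DF z (b, 0)) differentiable (at (x 0, x (- 0)))"
      using one by (simp add: x0 dDF inS)
    from differentiable_chain_at[OF 1 this] show "(\<lambda>t. DF (x t, x (- t)) (b, 0)) differentiable (at 0)"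
      unfolding comp_def .
  qed
  then obtain L where L: "(k has_derivative L) (at 0)" unfolding differentiable_def by blast
  have ev: "\<forall>\<^sub>F t in nhds 0. k t = Ad \<A> H (\<gamma> t) \<eta>"
    using evD
  proof eventually_elim
    case (elim t)
    then have S: "(x t, x (- t)) \<in> S"
      unfolding x_def using one by (intro inS) (simp_all add: one_param_minus(1)[OF g])
    have lin: "linear (\<lambda>u. DF (x t, x (- t)) (u, 0))"
      using has_derivative_bounded_linear[OF dF[OF S]]
      by (intro linearI) (simp_all add: bounded_linear.linear linear_add[symmetric] linear_scale[symmetric])
    have "w t = (\<Sum>b\<in>model_basis. r b (w t) *\<^sub>R b)"
      unfolding r_def
      by (rule sum_representation_eq[symmetric]) (simp_all add: independent_model_basis span_model_basis finite_model_basis)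
    then have "DF (x t, x (- t)) (w t, 0) = k t"
      unfolding k_def using linear_sum[OF lin] linear_scale[OF lin] by (metis (no_types, lifting) sum.cong)
    then show ?case
      using Ad_eq[OF elim(1)] elim(2) unfolding w_def x_def one_param_minus(2)[OF g] by simp
  qed
  have "((\<lambda>t. Ad \<A> H (\<gamma> t) \<eta>) has_derivative L) (at 0)"
    using L
  proof (rule has_derivative_transform_eventually)
    show "\<forall>\<^sub>F t in at 0. k t = Ad \<A> H (\<gamma> t) \<eta>" using ev by (simp add: eventually_nhds_conv_at)
    show "k 0 = Ad \<A> H (\<gamma> 0) \<eta>" using eventually_nhds_x_imp_x[OF ev] .
  qed simp
  then show ?thesis unfolding differentiable_def by blast
qed

text \<open>The bracket is the derivative at time 0 only. As \<open>Ad\<close> is multiplicative,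
  the derivative at time \<open>t\<close> is the image of that one under the linear map
  \<open>Ad \<A> H (\<gamma> t)\<close>, hence zero too.\<close>

lemma Ad_one_param_fixed:
  assumes g: "one_param \<A> H \<gamma> \<xi>" and br: "lie_bracket \<A> H \<xi> \<eta> = 0"
  shows "Ad \<A> H (\<gamma> t) \<eta> = \<eta>"
proof -
  have "((\<lambda>t. Ad \<A> H (\<gamma> t) \<eta>) has_vector_derivative 0) (at 0)"
    using Ad_one_param_differentiable[OF g, of \<eta>] br
    unfolding vector_derivative_works lie_bracket_def lie_exp_one_param[OF g] by simp
  then have d0: "((\<lambda>t. Ad \<A> H (\<gamma> t) \<eta>) has_derivative (\<lambda>_. 0)) (at 0)"
    unfolding has_vector_derivative_def by simp
  have "((\<lambda>s. Ad \<A> H (\<gamma> s) \<eta>) has_derivative (\<lambda>_. 0)) (at t)" for t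
  proof -
    have "((\<lambda>s. s - t) has_derivative (\<lambda>s. s)) (at t)" by (intro derivative_eq_intros) auto
    from has_derivative_compose[OF this, of "\<lambda>t. Ad \<A> H (\<gamma> t) \<eta>"] d0
    have "((\<lambda>s. Ad \<A> H (\<gamma> (s - t)) \<eta>) has_derivative (\<lambda>_. 0)) (at t)" by simp
    from bounded_linear.has_derivative[OF bounded_linear_Ad this, of "\<gamma> t"]
    have "((\<lambda>s. Ad \<A> H (\<gamma> t) (Ad \<A> H (\<gamma> (s - t)) \<eta>)) has_derivative (\<lambda>_. 0)) (at t)"
      using linear_0[OF bounded_linear.linear[OF bounded_linear_Ad]] by simp
    moreover have "Ad \<A> H (\<gamma> t) (Ad \<A> H (\<gamma> (s - t)) \<eta>) = Ad \<A> H (\<gamma> s) \<eta>" for s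
      using one_param_add[OF g, of t "s - t"] by (simp add: Ad_mult)
    ultimately show ?thesis by simp
  qed
  then have "\<exists>c. \<forall>s\<in>UNIV. Ad \<A> H (\<gamma> s) \<eta> = c"
    by (intro has_derivative_zero_constant) auto
  then have "Ad \<A> H (\<gamma> t) \<eta> = Ad \<A> H (\<gamma> 0) \<eta>" by auto
  then show ?thesis by (simp add: one_param_zero[OF g] Ad_one)
qed

text \<open>Conjugating \<open>\<gamma>'\<close> by a fixed \<open>\<gamma> s\<close> gives a
  one-parameter subgroup with velocity \<open>Ad \<A> H (\<gamma> s) \<eta> = \<eta>\<close>; by
  uniqueness it is \<open>\<gamma>'\<close> itself.\<close>

lemma one_param_commute:
  assumes g: "one_param \<A> H \<gamma> \<xi>" and g': "one_param \<A> H \<gamma>' \<eta>" and br: "lie_bracket \<A> H \<xi> \<eta> = 0"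
  shows "\<gamma> s \<otimes> \<gamma>' t = \<gamma>' t \<otimes> \<gamma> s"
proof -
  define h where "h = \<gamma> s"
  have "one_param \<A> H (\<lambda>t. h \<otimes> \<gamma>' t \<otimes> inv h) \<eta>"
  proof (rule one_paramI)
    fix a b
    have "inv h \<otimes> (h \<otimes> x) = x" for x using mult_assoc[of "inv h" h x] by simp
    then show "h \<otimes> \<gamma>' (a + b) \<otimes> inv h = (h \<otimes> \<gamma>' a \<otimes> inv h) \<otimes> (h \<otimes> \<gamma>' b \<otimes> inv h)"
      by (simp add: one_param_add[OF g'] mult_assoc)
  next
    have "velocity \<A> (\<lambda>t. h \<otimes> \<gamma>' t \<otimes> inv h) 0 (Ad \<A> H h \<eta>)"
      using velocity_compose[OF M one_param_velocity[OF g'], of \<A> "\<lambda>x. h \<otimes> x \<otimes> inv h"] Ad_tangent_map[of h]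
      unfolding one_param_zero[OF g'] by blast
    then show "velocity \<A> (\<lambda>t. h \<otimes> \<gamma>' t \<otimes> inv h) 0 \<eta>"
      unfolding h_def Ad_one_param_fixed[OF g br] .
    have "isCont (\<lambda>x. h \<otimes> x \<otimes> inv h) y" for y
    proof -
      have c: "continuous_on UNIV (\<lambda>(x, y). x \<otimes> y)" using mult_holo unfolding holo_map_def by blast
      have "continuous_on UNIV (\<lambda>x. (\<lambda>(x, y). x \<otimes> y) (h, x))"
        by (rule continuous_on_compose2[OF c]) (auto intro!: continuous_intros)
      then have "continuous_on UNIV (\<lambda>x. (h \<otimes> x, inv h))" by (intro continuous_intros) simp
      then have "continuous_on UNIV (\<lambda>x. (\<lambda>(x, y). x \<otimes> y) (h \<otimes> x, inv h))"
        by (rule continuous_on_compose2[OF c]) simp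
      then show ?thesis by (simp add: continuous_on_eq_continuous_at)
    qed
    then have "continuous_on UNIV (\<lambda>x. h \<otimes> x \<otimes> inv h)" by (simp add: continuous_on_eq_continuous_at)
    then show "continuous_on UNIV (\<lambda>t. h \<otimes> \<gamma>' t \<otimes> inv h)"
      by (rule continuous_on_compose2) (use g' in \<open>auto simp: one_param_def\<close>)
  qed
  from one_param_unique[OF this g'] have "\<gamma>' t = h \<otimes> \<gamma>' t \<otimes> inv h" by metis
  then have "\<gamma>' t \<otimes> h = h \<otimes> \<gamma>' t \<otimes> (inv h \<otimes> h)" using mult_assoc by metis
  then show ?thesis unfolding h_def by simp
qed

lemma one_param_mult:
  assumes g: "one_param \<A> H \<gamma> \<xi>" and g': "one_param \<A> H \<gamma>' \<eta>" and br: "lie_bracket \<A> H \<xi> \<eta> = 0"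
  shows "one_param \<A> H (\<lambda>t. \<gamma> t \<otimes> \<gamma>' t) (\<xi> + \<eta>)"
proof (rule one_paramI)
  show "\<gamma> (s + t) \<otimes> \<gamma>' (s + t) = (\<gamma> s \<otimes> \<gamma>' s) \<otimes> (\<gamma> t \<otimes> \<gamma>' t)" for s t
  proof -
    have "(\<gamma> s \<otimes> \<gamma>' s) \<otimes> (\<gamma> t \<otimes> \<gamma>' t) = \<gamma> s \<otimes> ((\<gamma>' s \<otimes> \<gamma> t) \<otimes> \<gamma>' t)" by (simp only: mult_assoc)
    also have "\<dots> = \<gamma> s \<otimes> ((\<gamma> t \<otimes> \<gamma>' s) \<otimes> \<gamma>' t)" unfolding one_param_commute[OF g g' br] ..
    finally show ?thesis by (simp only: one_param_add[OF g] one_param_add[OF g'] mult_assoc)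
  qed
  show "velocity \<A> (\<lambda>t. \<gamma> t \<otimes> \<gamma>' t) 0 (\<xi> + \<eta>)"
    by (intro velocity_mult_one one_param_velocity one_param_zero[OF g] one_param_zero[OF g'] g g')
  have "continuous_on UNIV (\<lambda>t. (\<gamma> t, \<gamma>' t))" using g g' unfolding one_param_def by (intro continuous_on_Pair) auto
  moreover have "continuous_on UNIV (\<lambda>(x, y). x \<otimes> y)" using mult_holo unfolding holo_map_def by blast
  ultimately have "continuous_on UNIV (\<lambda>t. (\<lambda>(x, y). x \<otimes> y) (\<gamma> t, \<gamma>' t))" by (metis continuous_on_compose2 top_greatest)
  then show "continuous_on UNIV (\<lambda>t. \<gamma> t \<otimes> \<gamma>' t)" by simp
qed

lemma lie_exp_add:
  assumes g: "one_param \<A> H \<gamma> \<xi>" and g': "one_param \<A> H \<gamma>' \<eta>" and br: "lie_bracket \<A> H \<xi> \<eta> = 0"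
  shows "lie_exp \<A> H (\<xi> + \<eta>) = lie_exp \<A> H \<xi> \<otimes> lie_exp \<A> H \<eta>"
  using lie_exp_one_param[OF one_param_mult[OF assms], of 1]
    lie_exp_one_param[OF g, of 1] lie_exp_one_param[OF g', of 1] by simp

end

section \<open>Monotonicity of the momentum map along the flow\<close>

locale kaehler_action = complex_lie H J \<A>
  for H :: "'g::{t2_space,second_countable_topology} monoid" (structure)
    and J :: "'l::fin_dim_space \<Rightarrow> 'l" and \<A> :: "('g, 'l) atlas" +
  fixes U :: "'g set" and \<B> :: "('z::{t2_space,second_countable_topology}, 'e::fin_dim_space) atlas"
    and JZ :: "'e \<Rightarrow> 'e" and \<omega> :: "'z \<Rightarrow> 'e \<Rightarrow> 'e \<Rightarrow> real"
    and act :: "'g \<Rightarrow> 'z \<Rightarrow> 'z" and \<mu> :: "'z \<Rightarrow> 'l \<Rightarrow> real"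
  assumes kaehler: "kaehler_manifold JZ \<B> \<omega>"
    and holo_action: "holomorphic_action J \<A> H JZ \<B> act"
    and ham: "hamiltonian_action \<A> H U \<B> \<omega> act \<mu>"
begin

abbreviation \<uu> where "\<uu> \<equiv> lie_algebra \<A> H U"
abbreviation fund where "fund \<equiv> fundamental_field \<A> H \<B> act"

lemma MB: "complex_manifold JZ \<B>"
  using kaehler unfolding kaehler_manifold_def by blast

lemma act_holo: "holo_map (map_prod J JZ) (prod_atlas \<A> \<B>) JZ \<B> (\<lambda>(g, z). act g z)"
  and act_action: "group_action H UNIV act"
  using holo_action unfolding holomorphic_action_def by blast+

lemma act_continuous: "continuous_on UNIV (\<lambda>(g, z). act g z)"
  using act_holo unfolding holo_map_def by blast

lemma act_mult: "act (g \<otimes> h) z = act g (act h z)"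
  using group_action.composition_rule[OF act_action] by simp

lemma act_one [simp]: "act \<one> z = z"
  using group_action.id_eq_one[OF act_action] by (metis UNIV_I restrict_apply')

text \<open>The fundamental field is the derivative of the action at the identity in the group
  variable. A holomorphic action makes this derivative complex linear, hence the second claim. A
  one-parameter subgroup for \<open>J \<xi>\<close> is assumed because \<open>fund\<close> is
  defined through \<open>lie_exp\<close>.\<close>

lemma action_velocity:
  assumes g: "one_param \<A> H \<gamma> \<xi>"
  shows "velocity \<B> (\<lambda>t. act (\<gamma> t) z) 0 (fund \<xi> z)"
    and "one_param \<A> H \<gamma>' (J \<xi>) \<Longrightarrow> fund (J \<xi>) z = JZ (fund \<xi> z)"
proof -
  obtain L where L: "has_tangent_map2 \<A> \<B> \<B> act \<one> z L" "\<And>v. L (map_prod J JZ v) = JZ (L v)" "linear L"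
    using holo_map_has_tangent_map2[OF M MB MB act_holo, of "\<one>" z] by blast
  have vel: "velocity \<B> (\<lambda>t. act (\<gamma> t) z) 0 (L (\<xi>, 0))" if g: "one_param \<A> H \<gamma> \<xi>" for \<gamma> \<xi>
    by (rule velocity_pair[OF M MB L(1) one_param_velocity[OF g] one_param_zero[OF g] velocity_const[OF MB] refl])
  have fund: "fund \<xi> z = L (\<xi>, 0)" if g: "one_param \<A> H \<gamma> \<xi>" for \<gamma> \<xi>
    unfolding fundamental_field_def lie_exp_one_param[OF g]
    using vel[OF g] unfolding velocity_def one_param_zero[OF g] act_one by (blast intro: vector_derivative_at)
  show "velocity \<B> (\<lambda>t. act (\<gamma> t) z) 0 (fund \<xi> z)" unfolding fund[OF g] by (rule vel[OF g])
  have "linear JZ" using MB unfolding complex_manifold_def complex_structure_def by blast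
  then have "JZ 0 = 0" by (rule linear_0)
  then show "fund (J \<xi>) z = JZ (fund \<xi> z)" if g': "one_param \<A> H \<gamma>' (J \<xi>)"
    unfolding fund[OF g] fund[OF g'] using L(2)[of "(\<xi>, 0)"] by simp
qed

lemma action_velocity_at:
  assumes g: "one_param \<A> H \<gamma> \<xi>"
  shows "velocity \<B> (\<lambda>s. act (\<gamma> s) z) t (fund \<xi> (act (\<gamma> t) z))"
proof (rule velocity_shift)
  have "act (\<gamma> (t + h)) z = act (\<gamma> h) (act (\<gamma> t) z)" for h
    using one_param_add[OF g, of h t] by (simp add: act_mult add.commute)
  then show "velocity \<B> (\<lambda>h. act (\<gamma> (t + h)) z) 0 (fund \<xi> (act (\<gamma> t) z))"
    using action_velocity(1)[OF g, of "act (\<gamma> t) z"] by simp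
qed

text \<open>The orbit curve near time \<open>t\<close> is the image under
  \<open>act (\<gamma> t)\<close> of the curve near time 0, so its velocity is zero at every
  time.\<close>

lemma fund_zero_imp_fixed:
  assumes g: "one_param \<A> H \<gamma> \<xi>" and z: "fund \<xi> z = 0"
  shows "act (\<gamma> t) z = z"
proof -
  have "velocity \<B> (\<lambda>s. act (\<gamma> s) z) t 0" for t
  proof (rule velocity_shift)
    obtain L where L: "has_tangent_map2 \<A> \<B> \<B> act (\<gamma> t) z L" "linear L"
      using holo_map_has_tangent_map2[OF M MB MB act_holo, of "\<gamma> t" z] by blast
    have "velocity \<B> (\<lambda>h. act (\<gamma> t) (act (\<gamma> h) z)) 0 (L (0, 0))"
    proof (rule velocity_pair[OF M MB L(1) velocity_const[OF M] refl])
      show "velocity \<B> (\<lambda>h. act (\<gamma> h) z) 0 0" using action_velocity(1)[OF g, of z] z by simp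
    qed (simp add: one_param_zero[OF g])
    then show "velocity \<B> (\<lambda>h. act (\<gamma> (t + h)) z) 0 0"
      using linear_0[OF L(2)] by (simp add: one_param_add[OF g] act_mult zero_prod_def)
  qed
  then have "act (\<gamma> t) z = act (\<gamma> 0) z" by (rule zero_velocity_constant[OF MB])
  then show ?thesis by (simp add: one_param_zero[OF g])
qed

lemma moment_local:
  assumes "\<beta> \<in> \<uu>"
  shows "(\<lambda>y. \<mu> (coord_inv \<B> p y) \<beta>) differentiable (at (coord \<B> p p))"
proof -
  have "smooth_fun \<B> (\<lambda>z. \<mu> z \<beta>)" using ham assms unfolding hamiltonian_action_def Let_def by blast
  then have "smooth_on (coord \<B> p ` chart_dom \<B> p) ((\<lambda>z. \<mu> z \<beta>) \<circ> coord_inv \<B> p)"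
    using chart_pair_in[OF MB, of p] unfolding smooth_fun_def coord_inv_eq[OF MB] by blast
  then have "Ck_on (Suc 0) (coord \<B> p ` chart_dom \<B> p) ((\<lambda>z. \<mu> z \<beta>) \<circ> coord_inv \<B> p)"
    unfolding smooth_on_def by blast
  then have "((\<lambda>z. \<mu> z \<beta>) \<circ> coord_inv \<B> p) differentiable (at (coord \<B> p p))"
    unfolding Ck_on.simps using base_in_chart_dom[OF MB, of p] by (elim conjE) (erule bspec, blast)
  then show ?thesis unfolding comp_def .
qed

lemma moment_continuous:
  assumes "\<beta> \<in> \<uu>"
  shows "continuous_on UNIV (\<lambda>z. \<mu> z \<beta>)"
proof -
  have "isCont (\<lambda>z. \<mu> z \<beta>) p" for p
  proof -
    have "isCont (\<lambda>z. \<mu> (coord_inv \<B> p (coord \<B> p z)) \<beta>) p"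
      by (rule isCont_o2[OF isCont_coord[OF MB base_in_chart_dom[OF MB]]
          differentiable_imp_continuous_within[OF moment_local[OF assms]]])
    moreover have "\<forall>\<^sub>F z in nhds p. z \<in> chart_dom \<B> p"
      using open_chart_dom[OF MB] base_in_chart_dom[OF MB] by (rule eventually_nhds_in_open)
    then have "\<forall>\<^sub>F z in nhds p. \<mu> (coord_inv \<B> p (coord \<B> p z)) \<beta> = \<mu> z \<beta>"
      by eventually_elim (simp add: coord_inv_coord[OF MB])
    ultimately show ?thesis
      using isCont_cong[of "\<lambda>z. \<mu> (coord_inv \<B> p (coord \<B> p z)) \<beta>" "\<lambda>z. \<mu> z \<beta>" p] by blast
  qed
  then show ?thesis by (simp add: continuous_on_eq_continuous_at)
qed

lemma moment_derivative:
  assumes b: "\<beta> \<in> \<uu>" and c: "velocity \<B> c t v"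
  shows "((\<lambda>s. \<mu> (c s) \<beta>) has_real_derivative \<omega> (c t) (fund \<beta> (c t)) v) (at t)"
proof -
  let ?p = "c t" and ?L = "differential \<B> (\<lambda>z. \<mu> z \<beta>) (c t)"
  have "((\<lambda>y. \<mu> (coord_inv \<B> ?p y) \<beta>) has_derivative ?L) (at (coord \<B> ?p ?p))"
    using moment_local[OF b, of ?p] unfolding differential_def frechet_derivative_works comp_def .
  then have L: "((\<lambda>y. \<mu> (coord_inv \<B> ?p y) \<beta>) has_derivative ?L) (at (coord \<B> ?p (c t)))" .
  have cd: "((\<lambda>s. coord \<B> ?p (c s)) has_derivative (\<lambda>r. r *\<^sub>R v)) (at t)" and cc: "isCont c t"
    using c unfolding velocity_def has_vector_derivative_def by simp_all
  from has_derivative_compose[OF cd L]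
  have "((\<lambda>s. \<mu> (coord_inv \<B> ?p (coord \<B> ?p (c s))) \<beta>) has_derivative (\<lambda>r. r *\<^sub>R ?L v)) (at t)"
    unfolding linear_simps(5)[OF has_derivative_bounded_linear[OF L]] .
  then have "((\<lambda>s. \<mu> (c s) \<beta>) has_derivative (\<lambda>r. r *\<^sub>R ?L v)) (at t)"
  proof (rule has_derivative_transform_eventually)
    have "\<forall>\<^sub>F s in nhds t. \<mu> (coord_inv \<B> ?p (coord \<B> ?p (c s))) \<beta> = \<mu> (c s) \<beta>"
      using eventually_chart_dom[OF MB cc] by eventually_elim (simp add: coord_inv_coord[OF MB])
    then show "\<forall>\<^sub>F s in at t. \<mu> (coord_inv \<B> ?p (coord \<B> ?p (c s))) \<beta> = \<mu> (c s) \<beta>"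
      by (simp add: eventually_nhds_conv_at)
  qed (simp_all add: coord_inv_coord[OF MB] base_in_chart_dom[OF MB])
  moreover have "?L v = \<omega> (c t) (fund \<beta> (c t)) v"
    using ham b unfolding hamiltonian_action_def Let_def by blast
  ultimately show ?thesis
    unfolding has_field_derivative_def by (simp add: mult_commute_abs)
qed

lemma bilinear_omega: "bilinear (\<omega> z)" and omega_skew: "\<omega> z v w = - \<omega> z w v"
proof -
  have "\<forall>z. bilinear (\<omega> z) \<and> (\<forall>v w. \<omega> z v w = - \<omega> z w v)"
    using kaehler unfolding kaehler_manifold_def by (elim conjE)
  note 1 = this[THEN spec, of z]
  show "bilinear (\<omega> z)" using 1 by (rule conjunct1)
  show "\<omega> z v w = - \<omega> z w v" by (rule 1[THEN conjunct2, THEN spec, THEN spec])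
qed

text \<open>The flow of \<open>\<beta> \<in> \<i>\<uu>\<close> is the gradient flow of \<open>- \<mu>\<^sup>J\<^sup>\<beta>\<close>, so that function increases along it.\<close>

lemma moment_flow_derivative:
  fixes z :: 'z and \<gamma> :: "real \<Rightarrow> 'g" and \<beta> :: 'l
  assumes g: "one_param \<A> H \<gamma> \<beta>" and b: "J \<beta> \<in> \<uu>"
  defines "F \<equiv> \<lambda>t. fund \<beta> (act (\<gamma> t) z)"
  shows "((\<lambda>t. - \<mu> (act (\<gamma> t) z) (J \<beta>)) has_real_derivative \<omega> (act (\<gamma> t) z) (F t) (JZ (F t))) (at t)"
proof -
  obtain \<gamma>' where g': "one_param \<A> H \<gamma>' (J \<beta>)" using b unfolding lie_algebra_def by blast
  have "((\<lambda>t. - \<mu> (act (\<gamma> t) z) (J \<beta>)) has_real_derivative - \<omega> (act (\<gamma> t) z) (JZ (F t)) (F t)) (at t)"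
    using DERIV_minus[OF moment_derivative[OF b action_velocity_at[OF g, of z t]]]
    unfolding F_def action_velocity(2)[OF g g'] .
  then show ?thesis using omega_skew[of "act (\<gamma> t) z" "F t" "JZ (F t)"] by simp
qed

lemma kaehler_pos: "\<omega> z v (JZ v) \<ge> 0" and kaehler_eq_0: "\<omega> z v (JZ v) = 0 \<Longrightarrow> v = 0"
proof -
  have "\<forall>z. (\<forall>v w. \<omega> z (JZ v) (JZ w) = \<omega> z v w) \<and> (\<forall>v. v \<noteq> 0 \<longrightarrow> \<omega> z v (JZ v) > 0)"
    using kaehler unfolding kaehler_manifold_def by (elim conjE)
  then have pos: "v \<noteq> 0 \<Longrightarrow> \<omega> z v (JZ v) > 0" by blast
  show "\<omega> z v (JZ v) \<ge> 0"
    by (cases "v = 0") (use pos bilinear_lzero[OF bilinear_omega] in auto)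
  show "\<omega> z v (JZ v) = 0 \<Longrightarrow> v = 0" using pos by fastforce
qed

lemma moment_flow_mono:
  assumes g: "one_param \<A> H \<gamma> \<beta>" and b: "J \<beta> \<in> \<uu>"
  shows "- \<mu> z (J \<beta>) \<le> - \<mu> (act (\<gamma> 1) z) (J \<beta>)"
proof -
  have "- \<mu> (act (\<gamma> 0) z) (J \<beta>) \<le> - \<mu> (act (\<gamma> 1) z) (J \<beta>)"
    using moment_flow_derivative[OF g b, of z] kaehler_pos
    by (intro DERIV_nonneg_imp_nondecreasing[of 0 1 "\<lambda>t. - \<mu> (act (\<gamma> t) z) (J \<beta>)"]) (simp, blast)
  then show ?thesis by (simp add: one_param_zero[OF g])
qed

text \<open>By the mean value theorem the squared speed vanishes at some time \<open>s\<close>, so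
  the point reached at that time is fixed. The whole orbit curve then consists of that
  point.\<close>

lemma moment_flow_strict:
  assumes g: "one_param \<A> H \<gamma> \<beta>" and b: "J \<beta> \<in> \<uu>"
    and eq: "- \<mu> (act (\<gamma> 1) z) (J \<beta>) = - \<mu> z (J \<beta>)"
  shows "act (\<gamma> t) z = z"
proof -
  obtain s where "- \<mu> (act (\<gamma> 1) z) (J \<beta>) - - \<mu> (act (\<gamma> 0) z) (J \<beta>)
      = (1 - 0) * \<omega> (act (\<gamma> s) z) (fund \<beta> (act (\<gamma> s) z)) (JZ (fund \<beta> (act (\<gamma> s) z)))"
    using MVT2[of 0 1 "\<lambda>t. - \<mu> (act (\<gamma> t) z) (J \<beta>)"
        "\<lambda>t. \<omega> (act (\<gamma> t) z) (fund \<beta> (act (\<gamma> t) z)) (JZ (fund \<beta> (act (\<gamma> t) z)))"]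
      moment_flow_derivative[OF g b] by auto
  then have "fund \<beta> (act (\<gamma> s) z) = 0"
    using eq by (intro kaehler_eq_0) (simp add: one_param_zero[OF g])
  then have fixd: "act (\<gamma> r) (act (\<gamma> s) z) = act (\<gamma> s) z" for r by (rule fund_zero_imp_fixed[OF g])
  have "act (\<gamma> (r + s)) z = act (\<gamma> s) z" for r
    using fixd by (simp add: one_param_add[OF g] act_mult)
  from this[of "t - s"] this[of "0 - s"] show ?thesis by (simp add: one_param_zero[OF g])
qed

end

section \<open>Orthonormal bases of subspaces\<close>

lemma sum_linear_on:
  fixes f :: "'l::real_vector \<Rightarrow> real"
  assumes f: "functional_on V f" and V: "subspace V" and B: "finite B" "B \<subseteq> V"
  shows "f (\<Sum>b\<in>B. c b *\<^sub>R b) = (\<Sum>b\<in>B. c b * f b)"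
  using B
proof induction
  case empty
  have "f (0 *\<^sub>R 0) = 0 * f 0" using f subspace_0[OF V] unfolding functional_on_def by blast
  then show ?case by simp
next
  case (insert a B)
  have "c a *\<^sub>R a \<in> V" "(\<Sum>b\<in>B. c b *\<^sub>R b) \<in> V"
    using insert.prems by (auto intro!: subspace_scale[OF V] subspace_sum[OF V])
  then show ?case using insert f unfolding functional_on_def by simp
qed

text \<open>Orthonormal sets are independent, so their size is bounded and a largest one exists. A
  vector different from its expansion would leave a remainder orthogonal to the set, and normalising
  it would enlarge the set. Only properties of \<open>q\<close> on \<open>V\<close> are available,
  so every vector involved has to be kept in \<open>V\<close>.\<close>

lemma orthonormal_basis_exists:
  fixes V :: "'l::fin_dim_space set" and q :: "'l \<Rightarrow> 'l \<Rightarrow> real"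
  assumes V: "subspace V" and lin: "\<And>y. y \<in> V \<Longrightarrow> functional_on V (\<lambda>x. q x y)"
    and sym: "\<And>x y. x \<in> V \<Longrightarrow> y \<in> V \<Longrightarrow> q x y = q y x"
    and pos: "\<And>x. x \<in> V \<Longrightarrow> x \<noteq> 0 \<Longrightarrow> q x x > 0"
  obtains B where "finite B" "B \<subseteq> V" "card B \<le> CARD('l coord_index)"
    "\<And>x. x \<in> V \<Longrightarrow> x = (\<Sum>b\<in>B. q x b *\<^sub>R b)"
proof -
  define on where "on B \<longleftrightarrow> finite B \<and> B \<subseteq> V \<and> (\<forall>a\<in>B. \<forall>b\<in>B. q a b = of_bool (a = b))" for B
  have ind: "independent B" if "on B" for B
  proof -
    have B: "finite B" "B \<subseteq> V" and q: "\<And>a b. a \<in> B \<Longrightarrow> b \<in> B \<Longrightarrow> q a b = of_bool (a = b)"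
      using that unfolding on_def by auto
    show ?thesis
      unfolding independent_explicit_finite_subsets
    proof (intro allI impI ballI)
      fix C u a assume C: "C \<subseteq> B" "finite C" and z: "(\<Sum>v\<in>C. u v *\<^sub>R v) = 0" and a: "a \<in> C"
      have aV: "a \<in> V" using a C B by blast
      have "q 0 a = 0"
        using sum_linear_on[OF lin[OF aV] V, of "{}" "\<lambda>_. 0"] by simp
      then have "0 = q (\<Sum>v\<in>C. u v *\<^sub>R v) a" using z by simp
      also have "\<dots> = (\<Sum>v\<in>C. u v * q v a)" using C B by (intro sum_linear_on[OF lin[OF aV] V]) auto
      also have "\<dots> = (\<Sum>v\<in>C. if v = a then u v else 0)"
      proof (rule sum.cong)
        fix v assume "v \<in> C"
        then have "q v a = of_bool (v = a)" using q C(1) a by blast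
        then show "u v * q v a = (if v = a then u v else 0)" by simp
      qed simp
      also have "\<dots> = u a" using C(2) a by simp
      finally show "u a = 0" by simp
    qed
  qed
  have card: "card B \<le> CARD('l coord_index)" if "on B" for B
    using card_independent_le_coord_index[OF ind[OF that]] by blast
  have "on {}" unfolding on_def by simp
  then obtain B where B: "on B" "\<And>C. on C \<Longrightarrow> card C \<le> card B"
    using ex_has_greatest_nat[of on "{}" card "Suc CARD('l coord_index)"] card by (auto simp: less_Suc_eq_le)
  have Bf: "finite B" "B \<subseteq> V" and q: "\<And>a b. a \<in> B \<Longrightarrow> b \<in> B \<Longrightarrow> q a b = of_bool (a = b)"
    using B(1) unfolding on_def by auto
  have "x = (\<Sum>b\<in>B. q x b *\<^sub>R b)" if x: "x \<in> V" for x
  proof (rule ccontr)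
    assume ne: "x \<noteq> (\<Sum>b\<in>B. q x b *\<^sub>R b)"
    define s where "s = (\<Sum>b\<in>B. q x b *\<^sub>R b)"
    define y where "y = x - s"
    have sV: "s \<in> V" unfolding s_def using Bf by (auto intro!: subspace_scale[OF V] subspace_sum[OF V])
    have yV: "y \<in> V" unfolding y_def using x sV by (rule subspace_diff[OF V])
    have y0: "y \<noteq> 0" using ne unfolding y_def s_def by simp
    have yb: "q y b = 0" if b: "b \<in> B" for b
    proof -
      have bV: "b \<in> V" using b Bf by blast
      have "q s b = (\<Sum>a\<in>B. q x a * q a b)" unfolding s_def by (rule sum_linear_on[OF lin[OF bV] V Bf])
      also have "\<dots> = (\<Sum>a\<in>B. if a = b then q x a else 0)" using q b by (intro sum.cong) auto
      also have "\<dots> = q x b" using Bf(1) b by simp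
      finally have "q s b = q x b" .
      moreover have "q (y + s) b = q y b + q s b" using lin[OF bV] yV sV unfolding functional_on_def by blast
      ultimately show ?thesis unfolding y_def by simp
    qed
    define n where "n = (1 / sqrt (q y y)) *\<^sub>R y"
    have qy: "q y y > 0" by (rule pos[OF yV y0])
    have nV: "n \<in> V" unfolding n_def by (rule subspace_scale[OF V yV])
    have qn: "q n w = (1 / sqrt (q y y)) * q y w" if "w \<in> V" for w
      using lin[OF that] yV unfolding functional_on_def n_def by blast
    have nb: "q n b = 0" if "b \<in> B" for b using qn[of b] yb[OF that] that Bf by auto
    have "q n n = (1 / sqrt (q y y)) * ((1 / sqrt (q y y)) * q y y)"
      using qn[OF nV] qn[OF yV] sym[OF yV nV] by simp
    also have "\<dots> = 1" using qy by (simp add: field_simps)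
    finally have nn: "q n n = 1" .
    have nB: "n \<notin> B" using nb nn by force
    have "on (insert n B)"
      unfolding on_def
    proof (intro conjI ballI)
      have bn: "q b n = 0" if "b \<in> B" for b
        using sym[OF nV subsetD[OF Bf(2) that]] nb[OF that] by simp
      fix a b assume "a \<in> insert n B" "b \<in> insert n B"
      then consider "a = n" "b = n" | "a = n" "b \<in> B" | "a \<in> B" "b = n" | "a \<in> B" "b \<in> B" by blast
      then show "q a b = of_bool (a = b)"
        by cases (use nB in \<open>auto simp: nn nb bn q\<close>)
    qed (use Bf nV in simp_all)
    then have "card (insert n B) \<le> card B" by (rule B(2))
    then show False using nB Bf(1) by simp
  qed
  then show thesis using that Bf card[OF B(1)] by blast
qed

text \<open>Since the number of basis vectors may be less than the dimension of the model space, the family is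
  padded with zeros.\<close>

lemma orthonormal_family_exists:
  fixes V :: "'l::fin_dim_space set" and q :: "'l \<Rightarrow> 'l \<Rightarrow> real"
  assumes V: "subspace V" and lin: "\<And>y. y \<in> V \<Longrightarrow> functional_on V (\<lambda>x. q x y)"
    and sym: "\<And>x y. x \<in> V \<Longrightarrow> y \<in> V \<Longrightarrow> q x y = q y x"
    and pos: "\<And>x. x \<in> V \<Longrightarrow> x \<noteq> 0 \<Longrightarrow> q x x > 0"
  obtains b :: "'l coord_index \<Rightarrow> 'l" where "range b \<subseteq> V" "\<And>x. x \<in> V \<Longrightarrow> x = (\<Sum>i\<in>UNIV. q x (b i) *\<^sub>R b i)"
proof -
  obtain B where B: "finite B" "B \<subseteq> V" "card B \<le> CARD('l coord_index)"
    "\<And>x. x \<in> V \<Longrightarrow> x = (\<Sum>b\<in>B. q x b *\<^sub>R b)"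
    using orthonormal_basis_exists[where V = V and q = q, OF assms] by blast
  obtain f :: "'l \<Rightarrow> 'l coord_index" where f: "inj_on f B"
    using card_le_inj[OF B(1) finite_class.finite_UNIV B(3)] by blast
  define b where "b i = (if i \<in> f ` B then inv_into B f i else 0)" for i
  have "b i \<in> V" for i
    unfolding b_def using subsetD[OF B(2) inv_into_into[of i f B]] subspace_0[OF V] by simp
  then have "range b \<subseteq> V" by blast
  moreover have "x = (\<Sum>i\<in>UNIV. q x (b i) *\<^sub>R b i)" if "x \<in> V" for x
  proof -
    have "(\<Sum>i\<in>UNIV. q x (b i) *\<^sub>R b i) = (\<Sum>i\<in>f ` B. q x (b i) *\<^sub>R b i)"
      by (rule sum.mono_neutral_right) (auto simp: b_def)
    also have "\<dots> = (\<Sum>v\<in>B. q x v *\<^sub>R v)"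
      by (subst sum.reindex[OF f]) (auto simp: b_def f intro!: sum.cong)
    finally show ?thesis using B(4)[OF that] by simp
  qed
  ultimately show thesis using that by blast
qed

section \<open>The convexity theorem\<close>

theorem theorem4p1:
  fixes UC :: "('g::{t2_space,second_countable_topology}) monoid"
    and \<A> :: "('g, 'l::fin_dim_space) atlas" and J :: "'l \<Rightarrow> 'l"
    and U G :: "'g set"
    and \<B> :: "('z::{t2_space,second_countable_topology}, 'e::fin_dim_space) atlas"
    and JZ :: "'e \<Rightarrow> 'e" and \<omega> :: "'z \<Rightarrow> 'e \<Rightarrow> 'e \<Rightarrow> real"
    and act :: "'g \<Rightarrow> 'z \<Rightarrow> 'z" and \<mu> :: "'z \<Rightarrow> 'l \<Rightarrow> real"
    and ip :: "'l \<Rightarrow> 'l \<Rightarrow> real"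
    and X :: "'z set" and \<aa> :: "'l set" and A :: "'g set" and \<nu> :: "'z measure"
  assumes "is_complexification J \<A> UC U" and "compact U" and "connected U"
    and "kaehler_manifold JZ \<B> \<omega>"
    and "holomorphic_action J \<A> UC JZ \<B> act"
    and "hamiltonian_action \<A> UC U \<B> \<omega> act \<mu>"
    and "invariant_scalar_product \<A> UC U ip"
    and "compatible_subgroup J \<A> UC U G" and "closed G" and "connected G"
    and "compact X" and "\<forall>g\<in>G. act g ` X \<subseteq> X"
    and "abelian_subalgebra \<A> UC \<aa>" and "\<aa> \<subseteq> compat_p J \<A> UC U G"
    and "A = lie_exp \<A> UC ` \<aa>"
    and "\<nu> \<in> prob_measures X"
  shows "convex (mean_gradient J ip \<mu> \<aa> ` measure_orbit X act A \<nu>) \<and>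
    mean_gradient J ip \<mu> \<aa> ` (weak_topology X closure_of measure_orbit X act A \<nu>) =
      convex hull (mean_gradient J ip \<mu> \<aa> `
        (invariant_measures X act A \<inter> (weak_topology X closure_of measure_orbit X act A \<nu>)))"
proof -
  have clg: "complex_lie_group J \<A> UC" using assms(1) unfolding is_complexification_def by blast
  then have "group UC" unfolding complex_lie_group_def by blast
  with clg assms(4-6) interpret kaehler_action UC J \<A> U \<B> JZ \<omega> act \<mu>
    by (intro kaehler_action.intro complex_lie.intro complex_lie_axioms.intro kaehler_action_axioms.intro)
  have V: "subspace \<aa>" and br: "\<And>\<xi> \<eta>. \<xi> \<in> \<aa> \<Longrightarrow> \<eta> \<in> \<aa> \<Longrightarrow> lie_bracket \<A> UC \<xi> \<eta> = 0"
    using assms(13) unfolding abelian_subalgebra_def by blast+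
  have linJ: "linear J" and JJ: "\<And>v. J (J v) = - v"
    using M unfolding complex_manifold_def complex_structure_def by blast+
  have ex_param: "\<exists>\<gamma>. one_param \<A> UC \<gamma> \<beta> \<and> range \<gamma> \<subseteq> G" if "\<beta> \<in> \<aa>" for \<beta>
    using assms(14) that unfolding compat_p_def lie_algebra_def by blast
  \<comment> \<open>Both signs occur: \<open>iu_scalar_product\<close> evaluates \<open>ip\<close>
    at \<open>- J \<beta>\<close>, the gradient map evaluates \<mu> at \<open>J \<beta>\<close>.
    Negatives in the Lie algebra are obtained by reversing the time of a one-parameter
    subgroup.\<close>
  have Ju: "- J \<beta> \<in> \<uu>" "J \<beta> \<in> \<uu>" if beta: "\<beta> \<in> \<aa>" for \<beta>
  proof -
    obtain \<eta> where e: "\<eta> \<in> \<uu>" "\<beta> = J \<eta>" using assms(14) beta unfolding compat_p_def by blast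
    then show "- J \<beta> \<in> \<uu>" using JJ by simp
    obtain \<gamma> where g: "one_param \<A> UC \<gamma> \<eta>" "range \<gamma> \<subseteq> U" using e(1) unfolding lie_algebra_def by blast
    from one_param_scale[OF g(1), of "- 1"] g(2) have "- \<eta> \<in> \<uu>" unfolding lie_algebra_def by auto
    then show "J \<beta> \<in> \<uu>" unfolding e(2) JJ .
  qed
  have mu_lin: "functional_on \<uu> (\<mu> z)" for z
    using assms(6) unfolding hamiltonian_action_def Let_def by blast
  \<comment> \<open>The functional on \<aa> that the value of the gradient map at \<open>z\<close>
    has to represent.\<close>
  define l where "l z \<beta> = - \<mu> z (J \<beta>)" for z \<beta>
  have l_lin: "functional_on \<aa> (l z)" for z
    using mu_lin[of z] Ju(2) unfolding functional_on_def l_def by (simp add: linear_add[OF linJ] linear_scale[OF linJ])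
  define q where "q = iu_scalar_product J ip"
  have q: "q \<alpha> \<beta> = ip (- J \<alpha>) (- J \<beta>)" for \<alpha> \<beta> unfolding q_def iu_scalar_product_def ..
  have ip: "\<And>\<eta>. \<eta> \<in> \<uu> \<Longrightarrow> functional_on \<uu> (\<lambda>\<xi>. ip \<xi> \<eta>)"
    "\<And>\<xi> \<eta>. \<xi> \<in> \<uu> \<Longrightarrow> \<eta> \<in> \<uu> \<Longrightarrow> ip \<xi> \<eta> = ip \<eta> \<xi>"
    "\<And>\<xi>. \<xi> \<in> \<uu> \<Longrightarrow> \<xi> \<noteq> 0 \<Longrightarrow> ip \<xi> \<xi> > 0"
    using assms(7) unfolding invariant_scalar_product_def Let_def by blast+
  have q_lin: "functional_on \<aa> (\<lambda>\<alpha>. q \<alpha> \<beta>)" if "\<beta> \<in> \<aa>" for \<beta>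
  proof -
    have J1: "- J (x + y) = - J x + - J y" and J2: "- J (c *\<^sub>R x) = c *\<^sub>R (- J x)" for x y c
      by (simp_all add: linear_add[OF linJ] linear_scale[OF linJ])
    show ?thesis
      using ip(1)[OF Ju(1)[OF that]] Ju(1) unfolding functional_on_def q J1 J2 by blast
  qed
  have q_sym: "q \<alpha> \<beta> = q \<beta> \<alpha>" if "\<alpha> \<in> \<aa>" "\<beta> \<in> \<aa>" for \<alpha> \<beta>
    unfolding q using that by (intro ip(2) Ju(1))
  have q_pos: "q \<alpha> \<alpha> > 0" if "\<alpha> \<in> \<aa>" "\<alpha> \<noteq> 0" for \<alpha>
  proof -
    have "J \<alpha> \<noteq> 0" using JJ[of \<alpha>] linear_0[OF linJ] that(2) by auto
    then show ?thesis unfolding q using that(1) by (intro ip(3) Ju(1)) auto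
  qed
  obtain b :: "'l coord_index \<Rightarrow> 'l" where ba: "range b \<subseteq> \<aa>"
    and bx: "\<And>x. x \<in> \<aa> \<Longrightarrow> x = (\<Sum>i\<in>UNIV. q x (b i) *\<^sub>R b i)"
    using orthonormal_family_exists[where V = \<aa> and q = q, OF V q_lin q_sym q_pos] by blast
  \<comment> \<open>With \<open>m\<close> below, the standard inner product of \<open>m z\<close>
    and \<open>s\<close> becomes \<open>l z (P s)\<close>. The components of \<open>m\<close> at
    padded zeros vanish, and flowing along the kernel of \<open>P\<close> is trivial.\<close>
  define P where "P s = (\<Sum>i\<in>UNIV. s $ i *\<^sub>R b i)" for s :: "real^'l coord_index"
  define m where "m z = (\<chi> i. l z (b i))" for z
  have blP: "bounded_linear P" unfolding P_def by (rule bounded_linear_coord_sum)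
  note linP = bounded_linear.linear[OF blP]
  have Pa: "P s \<in> \<aa>" for s
    unfolding P_def using ba by (intro subspace_sum[OF V] subspace_scale[OF V]) auto
  have rangeP: "range P = \<aa>"
  proof
    show "\<aa> \<subseteq> range P"
    proof
      fix x assume x: "x \<in> \<aa>"
      have "x = P (\<chi> i. q x (b i))" unfolding P_def using bx[OF x] by simp
      then show "x \<in> range P" by blast
    qed
  qed (use Pa in blast)
  have lin_fam: "f (P s) = (\<Sum>i\<in>UNIV. s $ i * f (b i))" if f: "functional_on \<aa> f" for f s
  proof -
    have f0: "f 0 = 0" using f subspace_0[OF V] unfolding functional_on_def by (metis mult_zero_left scaleR_zero_left)
    have "f (\<Sum>i\<in>I. s $ i *\<^sub>R b i) = (\<Sum>i\<in>I. s $ i * f (b i))" for I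
    proof (induction I rule: infinite_finite_induct)
      case (insert i I)
      have "s $ i *\<^sub>R b i \<in> \<aa>" "(\<Sum>i\<in>I. s $ i *\<^sub>R b i) \<in> \<aa>" "b i \<in> \<aa>"
        using ba by (auto intro!: subspace_sum[OF V] subspace_scale[OF V])
      then show ?case using insert f unfolding functional_on_def by simp
    qed (simp_all add: f0)
    then show ?thesis unfolding P_def .
  qed
  have m_inner: "m z \<bullet> s = l z (P s)" for z s
    unfolding lin_fam[OF l_lin] inner_vec_def m_def by (simp add: mult.commute)
  \<comment> \<open>Expanding \<beta> in the orthonormal family shows that \<open>P (m z)\<close>
    represents \<open>l z\<close>. Definiteness of \<open>q\<close> gives uniqueness, so the
    definite description in \<open>gradient_map\<close> really denotes this vector.\<close>
  have grad: "gradient_map J ip \<mu> \<aa> z = P (m z)" for z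
    unfolding gradient_map_def q_def[symmetric] l_def[symmetric]
  proof (rule the_equality)
    have qP: "q (P (m z)) \<beta> = l z \<beta>" if b: "\<beta> \<in> \<aa>" for \<beta>
    proof -
      have "q (P (m z)) \<beta> = (\<Sum>i\<in>UNIV. l z (b i) * q (b i) \<beta>)"
        using lin_fam[OF q_lin[OF b]] unfolding m_def by simp
      also have "\<dots> = (\<Sum>i\<in>UNIV. q \<beta> (b i) * l z (b i))"
        using q_sym[OF b, of "b i" for i] ba by (intro sum.cong) (simp_all add: image_subset_iff mult.commute)
      also have "\<dots> = l z (P (\<chi> i. q \<beta> (b i)))" unfolding lin_fam[OF l_lin] by simp
      also have "P (\<chi> i. q \<beta> (b i)) = \<beta>" unfolding P_def using bx[OF b] by simp
      finally show ?thesis .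
    qed
    show "P (m z) \<in> \<aa> \<and> (\<forall>\<beta>\<in>\<aa>. q (P (m z)) \<beta> = l z \<beta>)" using Pa qP by blast
    fix \<alpha> assume a: "\<alpha> \<in> \<aa> \<and> (\<forall>\<beta>\<in>\<aa>. q \<alpha> \<beta> = l z \<beta>)"
    define d where "d = \<alpha> - P (m z)"
    have d: "d \<in> \<aa>" unfolding d_def using a Pa subspace_diff[OF V] by blast
    have "q (d + P (m z)) d = q d d + q (P (m z)) d"
      using q_lin[OF d] d Pa unfolding functional_on_def by blast
    moreover have "d + P (m z) = \<alpha>" unfolding d_def by simp
    ultimately have "q d d = 0" using a qP[OF d] d by simp
    then have "d = 0" using q_pos[OF d] by force
    then show "\<alpha> = P (m z)" unfolding d_def by simp
  qed
  define \<Phi> where "\<Phi> s = act (lie_exp \<A> UC (P s))" for s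
  have exp_add: "lie_exp \<A> UC (\<xi> + \<eta>) = lie_exp \<A> UC \<xi> \<otimes>\<^bsub>UC\<^esub> lie_exp \<A> UC \<eta>" if "\<xi> \<in> \<aa>" "\<eta> \<in> \<aa>" for \<xi> \<eta>
    using ex_param[OF that(1)] ex_param[OF that(2)] lie_exp_add br[OF that] by blast
  have exp_zero: "lie_exp \<A> UC 0 = \<one>\<^bsub>UC\<^esub>"
  proof -
    obtain \<gamma> where g: "one_param \<A> UC \<gamma> 0" using ex_param[OF subspace_0[OF V]] by blast
    show ?thesis using lie_exp_one_param[OF g, of 0] one_param_zero[OF g] by simp
  qed
  have exp_G: "lie_exp \<A> UC \<xi> \<in> G" if xi: "\<xi> \<in> \<aa>" for \<xi>
  proof -
    obtain \<gamma> where g: "one_param \<A> UC \<gamma> \<xi>" "range \<gamma> \<subseteq> G" using ex_param[OF xi] by blast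
    show ?thesis using lie_exp_one_param[OF g(1), of 1] g(2) by auto
  qed
  \<comment> \<open>On \<aa> the exponential of a sum is a product, so it is a finite product of
    one-parameter subgroups evaluated at coordinates; continuity of \<open>lie_exp\<close> elsewhere
    is not involved.\<close>
  have exp_cont: "continuous_on UNIV (\<lambda>s :: real^'l coord_index. lie_exp \<A> UC (\<Sum>i\<in>I. s $ i *\<^sub>R b i))" for I
  proof (induction I rule: infinite_finite_induct)
    case (insert i I)
    have bi: "b i \<in> \<aa>" using ba by blast
    obtain \<gamma> where g: "one_param \<A> UC \<gamma> (b i)" using ex_param[OF bi] by blast
    have "s $ i *\<^sub>R b i \<in> \<aa>" "(\<Sum>i\<in>I. s $ i *\<^sub>R b i) \<in> \<aa>" for s :: "real^'l coord_index"
      using ba by (auto intro!: subspace_sum[OF V] subspace_scale[OF V])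
    then have eq: "lie_exp \<A> UC (\<Sum>i\<in>insert i I. s $ i *\<^sub>R b i)
        = (\<lambda>(x, y). x \<otimes>\<^bsub>UC\<^esub> y) (\<gamma> (s $ i), lie_exp \<A> UC (\<Sum>i\<in>I. s $ i *\<^sub>R b i))" for s :: "real^'l coord_index"
      using insert.hyps exp_add lie_exp_one_param[OF g] by simp
    have "continuous_on UNIV \<gamma>" using g unfolding one_param_def by blast
    then have "continuous_on UNIV (\<lambda>s :: real^'l coord_index. \<gamma> (s $ i))"
      by (rule continuous_on_compose2) (auto intro!: continuous_intros)
    then have pair: "continuous_on UNIV (\<lambda>s :: real^'l coord_index. (\<gamma> (s $ i), lie_exp \<A> UC (\<Sum>i\<in>I. s $ i *\<^sub>R b i)))"
      using insert.IH by (rule continuous_on_Pair)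
    have "continuous_on UNIV (\<lambda>(x, y). x \<otimes>\<^bsub>UC\<^esub> y)" using mult_holo unfolding holo_map_def by blast
    from continuous_on_compose2[OF this pair] show ?case unfolding eq by simp
  qed simp_all
  interpret gradient_flow X \<Phi> m
  proof
    show "compact X" by (rule assms(11))
    show "continuous_on (UNIV \<times> X) (\<lambda>(s, x). \<Phi> s x)"
    proof -
      have "continuous_on (UNIV \<times> X) (\<lambda>z. lie_exp \<A> UC (P (fst z)))"
        using exp_cont[of UNIV] unfolding P_def[symmetric]
        by (rule continuous_on_compose2) (auto intro!: continuous_intros)
      then have "continuous_on (UNIV \<times> X) (\<lambda>z. (lie_exp \<A> UC (P (fst z)), snd z))"
        by (intro continuous_on_Pair continuous_intros)
      then have "continuous_on (UNIV \<times> X) (\<lambda>z. (\<lambda>(g, z). act g z) (lie_exp \<A> UC (P (fst z)), snd z))"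
        by (rule continuous_on_compose2[OF act_continuous]) simp
      then show ?thesis unfolding \<Phi>_def by (simp add: case_prod_unfold)
    qed
    show "\<Phi> s x \<in> X" if "x \<in> X" for s x
      unfolding \<Phi>_def using assms(12) exp_G[OF Pa] that by blast
    show "\<Phi> (s + t) x = \<Phi> s (\<Phi> t x)" for s t x
      unfolding \<Phi>_def linear_add[OF linP] exp_add[OF Pa Pa] act_mult ..
    show "\<Phi> 0 x = x" for x
      unfolding \<Phi>_def linear_0[OF linP] exp_zero by simp
    have "b i \<in> \<aa>" for i using ba by blast
    then show "continuous_on X m"
      unfolding m_def l_def
      by (intro continuous_on_vec_lambda continuous_on_minus continuous_on_subset[OF moment_continuous] Ju(2)) simp_all
    show "m x \<bullet> s \<le> m (\<Phi> s x) \<bullet> s" for x s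
    proof -
      obtain \<gamma> where g: "one_param \<A> UC \<gamma> (P s)" using ex_param[OF Pa] by blast
      show ?thesis
        using moment_flow_mono[OF g Ju(2)[OF Pa], of x] lie_exp_one_param[OF g, of 1]
        unfolding m_inner l_def \<Phi>_def by simp
    qed
    show "\<Phi> (r *\<^sub>R s) x = x" if "m (\<Phi> s x) \<bullet> s = m x \<bullet> s" for x s r
    proof -
      obtain \<gamma> where g: "one_param \<A> UC \<gamma> (P s)" using ex_param[OF Pa] by blast
      have "lie_exp \<A> UC (P s) = \<gamma> 1" using lie_exp_one_param[OF g, of 1] by simp
      with that moment_flow_strict[OF g Ju(2)[OF Pa], of x r] show ?thesis
        unfolding m_inner l_def \<Phi>_def linear_scale[OF linP] lie_exp_one_param[OF g] by simp
    qed
  qed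
  have Aeq: "A = range (\<lambda>s. lie_exp \<A> UC (P s))" unfolding assms(15) rangeP[symmetric] by (rule image_image)
  have orbit: "measure_orbit X act A \<nu> = measure_orbit X \<Phi> UNIV \<nu>"
    unfolding measure_orbit_def Aeq image_image push_forward_def \<Phi>_def ..
  have inv: "invariant_measures X act A = invariant_measures X \<Phi> UNIV"
    unfolding invariant_measures_def Aeq push_forward_def \<Phi>_def by simp
  \<comment> \<open>A bounded linear map commutes with the Bochner integral, so the statement about
    \<aa> is the image under \<open>P\<close> of the one in coordinates.\<close>
  have mg: "mean_gradient J ip \<mu> \<aa> L = P (mean L)" if "L \<in> prob_measures X" for L
    unfolding mean_gradient_def mean_def grad by (rule integral_bounded_linear[OF blP m_integrable[OF that]])
  have img: "mean_gradient J ip \<mu> \<aa> ` S = P ` mean ` S" if "S \<subseteq> prob_measures X" for S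
    unfolding image_image using mg that by (intro image_cong) auto
  have clX: "weak_topology X closure_of measure_orbit X \<Phi> UNIV \<nu> \<subseteq> prob_measures X"
    using closure_of_subset_topspace[of "weak_topology X" "measure_orbit X \<Phi> UNIV \<nu>"] by simp
  note nu = assms(16)
  have "convex (mean_gradient J ip \<mu> \<aa> ` measure_orbit X act A \<nu>)"
    unfolding orbit img[OF orbit_subset[OF nu]]
    by (rule convex_linear_image[OF linP convex_mean_orbit[OF nu]])
  moreover have "mean_gradient J ip \<mu> \<aa> ` (weak_topology X closure_of measure_orbit X \<Phi> UNIV \<nu>)
      = P ` (convex hull (mean ` (invariant_measures X \<Phi> UNIV \<inter>
          (weak_topology X closure_of measure_orbit X \<Phi> UNIV \<nu>))))"
    unfolding img[OF clX] mean_closure_orbit[OF nu] ..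
  moreover have "\<dots> = convex hull (mean_gradient J ip \<mu> \<aa> ` (invariant_measures X \<Phi> UNIV \<inter>
          (weak_topology X closure_of measure_orbit X \<Phi> UNIV \<nu>)))"
    using clX by (subst img) (auto simp: convex_hull_linear_image[OF linP])
  ultimately show ?thesis unfolding orbit inv by simp
qed

end
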